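(* Let $n \geq 2$ and let $f$ be a real analytic function defined on an open neighborhood of the origin $0 \in \mathbb{R}^n$. Suppose that $\operatorname{codim}_{0}(Z_f) \geq 2$, where $Z_f=\{x: f(x)=0\}$. Then there exists an open neighborhood $U$ of $0$ such that $\log|f| \in W^{1,1}(U)$; that is, $\log|f| \in L^1(U)$ and its distributional gradient on $U$ belongs to $L^1(U)$ (and coincides a.e. with the pointwise gradient $\nabla f/f$ computed off $Z_f$).
   Context: For a real analytic subset $X$ of an open set in $\mathbb{R}^n$, a point $p \in X$ is a smooth point of dimension $d$ if there is an open neighborhood $W$ of $p$ such that $W\cap X$ is a real analytic submanifold of $W$ of dimension $d$. The dimension of $X$ at $p$, $\dim_p X$, is the largest $d$ such that $p$ lies in the closure of the set of smooth points of $X$ of dimension $d$, and $\operatorname{codim}_p X := n - \dim_p X$. If $0 \notin Z_f$ the hypothesis is considered satisfied (and the conclusion is trivial). The hypothesis $\operatorname{codim}_0(Z_f)\ge 2$ in particular excludes $f \equiv 0$, so $Z_f$ has Lebesgue measure zero near $0$ and $\log|f|$ is defined a.e. *)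

theory Defs
  imports "HOL-Analysis.Analysis"
begin

definition real_analytic_on :: "(real^'n \<Rightarrow> real) \<Rightarrow> (real^'n) set \<Rightarrow> bool" where
  "real_analytic_on f S \<longleftrightarrow>
     (\<forall>p\<in>S. \<exists>r>0. \<exists>c :: ('n \<Rightarrow> nat) \<Rightarrow> real.
        \<forall>x\<in>ball p r.
          ((\<lambda>\<alpha>. c \<alpha> * (\<Prod>i\<in>UNIV. (x$i - p$i) ^ \<alpha> i)) has_sum f x) UNIV)"

definition analytic_submanifold :: "(real^'n) set \<Rightarrow> (real^'n) set \<Rightarrow> nat \<Rightarrow> bool" where
  "analytic_submanifold M W d \<longleftrightarrow>
     d \<le> CARD('n) \<and> M \<subseteq> W \<and>
     (\<forall>q\<in>M. \<exists>V. open V \<and> q \<in> V \<and> V \<subseteq> W \<and>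
        (\<exists>g :: nat \<Rightarrow> real^'n \<Rightarrow> real.
           (\<forall>j < CARD('n) - d. real_analytic_on (g j) V) \<and>
           (\<forall>x\<in>V. \<exists>D :: nat \<Rightarrow> real^'n.
               (\<forall>j < CARD('n) - d. (g j has_derivative (\<lambda>h. D j \<bullet> h)) (at x)) \<and>
               (\<forall>a :: nat \<Rightarrow> real. (\<Sum>j < CARD('n) - d. a j *\<^sub>R D j) = 0
                   \<longrightarrow> (\<forall>j < CARD('n) - d. a j = 0))) \<and>
           M \<inter> V = {x\<in>V. \<forall>j < CARD('n) - d. g j x = 0}))"

definition smooth_point :: "(real^'n) set \<Rightarrow> real^'n \<Rightarrow> nat \<Rightarrow> bool" where
  "smooth_point X p d \<longleftrightarrow> p \<in> X \<and>
     (\<exists>W. open W \<and> p \<in> W \<and> analytic_submanifold (W \<inter> X) W d)"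

text \<open>dim_p X = the largest d such that p lies in the closure of the smooth points of
  dimension d (the set of such d is contained in {0..n}; its Sup is 0 if it is empty,
  which only happens for p outside the closure of X).\<close>
definition analytic_dim_at :: "(real^'n) set \<Rightarrow> real^'n \<Rightarrow> nat" where
  "analytic_dim_at X p = Sup {d. p \<in> closure {q. smooth_point X q d}}"

definition analytic_codim_at :: "(real^'n) set \<Rightarrow> real^'n \<Rightarrow> nat" where
  "analytic_codim_at X p = CARD('n) - analytic_dim_at X p"

definition partial_deriv :: "'n \<Rightarrow> (real^'n \<Rightarrow> real) \<Rightarrow> real^'n \<Rightarrow> real" where
  "partial_deriv i g x = deriv (\<lambda>t. g (x + t *\<^sub>R axis i 1)) 0"

fun iter_partial :: "'n list \<Rightarrow> (real^'n \<Rightarrow> real) \<Rightarrow> real^'n \<Rightarrow> real" where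
  "iter_partial [] g = g"
| "iter_partial (i # is) g = partial_deriv i (iter_partial is g)"

definition smooth_fun :: "(real^'n \<Rightarrow> real) \<Rightarrow> bool" where
  "smooth_fun \<phi> \<longleftrightarrow>
     (\<forall>is. continuous_on UNIV (iter_partial is \<phi>) \<and>
        (\<forall>i x. (\<lambda>t. iter_partial is \<phi> (x + t *\<^sub>R axis i 1)) differentiable (at 0)))"

definition test_fun :: "(real^'n) set \<Rightarrow> (real^'n \<Rightarrow> real) \<Rightarrow> bool" where
  "test_fun U \<phi> \<longleftrightarrow> smooth_fun \<phi> \<and> compact (closure {x. \<phi> x \<noteq> 0}) \<and> closure {x. \<phi> x \<noteq> 0} \<subseteq> U"

definition weak_gradient_on :: "(real^'n) set \<Rightarrow> (real^'n \<Rightarrow> real) \<Rightarrow> (real^'n \<Rightarrow> real^'n) \<Rightarrow> bool" where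
  "weak_gradient_on U u G \<longleftrightarrow>
     (\<forall>\<phi> i. test_fun U \<phi> \<longrightarrow>
        (LINT x:U|lebesgue. u x * partial_deriv i \<phi> x) = - (LINT x:U|lebesgue. G x $ i * \<phi> x))"

definition L1_on :: "(real^'n) set \<Rightarrow> (real^'n \<Rightarrow> real) \<Rightarrow> bool" where
  "L1_on U u \<longleftrightarrow> set_integrable lebesgue U u"

end

theory Submission
  imports Defs "HOL-Complex_Analysis.Complex_Analysis"
begin

text \<open>
  Fix a direction \<open>v\<close> with \<open>f v \<noteq> 0\<close> and expand \<open>f\<close> in a power series, so that
  \<open>t \<mapsto> f (x + t v)\<close> becomes a holomorphic function on a fixed disc whose zeros
  \<open>\<xi>\<close> number at most \<open>N\<close>, uniformly in \<open>x\<close> near \<open>0\<close>.  Let \<open>k\<close> be the largest number of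
  distinct zeros over real \<open>x\<close>.  The sum over all \<open>k\<close>-tuples of zeros of the product of their
  differences is a polynomial in the power sums of the zeros, hence an analytic function \<open>D\<close> of \<open>x\<close>;
  it is nonzero exactly where there are \<open>k\<close> distinct zeros, and there it is bounded by a constant
  times the distance of any two of them.  If \<open>D x \<noteq> 0\<close>, a real zero on the line through \<open>x\<close> would
  lie on a smooth hypersurface contained in the zero set, which the codimension hypothesis forbids.
  So all zeros are non-real, come in conjugate pairs, and satisfy \<open>\<bar>Im \<xi>\<bar> \<ge> const * \<bar>D x\<bar>\<close>.  Hence
  the integral of \<open>\<bar>\<partial>\<^sub>v f / f\<bar>\<close> over the line is \<open>O(1 + \<bar>ln \<bar>D x\<bar>\<bar>)\<close>, and the logarithm of a
  nonzero analytic function is locally integrable.  On almost every line \<open>f\<close> has no zero, so one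
  may integrate by parts there; the coordinate derivatives are combinations of derivatives in
  admissible directions.

  Fubini is used in the form \<open>2a \<integral> g(x) dx = \<integral> \<integral>\<^sub>-\<^sub>a\<^sup>a g(x + t v) dt dx\<close>, with the base point \<open>x\<close>
  ranging over the whole space; this avoids adapted coordinates and any induction on the dimension.
\<close>

section \<open>Zeros of a holomorphic function on a disc\<close>

lemma holomorphic_factor_zorder:
  assumes hol: "h holomorphic_on S" and S: "open S" "connected S" and \<xi>: "\<xi> \<in> S"
    and nonzero: "\<exists>t\<in>S. h t \<noteq> 0"
  obtains u where "u holomorphic_on S" "u \<xi> \<noteq> 0"
    "\<And>t. t \<in> S \<Longrightarrow> h t = u t * (t - \<xi>) ^ nat (zorder h \<xi>)"
proof -
  define g n where "g = zor_poly h \<xi>" and "n = nat (zorder h \<xi>)"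
  obtain r where r: "r > 0" "cball \<xi> r \<subseteq> S" and g: "g holomorphic_on cball \<xi> r"
    and local_factor: "\<And>w. w \<in> cball \<xi> r \<Longrightarrow> h w = g w * (w - \<xi>) ^ n \<and> g w \<noteq> 0"
    using zorder_exist_zero[OF hol S \<xi> nonzero] unfolding g_def n_def by blast
  define u where "u = (\<lambda>w. if w = \<xi> then g \<xi> else h w / (w - \<xi>) ^ n)"
  have "u holomorphic_on S - {\<xi>}"
    by (rule holomorphic_transform[where f = "\<lambda>w. h w / (w - \<xi>) ^ n"])
       (auto simp: u_def intro!: holomorphic_intros holomorphic_on_subset[OF hol])
  moreover have "u holomorphic_on ball \<xi> r"
    by (rule holomorphic_transform[OF holomorphic_on_subset[OF g]]) (auto simp: u_def local_factor)
  ultimately have "u holomorphic_on (S - {\<xi>}) \<union> ball \<xi> r"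
    using S by (intro holomorphic_on_Un) auto
  moreover have "S \<subseteq> (S - {\<xi>}) \<union> ball \<xi> r" using r by auto
  ultimately have "u holomorphic_on S" by (rule holomorphic_on_subset)
  moreover have "u \<xi> \<noteq> 0" using local_factor[of \<xi>] r by (simp add: u_def)
  moreover have "h t = u t * (t - \<xi>) ^ n" if "t \<in> S" for t
    using local_factor[of \<xi>] r by (auto simp: u_def)
  ultimately show ?thesis using that unfolding n_def by blast
qed

lemma holomorphic_factor_finite_zorder:
  assumes hol: "h holomorphic_on S" and S: "open S" "connected S" and nonzero: "\<exists>t\<in>S. h t \<noteq> 0"
    and Z: "finite Z" "Z \<subseteq> S"
  shows "\<exists>u. u holomorphic_on S \<and> (\<forall>\<xi>\<in>Z. u \<xi> \<noteq> 0) \<and>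
           (\<forall>t\<in>S. h t = u t * (\<Prod>\<xi>\<in>Z. (t - \<xi>) ^ nat (zorder h \<xi>)))"
  using Z
proof (induction Z rule: finite_induct)
  case empty
  then show ?case using hol by (intro exI[of _ h]) auto
next
  case (insert \<xi> Z)
  define P where "P = (\<lambda>t. \<Prod>\<xi>\<in>Z. (t - \<xi>) ^ nat (zorder h \<xi>))"
  obtain u where u: "u holomorphic_on S" "\<forall>\<xi>\<in>Z. u \<xi> \<noteq> 0" and h: "\<And>t. t \<in> S \<Longrightarrow> h t = u t * P t"
    using insert unfolding P_def by blast
  have \<xi>: "\<xi> \<in> S" using insert.prems by blast
  have "\<exists>t\<in>S. u t \<noteq> 0" using nonzero h by force
  then obtain u' where u': "u' holomorphic_on S" "u' \<xi> \<noteq> 0"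
    and factor: "\<And>t. t \<in> S \<Longrightarrow> u t = u' t * (t - \<xi>) ^ nat (zorder u \<xi>)"
    using holomorphic_factor_zorder[OF u(1) S \<xi>] by blast
  have "zorder h \<xi> = zorder (\<lambda>t. u t * P t) \<xi>"
    using eventually_nhds_in_open[OF S(1) \<xi>]
    by (intro zorder_cong refl) (auto simp: eventually_at_filter h elim!: eventually_mono)
  also have "\<dots> = zorder u \<xi> + zorder P \<xi>"
  proof (rule zorder_times_analytic)
    show "u analytic_on {\<xi>}" using u(1) S(1) \<xi> by (auto simp: analytic_at)
    show "P analytic_on {\<xi>}" unfolding P_def by (intro analytic_intros)
    obtain t where "t \<in> S" "h t \<noteq> 0" using nonzero by blast
    then have "\<forall>\<^sub>F t in at \<xi>. h t \<noteq> 0 \<and> t \<in> S" by (rule non_zero_neighbour_alt[OF hol S \<xi>])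
    then show "\<forall>\<^sub>F t in at \<xi>. u t * P t \<noteq> 0" by eventually_elim (use h in auto)
  qed
  also have "zorder P \<xi> = 0"
    unfolding P_def using insert.hyps by (intro zorder_eq_0I analytic_intros) auto
  finally have "nat (zorder u \<xi>) = nat (zorder h \<xi>)" by simp
  then have "h t = u' t * (\<Prod>\<xi>\<in>insert \<xi> Z. (t - \<xi>) ^ nat (zorder h \<xi>))" if "t \<in> S" for t
    using insert.hyps by (simp add: h[OF that] factor[OF that] P_def)
  moreover have "u' \<xi>' \<noteq> 0" if "\<xi>' \<in> insert \<xi> Z" for \<xi>'
    using that u(2) u'(2) factor[of \<xi>'] insert.prems by auto
  ultimately show ?case using u'(1) by blast
qed

lemma winding_number_circlepath_outside:
  assumes "0 < s" "norm w > s"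
  shows "winding_number (circlepath 0 s) w = 0"
  by (rule winding_number_zero_outside[where s = "cball 0 s"]) (use assms in auto)

definition disc_zeros :: "(complex \<Rightarrow> complex) \<Rightarrow> real \<Rightarrow> complex set" where
  "disc_zeros h \<rho> = {t \<in> ball 0 \<rho>. h t = 0}"

definition zero_mult :: "(complex \<Rightarrow> complex) \<Rightarrow> complex \<Rightarrow> nat" where
  "zero_mult h \<xi> = nat (zorder h \<xi>)"

definition zero_count_bound :: "real \<Rightarrow> real \<Rightarrow> real" where
  "zero_count_bound c M = ln (M / c) / ln (3/2)"

locale bounded_disc_function =
  fixes h :: "complex \<Rightarrow> complex" and \<rho> c M :: real
  assumes radius_pos: "0 < \<rho>" and holomorphic_h: "h holomorphic_on ball 0 (5 * \<rho>)"
    and norm_h_le: "\<And>t. norm t \<le> 4 * \<rho> \<Longrightarrow> norm (h t) \<le> M"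
    and lower_bound_pos: "0 < c" and norm_h_ge: "\<And>t. norm t = \<rho> \<Longrightarrow> c \<le> norm (h t)"
begin

abbreviation Z :: "complex set" where "Z \<equiv> disc_zeros h \<rho>"

text \<open>
  The factors have modulus at most \<open>1\<close> on the circle of radius \<open>\<rho>\<close> and at least \<open>3/2\<close> on the
  circle of radius \<open>4\<rho>\<close>, so that the maximum principle bounds both the cofactor and the number of
  zeros.
\<close>

definition zero_product :: "complex \<Rightarrow> complex" where
  "zero_product t = (\<Prod>\<xi>\<in>Z. ((t - \<xi>) / (2 * \<rho>)) ^ zero_mult h \<xi>)"

definition is_cofactor :: "(complex \<Rightarrow> complex) \<Rightarrow> bool" where
  "is_cofactor u \<longleftrightarrow> u holomorphic_on ball 0 (5 * \<rho>) \<and> (\<forall>\<xi>\<in>Z. u \<xi> \<noteq> 0) \<and>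
     (\<forall>t\<in>ball 0 (5 * \<rho>). h t = u t * zero_product t)"

lemma exists_nonzero: "\<exists>t\<in>ball 0 (5 * \<rho>). h t \<noteq> 0"
  using norm_h_ge[of "of_real \<rho>"] lower_bound_pos radius_pos by (intro bexI[of _ "of_real \<rho>"]) auto

lemma finite_zeros_cball:
  assumes "s < 5 * \<rho>"
  shows "finite {t \<in> cball 0 s. h t = 0}"
proof (cases "{t \<in> cball 0 s. h t = 0} = {}")
  case False
  then have "\<not> h constant_on ball 0 (5 * \<rho>)"
    using exists_nonzero assms unfolding constant_on_def by fastforce
  then show ?thesis
    using assms by (intro holomorphic_compact_finite_zeros[OF holomorphic_h]) auto
qed (metis finite.emptyI)

lemma finite_Z: "finite Z"
  by (rule finite_subset[OF _ finite_zeros_cball[of \<rho>]])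
     (use radius_pos in \<open>auto simp: disc_zeros_def\<close>)

lemma norm_zero_less: "\<xi> \<in> Z \<Longrightarrow> norm \<xi> < \<rho>"
  by (simp add: disc_zeros_def)

lemma Z_subset: "Z \<subseteq> ball 0 (5 * \<rho>)"
  using radius_pos by (auto simp: disc_zeros_def)

lemma zorder_zero_pos: "\<xi> \<in> Z \<Longrightarrow> zorder h \<xi> > 0"
  using zorder_exist_zero[OF holomorphic_h open_ball connected_ball, of \<xi>] Z_subset exists_nonzero
  by (auto simp: disc_zeros_def)

lemma zero_mult_pos: "\<xi> \<in> Z \<Longrightarrow> zero_mult h \<xi> > 0"
  using zorder_zero_pos by (simp add: zero_mult_def)

lemma exists_cofactor: "\<exists>u. is_cofactor u"
proof -
  obtain u where u: "u holomorphic_on ball 0 (5 * \<rho>)" "\<forall>\<xi>\<in>Z. u \<xi> \<noteq> 0"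
    and factor: "\<And>t. t \<in> ball 0 (5 * \<rho>) \<Longrightarrow> h t = u t * (\<Prod>\<xi>\<in>Z. (t - \<xi>) ^ zero_mult h \<xi>)"
    using holomorphic_factor_finite_zorder[OF holomorphic_h open_ball connected_ball exists_nonzero
        finite_Z Z_subset]
    unfolding zero_mult_def by blast
  define a :: complex where "a = (2 * of_real \<rho>) ^ (\<Sum>\<xi>\<in>Z. zero_mult h \<xi>)"
  have "zero_product t = (\<Prod>\<xi>\<in>Z. (t - \<xi>) ^ zero_mult h \<xi>) / a" for t
    by (simp add: zero_product_def power_divide prod_dividef a_def power_sum)
  moreover have "a \<noteq> 0" using radius_pos by (simp add: a_def)
  ultimately have "is_cofactor (\<lambda>t. u t * a)"
    unfolding is_cofactor_def using u factor by (auto intro!: holomorphic_intros)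
  then show ?thesis by blast
qed

lemma cofactor_nonzero:
  assumes "is_cofactor u" "norm t \<le> \<rho>"
  shows "u t \<noteq> 0"
proof (cases "h t = 0")
  case True
  then have "norm t \<noteq> \<rho>" using norm_h_ge[of t] lower_bound_pos by auto
  then have "t \<in> Z" using True assms(2) by (simp add: disc_zeros_def)
  then show ?thesis using assms(1) by (simp add: is_cofactor_def)
next
  case False
  then show ?thesis using assms radius_pos by (auto simp: is_cofactor_def)
qed

lemma norm_zero_product_le: "norm t \<le> \<rho> \<Longrightarrow> norm (zero_product t) \<le> 1"
  unfolding zero_product_def prod_norm[symmetric] norm_power
proof (intro prod_le_1 conjI power_le_one)
  fix \<xi> assume "norm t \<le> \<rho>" "\<xi> \<in> Z"
  then have "norm (t - \<xi>) \<le> 2 * \<rho>" using norm_triangle_ineq4[of t \<xi>] norm_zero_less by fastforce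
  then show "norm ((t - \<xi>) / (2 * \<rho>)) \<le> 1" using radius_pos by (simp add: norm_divide)
qed auto

lemma norm_zero_product_ge:
  assumes "norm t = 4 * \<rho>"
  shows "(3/2) ^ (\<Sum>\<xi>\<in>Z. zero_mult h \<xi>) \<le> norm (zero_product t)"
  unfolding zero_product_def prod_norm[symmetric] norm_power power_sum
proof (intro prod_mono conjI power_mono)
  fix \<xi> assume "\<xi> \<in> Z"
  then have "norm (t - \<xi>) \<ge> 3 * \<rho>"
    using norm_triangle_ineq2[of t \<xi>] norm_zero_less assms by fastforce
  then show "3/2 \<le> norm ((t - \<xi>) / (2 * \<rho>))" using radius_pos by (simp add: norm_divide field_simps)
qed auto

lemma cofactor_norm_ge:
  assumes u: "is_cofactor u" and t: "norm t \<le> \<rho>"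
  shows "c \<le> norm (u t)"
proof -
  have hol: "u holomorphic_on ball 0 (5 * \<rho>)" using u by (simp add: is_cofactor_def)
  have on_circle: "c \<le> norm (u z)" if "norm z = \<rho>" for z
  proof -
    have "c \<le> norm (u z) * norm (zero_product z)"
      using u norm_h_ge[OF that] that radius_pos by (simp add: is_cofactor_def norm_mult)
    also have "\<dots> \<le> norm (u z)" using norm_zero_product_le[of z] that by (simp add: mult_left_le)
    finally show ?thesis .
  qed
  have "norm (inverse (u t)) \<le> inverse c"
  proof (rule maximum_modulus_frontier[of "\<lambda>t. inverse (u t)" "cball 0 \<rho>"])
    show "(\<lambda>t. inverse (u t)) holomorphic_on interior (cball 0 \<rho>)"
      using cofactor_nonzero[OF u] radius_pos
      by (intro holomorphic_intros holomorphic_on_subset[OF hol]) auto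
    show "continuous_on (closure (cball 0 \<rho>)) (\<lambda>t. inverse (u t))"
      using cofactor_nonzero[OF u] radius_pos
      by (intro continuous_intros holomorphic_on_imp_continuous_on holomorphic_on_subset[OF hol])
         auto
    show "norm (inverse (u z)) \<le> inverse c" if "z \<in> frontier (cball 0 \<rho>)" for z
      using on_circle[of z] lower_bound_pos that radius_pos
      by (auto simp: norm_inverse intro!: le_imp_inverse_le)
  qed (use t in auto)
  then show ?thesis
    using lower_bound_pos cofactor_nonzero[OF u t] by (auto simp: norm_inverse inverse_le_iff_le)
qed

lemma cofactor_norm_le_div_power:
  assumes u: "is_cofactor u" and t: "norm t \<le> 4 * \<rho>"
  shows "norm (u t) \<le> M / (3/2) ^ (\<Sum>\<xi>\<in>Z. zero_mult h \<xi>)"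
proof (rule maximum_modulus_frontier[of u "cball 0 (4 * \<rho>)"])
  have hol: "u holomorphic_on ball 0 (5 * \<rho>)" using u by (simp add: is_cofactor_def)
  show "u holomorphic_on interior (cball 0 (4 * \<rho>))"
    using radius_pos by (intro holomorphic_on_subset[OF hol]) auto
  show "continuous_on (closure (cball 0 (4 * \<rho>))) u"
    using radius_pos by (intro holomorphic_on_imp_continuous_on holomorphic_on_subset[OF hol]) auto
  show "norm (u z) \<le> M / (3/2) ^ (\<Sum>\<xi>\<in>Z. zero_mult h \<xi>)" if "z \<in> frontier (cball 0 (4 * \<rho>))" for z
  proof -
    have z: "norm z = 4 * \<rho>" using that radius_pos by auto
    have "norm (u z) * (3/2) ^ (\<Sum>\<xi>\<in>Z. zero_mult h \<xi>) \<le> norm (u z) * norm (zero_product z)"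
      by (intro mult_left_mono norm_zero_product_ge z) auto
    also have "\<dots> = norm (h z)" using u z radius_pos by (simp add: is_cofactor_def norm_mult)
    also have "\<dots> \<le> M" using norm_h_le z by simp
    finally show ?thesis by (simp add: field_simps)
  qed
qed (use t in auto)

lemma lower_le_upper: "c \<le> M"
  using norm_h_ge[of "of_real \<rho>"] norm_h_le[of "of_real \<rho>"] radius_pos by simp

lemma cofactor_norm_le:
  assumes "is_cofactor u" "norm t \<le> 4 * \<rho>"
  shows "norm (u t) \<le> M"
proof -
  have "M / (3/2) ^ (\<Sum>\<xi>\<in>Z. zero_mult h \<xi>) \<le> M / 1"
    using lower_le_upper lower_bound_pos by (intro divide_left_mono) auto
  then show ?thesis using cofactor_norm_le_div_power[OF assms] by simp
qed

lemma sum_zero_mult_le: "real (\<Sum>\<xi>\<in>Z. zero_mult h \<xi>) \<le> zero_count_bound c M"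
proof -
  let ?N = "\<Sum>\<xi>\<in>Z. zero_mult h \<xi>"
  obtain u where u: "is_cofactor u" using exists_cofactor by blast
  have "c \<le> M / (3/2) ^ ?N"
    using cofactor_norm_ge[OF u, of 0] cofactor_norm_le_div_power[OF u, of 0] radius_pos by simp
  then have "(3/2) ^ ?N \<le> M / c" using lower_bound_pos by (simp add: field_simps)
  then have "ln ((3/2) ^ ?N) \<le> ln (M / c)" by (intro ln_mono) auto
  then have "real ?N * ln (3/2) \<le> ln (M / c)" unfolding ln_realpow .
  then show ?thesis unfolding zero_count_bound_def by (subst pos_le_divide_eq) auto
qed

lemma zero_count_bound_nonneg: "0 \<le> zero_count_bound c M"
  using sum_zero_mult_le of_nat_0_le_iff order_trans by blast

lemma card_Z_le: "card Z \<le> nat \<lfloor>zero_count_bound c M\<rfloor>"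
proof -
  have "card Z \<le> (\<Sum>\<xi>\<in>Z. zero_mult h \<xi>)"
    using sum_mono[of Z "\<lambda>_. 1" "zero_mult h"] zero_mult_pos by (simp add: Suc_leI)
  then show ?thesis using sum_zero_mult_le by (intro le_nat_floor) linarith
qed

lemma contour_integral_power_log_derivative:
  "contour_integral (circlepath 0 \<rho>) (\<lambda>t. t ^ j * (deriv h t / h t)) =
     2 * of_real pi * \<i> * (\<Sum>\<xi>\<in>Z. of_nat (zero_mult h \<xi>) * \<xi> ^ j)"
proof -
  define B where "B = ball (0::complex) (2 * \<rho>)"
  let ?roots = "{w \<in> B. h w = 0 \<or> w \<in> {}}"
  have finite_roots: "finite ?roots"
    by (rule finite_subset[OF _ finite_zeros_cball[of "2 * \<rho>"]])
       (use radius_pos in \<open>auto simp: B_def\<close>)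
  note outside = winding_number_circlepath_outside[OF radius_pos]
  have on_circle: "h w \<noteq> 0" if "norm w = \<rho>" for w using norm_h_ge[OF that] lower_bound_pos by auto
  have "contour_integral (circlepath 0 \<rho>) (\<lambda>t. t ^ j * (deriv h t / h t)) =
      contour_integral (circlepath 0 \<rho>) (\<lambda>t. deriv h t * t ^ j / h t)"
    by (simp add: mult.commute)
  also have "\<dots> = 2 * pi * \<i> *
      (\<Sum>w\<in>?roots. winding_number (circlepath 0 \<rho>) w * w ^ j * zorder h w)"
  proof (rule argument_principle)
    show "path_image (circlepath 0 \<rho>) \<subseteq> B - ?roots"
      using radius_pos on_circle by (auto simp: B_def)
    show "\<forall>w. w \<notin> B \<longrightarrow> winding_number (circlepath 0 \<rho>) w = 0"
      using radius_pos by (auto simp: B_def intro!: outside)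
    show "h holomorphic_on B - {}"
      using radius_pos by (auto simp: B_def intro!: holomorphic_on_subset[OF holomorphic_h])
  qed (use finite_roots in \<open>auto simp: B_def intro!: holomorphic_intros\<close>)
  also have "(\<Sum>w\<in>?roots. winding_number (circlepath 0 \<rho>) w * w ^ j * zorder h w) =
      (\<Sum>\<xi>\<in>Z. of_nat (zero_mult h \<xi>) * \<xi> ^ j)"
  proof (rule sum.mono_neutral_cong_right[OF finite_roots])
    show "\<forall>w\<in>?roots - Z. winding_number (circlepath 0 \<rho>) w * w ^ j * zorder h w = 0"
      using on_circle outside by (force simp: disc_zeros_def)
    fix \<xi> assume \<xi>: "\<xi> \<in> Z"
    have "winding_number (circlepath 0 \<rho>) \<xi> = 1"
      using norm_zero_less[OF \<xi>] by (intro winding_number_circlepath) simp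
    moreover have "of_int (zorder h \<xi>) = (of_nat (zero_mult h \<xi>) :: complex)"
      using zorder_zero_pos[OF \<xi>] by (simp add: zero_mult_def)
    ultimately show "winding_number (circlepath 0 \<rho>) \<xi> * \<xi> ^ j * zorder h \<xi> =
        of_nat (zero_mult h \<xi>) * \<xi> ^ j"
      by simp
  qed (use radius_pos in \<open>auto simp: disc_zeros_def B_def\<close>)
  finally show ?thesis by simp
qed

end

section \<open>Integrals along a line\<close>

lemma has_real_derivative_arsinh_shift_scale:
  fixes a b t :: real
  assumes b: "b > 0"
  shows "((\<lambda>t. arsinh ((t - a) / b)) has_real_derivative
      1 / sqrt ((t - a)\<^sup>2 + b\<^sup>2)) (at t within S)"
proof -
  have "sqrt (((t - a) / b)\<^sup>2 + 1) * b = sqrt ((((t - a) / b)\<^sup>2 + 1) * b\<^sup>2)"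
    using b by (simp add: real_sqrt_mult)
  also have "(((t - a) / b)\<^sup>2 + 1) * b\<^sup>2 = (t - a)\<^sup>2 + b\<^sup>2"
    using b by (simp add: field_simps power_divide)
  finally have "1 / sqrt ((t - a)\<^sup>2 + b\<^sup>2) = 1 / sqrt (((t - a) / b)\<^sup>2 + 1) * (1 / b)" by simp
  moreover have "((\<lambda>t. arsinh ((t - a) / b)) has_real_derivative
      1 / sqrt (((t - a) / b)\<^sup>2 + 1) * (1 / b)) (at t within S)"
    by (rule DERIV_chain2[OF arsinh_real_has_field_derivative])
       (use b in \<open>auto intro!: derivative_eq_intros\<close>)
  ultimately show ?thesis by simp
qed

lemma arsinh_le_ln:
  fixes y \<delta> :: real
  assumes \<delta>: "0 < \<delta>" "\<delta> \<le> 1" and y: "y \<le> 1 / \<delta>"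
  shows "arsinh y \<le> ln (3 / \<delta>)"
proof -
  have "sqrt ((1/\<delta>)\<^sup>2 + 1) \<le> 1/\<delta> + 1"
    using \<delta> by (intro real_le_lsqrt) (auto simp: power2_eq_square algebra_simps)
  then have "1/\<delta> + sqrt ((1/\<delta>)\<^sup>2 + 1) \<le> 3 / \<delta>" using \<delta> by (simp add: field_simps)
  then have "arsinh (1/\<delta>) \<le> ln (3 / \<delta>)"
    unfolding arsinh_real_def by (intro ln_mono) (use arsinh_real_aux in auto)
  moreover have "arsinh y \<le> arsinh (1 / \<delta>)"
    using y arsinh_real_strict_mono[of y "1 / \<delta>"] by (metis less_eq_real_def)
  ultimately show ?thesis by simp
qed

lemma nn_integral_inverse_dist_le:
  fixes \<xi> :: complex
  assumes \<rho>: "0 < \<rho>" "\<rho> \<le> 1/2" and \<xi>: "norm \<xi> \<le> \<rho>" "\<delta> \<le> \<bar>Im \<xi>\<bar>" and \<delta>: "0 < \<delta>" "\<delta> \<le> 1"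
  shows "(\<integral>\<^sup>+t\<in>{-\<rho>..\<rho>}. ennreal (1 / norm (of_real t - \<xi>)) \<partial>lborel) \<le> ennreal (2 * ln (3 / \<delta>))"
proof -
  define a b where "a = Re \<xi>" and "b = \<bar>Im \<xi>\<bar>"
  have b: "b > 0" "\<delta> \<le> b" using \<xi> \<delta> by (auto simp: b_def)
  have a: "\<bar>a\<bar> \<le> \<rho>" using \<xi>(1) abs_Re_le_cmod[of \<xi>] by (simp add: a_def)
  have "norm (of_real t - \<xi>) = sqrt ((t - a)\<^sup>2 + b\<^sup>2)" for t
    by (simp add: cmod_def a_def b_def)
  then have "((\<lambda>t. arsinh ((t - a) / b)) has_real_derivative
      1 / norm (of_real t - \<xi>)) (at t within {-\<rho>..\<rho>})" for t
    using has_real_derivative_arsinh_shift_scale[OF b(1)] by simp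
  then have "((\<lambda>t. 1 / norm (of_real t - \<xi>)) has_integral
      arsinh ((\<rho> - a) / b) - arsinh ((-\<rho> - a) / b)) {-\<rho>..\<rho>}"
    using \<rho> by (intro fundamental_theorem_of_calculus)
      (auto simp: has_real_derivative_iff_has_vector_derivative)
  then have "(\<integral>\<^sup>+t\<in>{-\<rho>..\<rho>}. ennreal (1 / norm (of_real t - \<xi>)) \<partial>lborel) =
     ennreal (arsinh ((\<rho> - a) / b) - arsinh ((-\<rho> - a) / b))"
    by (intro nn_integral_has_integral_lebesgue') auto
  also have "\<dots> \<le> ennreal (2 * ln (3 / \<delta>))"
  proof (intro ennreal_leI)
    have quotient_le: "x / b \<le> 1 / \<delta>" if "0 \<le> x" "x \<le> 1" for x
      using that b \<delta> by (intro frac_le) auto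
    have "arsinh ((\<rho> - a) / b) \<le> ln (3 / \<delta>)" "arsinh ((\<rho> + a) / b) \<le> ln (3 / \<delta>)"
      using a \<rho> by (intro arsinh_le_ln \<delta> quotient_le; linarith)+
    moreover have "- arsinh ((-\<rho> - a) / b) = arsinh ((\<rho> + a) / b)"
      by (simp flip: arsinh_minus_real add: minus_divide_left add.commute)
    ultimately show "arsinh ((\<rho> - a) / b) - arsinh ((-\<rho> - a) / b) \<le> 2 * ln (3 / \<delta>)" by simp
  qed
  finally show ?thesis .
qed

text \<open>Infinite at \<open>0\<close>, where \<open>ln 0 = 0\<close>, so that finite integrals also show zeros to be negligible.\<close>

definition abs_ln :: "real \<Rightarrow> ennreal" where
  "abs_ln y = (if y = 0 then \<infinity> else ennreal \<bar>ln y\<bar>)"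

lemma abs_ln_measurable [measurable]: "abs_ln \<in> borel_measurable borel"
  unfolding abs_ln_def by measurable

lemma abs_ln_mult: "x \<ge> 0 \<Longrightarrow> y \<ge> 0 \<Longrightarrow> abs_ln (x * y) \<le> abs_ln x + abs_ln y"
  by (auto simp: abs_ln_def ln_mult simp flip: ennreal_plus intro!: ennreal_leI)

lemma abs_ln_prod:
  "(\<And>a. a \<in> A \<Longrightarrow> f a \<ge> 0) \<Longrightarrow> abs_ln (\<Prod>a\<in>A. f a) \<le> (\<Sum>a\<in>A. abs_ln (f a))"
proof (induction A rule: infinite_finite_induct)
  case (insert x F)
  have "abs_ln (f x * prod f F) \<le> abs_ln (f x) + abs_ln (prod f F)"
    using insert.prems by (intro abs_ln_mult) (auto intro: prod_nonneg)
  also have "\<dots> \<le> abs_ln (f x) + (\<Sum>a\<in>F. abs_ln (f a))" using insert by (intro add_left_mono) auto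
  finally show ?case using insert by simp
qed (auto simp: abs_ln_def)

lemma abs_ln_power: "x \<ge> 0 \<Longrightarrow> abs_ln (x ^ n) \<le> of_nat n * abs_ln x"
  using abs_ln_prod[of "{..<n}" "\<lambda>_. x"] by simp

lemma abs_ln_le_between:
  assumes "0 < a" "a \<le> y" "y \<le> b"
  shows "abs_ln y \<le> ennreal (\<bar>ln a\<bar> + \<bar>ln b\<bar>)"
proof -
  have "ln a \<le> ln y" "ln y \<le> ln b" using assms by (auto simp: ln_mono)
  then have "\<bar>ln y\<bar> \<le> \<bar>ln a\<bar> + \<bar>ln b\<bar>" by linarith
  then show ?thesis using assms by (simp add: abs_ln_def ennreal_leI del: ennreal_plus)
qed

lemma abs_ln_le_powr:
  assumes "0 < s" "s \<le> y" "y \<le> 1"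
  shows "abs_ln y \<le> ennreal (2 * s powr (-1/2))"
proof -
  have "\<bar>ln y\<bar> \<le> - ln s" using assms by simp
  also have "\<dots> = 2 * ln (s powr (-1/2))" using assms by (simp add: ln_powr)
  also have "\<dots> \<le> 2 * s powr (-1/2)" using ln_le_minus_one[of "s powr (-1/2)"] assms by simp
  finally show ?thesis using assms by (auto simp: abs_ln_def intro!: ennreal_leI)
qed

lemma nn_integral_abs_powr_neg_half_le:
  "(\<integral>\<^sup>+s\<in>{-1..1}. ennreal (2 * \<bar>s\<bar> powr (-1/2)) \<partial>lborel) \<le> 8"
proof -
  let ?F = "\<lambda>s::real. ennreal (2 * s powr (-1/2)) * indicator {0..1} s"
  have "((\<lambda>s. 2 * s powr (-1/2)) has_integral 4) {0..1::real}"
    using has_integral_mult_right[OF has_integral_powr_from_0[of "-1/2" 1], of 2] by simp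
  then have half: "(\<integral>\<^sup>+s. ?F s \<partial>lborel) = 4"
    by (subst nn_integral_has_integral_lebesgue') auto
  then have reflected_half: "(\<integral>\<^sup>+s. ?F (- s) \<partial>lborel) = 4"
    by (subst nn_integral_real_affine[of _ "-1" 0]) simp_all
  have "(\<integral>\<^sup>+s\<in>{-1..1}. ennreal (2 * \<bar>s\<bar> powr (-1/2)) \<partial>lborel)
      \<le> (\<integral>\<^sup>+s. ?F s + ?F (- s) \<partial>lborel)"
    by (intro nn_integral_mono) (auto simp: indicator_def abs_if)
  also have "\<dots> = 8" by (subst nn_integral_add) (use half reflected_half in simp_all)
  finally show ?thesis .
qed

lemma nn_integral_abs_ln_dist_le:
  fixes \<xi> :: complex
  assumes \<rho>: "0 < \<rho>" and \<xi>: "norm \<xi> \<le> \<rho>"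
  shows "(\<integral>\<^sup>+t\<in>{-\<rho>..\<rho>}. abs_ln (norm ((of_real t - \<xi>) / (2 * \<rho>))) \<partial>lborel) \<le> ennreal (16 * \<rho>)"
proof -
  define a where "a = Re \<xi>"
  define g where "g = (\<lambda>s. ennreal (2 * \<bar>s\<bar> powr (-1/2)) * indicator {-1..1} s)"
  have [measurable]: "g \<in> borel_measurable borel" unfolding g_def by measurable
  have "(\<integral>\<^sup>+t\<in>{-\<rho>..\<rho>}. abs_ln (norm ((of_real t - \<xi>) / (2 * \<rho>))) \<partial>lborel)
     \<le> (\<integral>\<^sup>+t. g ((t - a) / (2 * \<rho>)) \<partial>lborel)"
  proof (rule nn_integral_mono_AE)
    show "AE t in lborel. abs_ln (norm ((of_real t - \<xi>) / (2 * \<rho>))) * indicator {-\<rho>..\<rho>} t \<le>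
        g ((t - a) / (2 * \<rho>))"
      using AE_lborel_singleton[of a]
    proof eventually_elim
      case (elim t)
      show ?case
      proof (cases "t \<in> {-\<rho>..\<rho>}")
        case True
        define s y where "s = (t - a) / (2 * \<rho>)" and "y = norm ((of_real t - \<xi>) / (2 * \<rho>))"
        have y: "y = norm (of_real t - \<xi>) / (2 * \<rho>)" using \<rho> by (simp add: y_def norm_divide)
        have "\<bar>t - a\<bar> \<le> norm (of_real t - \<xi>)"
          using abs_Re_le_cmod[of "of_real t - \<xi>"] by (simp add: a_def)
        then have "\<bar>s\<bar> \<le> y" unfolding y s_def using \<rho> by (simp add: divide_right_mono)
        moreover have "norm (of_real t - \<xi>) \<le> 2 * \<rho>"
          using norm_triangle_ineq4[of "of_real t" \<xi>] \<xi> True by auto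
        then have "y \<le> 1" unfolding y using \<rho> by simp
        moreover have "\<bar>s\<bar> > 0" using elim \<rho> by (simp add: s_def)
        ultimately have "abs_ln y \<le> ennreal (2 * \<bar>s\<bar> powr (-1/2))" "s \<in> {-1..1}"
          using abs_ln_le_powr[of "\<bar>s\<bar>" y] by auto
        then show ?thesis using True unfolding g_def s_def y_def by simp
      qed auto
    qed
  qed
  also have "\<dots> = ennreal (2 * \<rho>) * (\<integral>\<^sup>+s. g s \<partial>lborel)"
    using nn_integral_real_affine[of "\<lambda>t. g ((t - a) / (2 * \<rho>))" "2 * \<rho>" a] \<rho> by simp
  also have "\<dots> \<le> ennreal (2 * \<rho>) * 8"
    unfolding g_def by (intro mult_left_mono nn_integral_abs_powr_neg_half_le) auto
  also have "\<dots> = ennreal (16 * \<rho>)" using \<rho> by (simp flip: ennreal_numeral ennreal_mult)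
  finally show ?thesis .
qed

context bounded_disc_function
begin

lemma zero_product_has_field_derivative:
  assumes "t \<notin> Z"
  shows "(zero_product has_field_derivative
            zero_product t * (\<Sum>\<xi>\<in>Z. of_nat (zero_mult h \<xi>) / (t - \<xi>))) (at t)"
proof -
  let ?f = "\<lambda>(\<xi> :: complex) (t :: complex). ((t - \<xi>) / (2 * \<rho>)) ^ zero_mult h \<xi>"
  let ?f' = "\<lambda>\<xi>. of_nat (zero_mult h \<xi>) / (t - \<xi>) * ?f \<xi> t"
  have nonzero: "?f \<xi> t \<noteq> 0" if "\<xi> \<in> Z" for \<xi> using that assms radius_pos by auto
  have "(?f \<xi> has_field_derivative ?f' \<xi>) (at t)" if "\<xi> \<in> Z" for \<xi>
  proof -
    have "(?f \<xi> has_field_derivative of_nat (zero_mult h \<xi>) *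
        (1 / (2 * \<rho>) * ((t - \<xi>) / (2 * \<rho>)) ^ (zero_mult h \<xi> - Suc 0))) (at t)"
      by (rule DERIV_power) (use radius_pos in \<open>auto intro!: derivative_eq_intros\<close>)
    moreover have "of_nat (zero_mult h \<xi>) *
        (1 / (2 * \<rho>) * ((t - \<xi>) / (2 * \<rho>)) ^ (zero_mult h \<xi> - Suc 0)) = ?f' \<xi>"
      using that assms radius_pos by (cases "zero_mult h \<xi>") auto
    ultimately show ?thesis by simp
  qed
  from has_field_derivative_prod'[of Z ?f t ?f', OF nonzero this]
  have "(zero_product has_field_derivative zero_product t * (\<Sum>\<xi>\<in>Z. ?f' \<xi> / ?f \<xi> t)) (at t)"
    unfolding zero_product_def[abs_def] .
  also have "(\<Sum>\<xi>\<in>Z. ?f' \<xi> / ?f \<xi> t) = (\<Sum>\<xi>\<in>Z. of_nat (zero_mult h \<xi>) / (t - \<xi>))"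
    by (intro sum.cong refl nonzero_mult_div_cancel_right nonzero)
  finally show ?thesis .
qed

lemma log_derivative_eq:
  assumes u: "is_cofactor u" and t: "norm t \<le> \<rho>" "t \<notin> Z"
  shows "deriv h t / h t = deriv u t / u t + (\<Sum>\<xi>\<in>Z. of_nat (zero_mult h \<xi>) / (t - \<xi>))"
proof -
  define P where "P = zero_product"
  have S: "open (ball (0::complex) (5 * \<rho>))" "t \<in> ball 0 (5 * \<rho>)" using t radius_pos by auto
  have hol: "u holomorphic_on ball 0 (5 * \<rho>)" and factor: "\<And>s. s \<in> ball 0 (5 * \<rho>) \<Longrightarrow> h s = u s * P s"
    using u by (auto simp: is_cofactor_def P_def)
  have "((\<lambda>t. u t * P t) has_field_derivative
     deriv u t * P t + P t * (\<Sum>\<xi>\<in>Z. of_nat (zero_mult h \<xi>) / (t - \<xi>)) * u t) (at t)"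
    unfolding P_def
    by (intro DERIV_mult zero_product_has_field_derivative t holomorphic_derivI[OF hol S])
  then have "(h has_field_derivative
     deriv u t * P t + P t * (\<Sum>\<xi>\<in>Z. of_nat (zero_mult h \<xi>) / (t - \<xi>)) * u t) (at t)"
    by (rule has_field_derivative_transform_within_open[OF _ S]) (simp add: factor)
  then have "deriv h t = deriv u t * P t + P t * (\<Sum>\<xi>\<in>Z. of_nat (zero_mult h \<xi>) / (t - \<xi>)) * u t"
    by (rule DERIV_imp_deriv)
  moreover have "P t \<noteq> 0" unfolding P_def zero_product_def using t finite_Z radius_pos by auto
  ultimately show ?thesis
    using cofactor_nonzero[OF u t(1)] factor[OF S(2)] by (simp add: field_simps)
qed

lemma norm_deriv_cofactor_le:
  assumes u: "is_cofactor u" and t: "norm t \<le> \<rho>"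
  shows "norm (deriv u t) \<le> M / \<rho>"
proof -
  have hol: "u holomorphic_on ball 0 (5 * \<rho>)" using u by (simp add: is_cofactor_def)
  have sub: "norm z \<le> 4 * \<rho>" if "dist t z \<le> \<rho>" for z
    using norm_triangle_ineq2[of z t] that t radius_pos by (simp add: dist_norm norm_minus_commute)
  have sub_ball: "cball t \<rho> \<subseteq> ball 0 (5 * \<rho>)" using sub radius_pos by fastforce
  have "norm ((deriv ^^ 1) u t) \<le> fact 1 * M / \<rho> ^ 1"
  proof (rule Cauchy_inequality)
    show "u holomorphic_on ball t \<rho>"
      using sub_ball ball_subset_cball by (intro holomorphic_on_subset[OF hol]) blast
    show "continuous_on (cball t \<rho>) u"
      using sub_ball by (intro holomorphic_on_imp_continuous_on holomorphic_on_subset[OF hol])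
    show "norm (u x) \<le> M" if "norm (t - x) = \<rho>" for x
      using that by (intro cofactor_norm_le[OF u] sub) (simp add: dist_norm)
  qed (use radius_pos in auto)
  then show ?thesis by simp
qed

lemma norm_log_derivative_le:
  assumes t: "norm t \<le> \<rho>" "t \<notin> Z"
  shows "norm (deriv h t / h t) \<le> M / (\<rho> * c) + (\<Sum>\<xi>\<in>Z. real (zero_mult h \<xi>) * (1 / norm (t - \<xi>)))"
proof -
  obtain u where u: "is_cofactor u" using exists_cofactor by blast
  have "norm (deriv h t / h t) \<le>
      norm (deriv u t / u t) + norm (\<Sum>\<xi>\<in>Z. of_nat (zero_mult h \<xi>) / (t - \<xi>))"
    unfolding log_derivative_eq[OF u t] by (rule norm_triangle_ineq)
  moreover have "norm (deriv u t / u t) \<le> (M / \<rho>) / c"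
    unfolding norm_divide using lower_bound_pos lower_le_upper radius_pos
    by (intro frac_le norm_deriv_cofactor_le cofactor_norm_ge u t) auto
  moreover have "norm (\<Sum>\<xi>\<in>Z. of_nat (zero_mult h \<xi>) / (t - \<xi>)) \<le>
      (\<Sum>\<xi>\<in>Z. real (zero_mult h \<xi>) * (1 / norm (t - \<xi>)))"
    by (rule order_trans[OF norm_sum]) (auto intro!: sum_mono simp: norm_divide)
  ultimately show ?thesis by simp
qed

lemma abs_ln_norm_le:
  assumes t: "norm t \<le> \<rho>"
  shows "abs_ln (norm (h t)) \<le> ennreal (\<bar>ln c\<bar> + \<bar>ln M\<bar>) +
    (\<Sum>\<xi>\<in>Z. of_nat (zero_mult h \<xi>) * abs_ln (norm ((t - \<xi>) / (2 * \<rho>))))"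
proof -
  obtain u where u: "is_cofactor u" using exists_cofactor by blast
  let ?P = "\<Prod>\<xi>\<in>Z. norm ((t - \<xi>) / (2 * \<rho>)) ^ zero_mult h \<xi>"
  have "norm (h t) = norm (u t) * ?P"
    using u t radius_pos
    by (simp add: is_cofactor_def zero_product_def norm_mult norm_power flip: prod_norm)
  also have "abs_ln \<dots> \<le> abs_ln (norm (u t)) + abs_ln ?P"
    by (intro abs_ln_mult) (auto intro: prod_nonneg)
  also have "abs_ln (norm (u t)) \<le> ennreal (\<bar>ln c\<bar> + \<bar>ln M\<bar>)"
    using t radius_pos
    by (intro abs_ln_le_between lower_bound_pos cofactor_norm_ge cofactor_norm_le u) auto
  also have "abs_ln ?P \<le> (\<Sum>\<xi>\<in>Z. of_nat (zero_mult h \<xi>) * abs_ln (norm ((t - \<xi>) / (2 * \<rho>))))"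
    by (rule order_trans[OF abs_ln_prod]) (auto intro!: sum_mono abs_ln_power)
  finally show ?thesis by (simp add: add_mono)
qed

lemma nn_integral_le_sum_over_zeros:
  fixes g :: "real \<Rightarrow> ennreal"
  assumes K: "0 \<le> K" and B: "0 \<le> B"
    and F [measurable]: "\<And>\<xi>. F \<xi> \<in> borel_measurable borel"
    and F_le: "\<And>\<xi>. \<xi> \<in> Z \<Longrightarrow> (\<integral>\<^sup>+t\<in>{-\<rho>..\<rho>}. F \<xi> t \<partial>lborel) \<le> ennreal B"
    and g_le: "\<And>t. \<bar>t\<bar> \<le> \<rho> \<Longrightarrow> g t \<le> ennreal K + (\<Sum>\<xi>\<in>Z. of_nat (zero_mult h \<xi>) * F \<xi> t)"
  shows "(\<integral>\<^sup>+t\<in>{-\<rho>..\<rho>}. g t \<partial>lborel) \<le> ennreal (K * (2 * \<rho>) + zero_count_bound c M * B)"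
proof -
  have "(\<integral>\<^sup>+t\<in>{-\<rho>..\<rho>}. g t \<partial>lborel) \<le>
     (\<integral>\<^sup>+t. ennreal K * indicator {-\<rho>..\<rho>} t +
        (\<Sum>\<xi>\<in>Z. of_nat (zero_mult h \<xi>) * (F \<xi> t * indicator {-\<rho>..\<rho>} t)) \<partial>lborel)"
    using g_le by (intro nn_integral_mono) (auto simp: indicator_def)
  also have "\<dots> = ennreal K * emeasure lborel {-\<rho>..\<rho>} +
      (\<Sum>\<xi>\<in>Z. of_nat (zero_mult h \<xi>) * (\<integral>\<^sup>+t\<in>{-\<rho>..\<rho>}. F \<xi> t \<partial>lborel))"
    by (subst nn_integral_add; (subst nn_integral_sum)?) (auto simp: nn_integral_cmult)
  also have "\<dots> \<le> ennreal K * ennreal (2 * \<rho>) + (\<Sum>\<xi>\<in>Z. of_nat (zero_mult h \<xi>) * ennreal B)"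
    using radius_pos by (intro add_mono sum_mono mult_left_mono F_le) auto
  also have "(\<Sum>\<xi>\<in>Z. of_nat (zero_mult h \<xi>) * ennreal B) =
      ennreal (real (\<Sum>\<xi>\<in>Z. zero_mult h \<xi>)) * ennreal B"
    by (subst ennreal_of_nat_eq_real_of_nat[symmetric]) (simp only: of_nat_sum sum_distrib_right)
  also have "\<dots> \<le> ennreal (zero_count_bound c M) * ennreal B"
    using sum_zero_mult_le by (intro mult_right_mono ennreal_leI) auto
  also have "ennreal K * ennreal (2 * \<rho>) + ennreal (zero_count_bound c M) * ennreal B =
      ennreal (K * (2 * \<rho>) + zero_count_bound c M * B)"
    using K B radius_pos zero_count_bound_nonneg by (simp add: ennreal_mult)
  finally show ?thesis by (simp add: add_mono)
qed

lemma nn_integral_abs_ln_norm_le: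
  "(\<integral>\<^sup>+t\<in>{-\<rho>..\<rho>}. abs_ln (norm (h (of_real t))) \<partial>lborel)
     \<le> ennreal ((\<bar>ln c\<bar> + \<bar>ln M\<bar>) * (2 * \<rho>) + zero_count_bound c M * (16 * \<rho>))"
proof (rule nn_integral_le_sum_over_zeros)
  show "abs_ln (norm (h (of_real t))) \<le> ennreal (\<bar>ln c\<bar> + \<bar>ln M\<bar>) +
      (\<Sum>\<xi>\<in>Z. of_nat (zero_mult h \<xi>) * abs_ln (norm ((of_real t - \<xi>) / (2 * \<rho>))))"
    if "\<bar>t\<bar> \<le> \<rho>" for t :: real
    using that by (intro abs_ln_norm_le) simp
  show "(\<integral>\<^sup>+t\<in>{-\<rho>..\<rho>}. abs_ln (norm ((of_real t - \<xi>) / (2 * \<rho>))) \<partial>lborel) \<le> ennreal (16 * \<rho>)"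
    if "\<xi> \<in> Z" for \<xi>
    using that by (intro nn_integral_abs_ln_dist_le radius_pos less_imp_le norm_zero_less)
qed (use radius_pos in auto)

lemma nn_integral_log_derivative_le:
  assumes \<rho>: "\<rho> \<le> 1/2" and \<delta>: "0 < \<delta>" "\<delta> \<le> 1" and Im_ge: "\<And>\<xi>. \<xi> \<in> Z \<Longrightarrow> \<delta> \<le> \<bar>Im \<xi>\<bar>"
  shows "(\<integral>\<^sup>+t\<in>{-\<rho>..\<rho>}. ennreal (norm (deriv h (of_real t) / h (of_real t))) \<partial>lborel)
     \<le> ennreal (M / (\<rho> * c) * (2 * \<rho>) + zero_count_bound c M * (2 * ln (3 / \<delta>)))"
proof (rule nn_integral_le_sum_over_zeros)
  show "ennreal (norm (deriv h (of_real t) / h (of_real t))) \<le> ennreal (M / (\<rho> * c)) +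
      (\<Sum>\<xi>\<in>Z. of_nat (zero_mult h \<xi>) * ennreal (1 / norm (of_real t - \<xi>)))"
    if "\<bar>t\<bar> \<le> \<rho>" for t :: real
  proof -
    have "of_real t \<notin> Z" using Im_ge[of "of_real t"] \<delta> by auto
    then have "ennreal (norm (deriv h (of_real t) / h (of_real t))) \<le> ennreal (M / (\<rho> * c) +
        (\<Sum>\<xi>\<in>Z. real (zero_mult h \<xi>) * (1 / norm (of_real t - \<xi>))))"
      using that by (intro ennreal_leI norm_log_derivative_le) auto
    also have "\<dots> = ennreal (M / (\<rho> * c)) +
        (\<Sum>\<xi>\<in>Z. of_nat (zero_mult h \<xi>) * ennreal (1 / norm (of_real t - \<xi>)))"
      using lower_bound_pos lower_le_upper radius_pos
      by (subst ennreal_plus) (auto intro!: sum_nonneg sum.cong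
          simp: ennreal_mult'[symmetric] ennreal_of_nat_eq_real_of_nat sum_ennreal[symmetric]
          simp del: sum_ennreal)
    finally show ?thesis .
  qed
qed (use lower_bound_pos lower_le_upper radius_pos \<rho> \<delta> Im_ge in
      \<open>auto intro!: nn_integral_inverse_dist_le less_imp_le[OF norm_zero_less]\<close>)

end

lemma nn_integral_translate:
  fixes g :: "'a::euclidean_space \<Rightarrow> ennreal"
  assumes [measurable]: "g \<in> borel_measurable borel"
  shows "(\<integral>\<^sup>+x. g (x + y) \<partial>lborel) = (\<integral>\<^sup>+x. g x \<partial>lborel)"
  by (subst (2) lborel_distr_plus[symmetric, of y], subst nn_integral_distr)
     (auto simp: add.commute)

lemma integrable_translate:
  fixes u :: "'a::euclidean_space \<Rightarrow> real"
  assumes "integrable lborel u"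
  shows "integrable lborel (\<lambda>x. u (x + y))"
proof -
  have "integrable (distr lborel borel ((+) y)) u" using assms by (simp add: lborel_distr_plus)
  then show ?thesis using assms by (subst (asm) integrable_distr_eq) (auto simp: add.commute)
qed

lemma integral_translate:
  fixes u :: "'a::euclidean_space \<Rightarrow> real"
  assumes [measurable]: "u \<in> borel_measurable borel"
  shows "(LINT x|lborel. u (x + y)) = (LINT x|lborel. u x)"
  by (subst (2) lborel_distr_plus[symmetric, of y], subst integral_distr) (auto simp: add.commute)

lemma nn_integral_line_average:
  fixes g :: "'a::euclidean_space \<Rightarrow> ennreal"
  assumes [measurable]: "g \<in> borel_measurable borel" and a: "a > 0"
  shows "ennreal (2 * a) * (\<integral>\<^sup>+x. g x \<partial>lborel) =
     (\<integral>\<^sup>+x. (\<integral>\<^sup>+t\<in>{-a..a}. g (x + t *\<^sub>R v) \<partial>lborel) \<partial>lborel)"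
proof -
  have "(\<integral>\<^sup>+x. (\<integral>\<^sup>+t\<in>{-a..a}. g (x + t *\<^sub>R v) \<partial>lborel) \<partial>lborel) =
     (\<integral>\<^sup>+t. (\<integral>\<^sup>+x. g (x + t *\<^sub>R v) * indicator {-a..a} t \<partial>lborel) \<partial>lborel)"
    by (rule lborel_pair.Fubini') measurable
  also have "\<dots> = (\<integral>\<^sup>+t\<in>{-a..a}. (\<integral>\<^sup>+x. g x \<partial>lborel) \<partial>lborel)"
    by (simp add: nn_integral_multc nn_integral_translate)
  also have "\<dots> = (\<integral>\<^sup>+x. g x \<partial>lborel) * ennreal (2 * a)"
    using a by (subst nn_integral_cmult_indicator) auto
  finally show ?thesis by (simp add: mult.commute)
qed

lemma integral_line_average:
  fixes \<Psi> :: "'a::euclidean_space \<Rightarrow> real"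
  assumes \<Psi>: "integrable lborel \<Psi>" and a: "a > 0"
  shows "2 * a * (LINT x|lborel. \<Psi> x) =
      (LINT x|lborel. (LINT t|lborel. \<Psi> (x + t *\<^sub>R v) * indicator {-a..a} t))"
proof -
  have [measurable]: "\<Psi> \<in> borel_measurable borel" using \<Psi> by auto
  have pair_integrable:
    "integrable (lborel \<Otimes>\<^sub>M lborel) (\<lambda>(x, t). \<Psi> (x + t *\<^sub>R v) * indicator {-a..a} t)"
  proof (rule integrableI_bounded)
    have "(\<integral>\<^sup>+p. ennreal (norm (case p of
        (x, t) \<Rightarrow> \<Psi> (x + t *\<^sub>R v) * indicator {-a..a} t)) \<partial>(lborel \<Otimes>\<^sub>M lborel)) =
      (\<integral>\<^sup>+x. (\<integral>\<^sup>+t\<in>{-a..a}. ennreal (norm (\<Psi> (x + t *\<^sub>R v))) \<partial>lborel) \<partial>lborel)"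
      by (subst lborel.nn_integral_fst[symmetric])
         (auto intro!: nn_integral_cong simp: indicator_def)
    also have "\<dots> = ennreal (2 * a) * (\<integral>\<^sup>+x. ennreal (norm (\<Psi> x)) \<partial>lborel)"
      by (rule nn_integral_line_average[symmetric]) (use a in auto)
    also have "\<dots> < \<infinity>" using \<Psi> by (auto simp: integrable_iff_bounded ennreal_mult_less_top)
    finally show "(\<integral>\<^sup>+p. ennreal (norm (case p of
        (x, t) \<Rightarrow> \<Psi> (x + t *\<^sub>R v) * indicator {-a..a} t)) \<partial>(lborel \<Otimes>\<^sub>M lborel)) < \<infinity>" .
  qed measurable
  have "(LINT x|lborel. (LINT t|lborel. \<Psi> (x + t *\<^sub>R v) * indicator {-a..a} t)) =
     (LINT t|lborel. (LINT x|lborel. \<Psi> (x + t *\<^sub>R v) * indicator {-a..a} t))"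
    using lborel_pair.Fubini_integral[OF pair_integrable] by simp
  also have "\<dots> = 2 * a * (LINT x|lborel. \<Psi> x)" using a by (simp add: integral_translate)
  finally show ?thesis by simp
qed

section \<open>Multivariate power series\<close>

definition monom_at :: "('n::finite \<Rightarrow> nat) \<Rightarrow> 'a::comm_ring_1 ^ 'n \<Rightarrow> 'a" where
  "monom_at \<alpha> z = (\<Prod>i\<in>UNIV. (z $ i) ^ \<alpha> i)"

definition incr_at :: "'i \<Rightarrow> ('i \<Rightarrow> nat) \<Rightarrow> 'i \<Rightarrow> nat" where
  "incr_at i \<alpha> = \<alpha>(i := Suc (\<alpha> i))"

definition monom_pderiv :: "'n \<Rightarrow> ('n::finite \<Rightarrow> nat) \<Rightarrow> 'a::comm_ring_1 ^ 'n \<Rightarrow> 'a" where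
  "monom_pderiv i \<alpha> z = of_nat (\<alpha> i) * (z $ i) ^ (\<alpha> i - 1) * (\<Prod>j\<in>UNIV - {i}. (z $ j) ^ \<alpha> j)"

definition cvec :: "real ^ 'n \<Rightarrow> complex ^ 'n" where
  "cvec x = (\<chi> i. of_real (x $ i))"

definition converges_on_ball :: "(('n::finite \<Rightarrow> nat) \<Rightarrow> real) \<Rightarrow> real \<Rightarrow> bool" where
  "converges_on_ball c r \<longleftrightarrow> (\<forall>x\<in>ball (0::real^'n) r. (\<lambda>\<alpha>. c \<alpha> * monom_at \<alpha> x) summable_on UNIV)"

definition pseries :: "(('n::finite \<Rightarrow> nat) \<Rightarrow> real) \<Rightarrow> complex ^ 'n \<Rightarrow> complex" where
  "pseries c z = (\<Sum>\<^sub>\<infinity>\<alpha>. of_real (c \<alpha>) * monom_at \<alpha> z)"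

definition pderiv_coeff :: "'n \<Rightarrow> (('n::finite \<Rightarrow> nat) \<Rightarrow> real) \<Rightarrow> ('n \<Rightarrow> nat) \<Rightarrow> real" where
  "pderiv_coeff i c \<alpha> = real (Suc (\<alpha> i)) * c (incr_at i \<alpha>)"

definition dirderiv_coeff :: "real ^ 'n \<Rightarrow> (('n::finite \<Rightarrow> nat) \<Rightarrow> real) \<Rightarrow> ('n \<Rightarrow> nat) \<Rightarrow> real" where
  "dirderiv_coeff v c \<alpha> = (\<Sum>i\<in>UNIV. v $ i * pderiv_coeff i c \<alpha>)"

lemma has_sum_finite_sum:
  fixes f :: "'i \<Rightarrow> 'a \<Rightarrow> 'b::topological_comm_monoid_add"
  assumes "\<And>i. i \<in> I \<Longrightarrow> (f i has_sum s i) A"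
  shows "((\<lambda>x. \<Sum>i\<in>I. f i x) has_sum (\<Sum>i\<in>I. s i)) A"
  using assms by (induction I rule: infinite_finite_induct) (auto simp: has_sum_0 has_sum_add)

lemma cvec_nth [simp]: "cvec x $ i = of_real (x $ i)"
  by (simp add: cvec_def)

lemma norm_cvec [simp]: "norm (cvec x) = norm x"
  by (simp add: norm_vec_def)

lemma cvec_add: "cvec (x + y) = cvec x + cvec y"
  by (simp add: vec_eq_iff)

lemma cvec_diff: "cvec (x - y) = cvec x - cvec y"
  by (simp add: vec_eq_iff)

lemma cvec_scaleR: "cvec (t *\<^sub>R x) = of_real t *s cvec x"
  by (simp add: vec_eq_iff)

lemma cvec_0 [simp]: "cvec 0 = 0"
  by (simp add: vec_eq_iff)

lemma norm_vector_scalar_mult: "norm (s *s (z :: complex ^ 'n)) = norm s * norm z"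
  by (simp add: norm_vec_def norm_mult L2_set_right_distrib)

lemma continuous_on_cvec [continuous_intros]:
  "continuous_on S g \<Longrightarrow> continuous_on S (\<lambda>x. cvec (g x))"
  unfolding cvec_def by (intro continuous_on_vec_lambda continuous_intros)

lemma continuous_on_vector_scalar_mult [continuous_intros]:
  fixes g :: "'b::topological_space \<Rightarrow> complex ^ 'n"
  assumes "continuous_on S f" "continuous_on S g"
  shows "continuous_on S (\<lambda>x. f x *s g x)"
  unfolding vector_scalar_mult_def by (intro continuous_on_vec_lambda continuous_intros assms)

lemma norm_monom_at: "norm (monom_at \<alpha> (z :: complex ^ 'n)) = (\<Prod>i\<in>UNIV. norm (z $ i) ^ \<alpha> i)"
  by (simp add: monom_at_def prod_norm[symmetric] norm_power)

lemma monom_at_cvec: "monom_at \<alpha> (cvec x) = of_real (monom_at \<alpha> x)"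
  by (simp add: monom_at_def)

lemma inj_incr_at: "inj (incr_at i)"
proof (rule injI)
  fix \<alpha> \<beta> :: "'a \<Rightarrow> nat" assume "incr_at i \<alpha> = incr_at i \<beta>"
  then have "incr_at i \<alpha> j = incr_at i \<beta> j" for j by simp
  then show "\<alpha> = \<beta>" by (intro ext) (metis fun_upd_apply incr_at_def nat.inject)
qed

lemma range_incr_at: "range (incr_at i) = {\<alpha>. \<alpha> i > 0}"
proof (intro equalityI subsetI)
  fix \<alpha> :: "'a \<Rightarrow> nat" assume "\<alpha> \<in> {\<alpha>. \<alpha> i > 0}"
  then have "\<alpha> = incr_at i (\<alpha>(i := \<alpha> i - 1))" by (auto simp: incr_at_def)
  then show "\<alpha> \<in> range (incr_at i)" by blast
qed (auto simp: incr_at_def)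

lemma prod_power_incr_at:
  fixes y :: "'i \<Rightarrow> 'a::comm_monoid_mult"
  assumes "finite A" "i \<in> A"
  shows "(\<Prod>j\<in>A. y j ^ incr_at i \<alpha> j) = y i * (\<Prod>j\<in>A. y j ^ \<alpha> j)"
proof -
  have "(\<Prod>j\<in>A - {i}. y j ^ incr_at i \<alpha> j) = (\<Prod>j\<in>A - {i}. y j ^ \<alpha> j)"
    by (intro prod.cong) (auto simp: incr_at_def)
  then show ?thesis
    unfolding prod.remove[OF assms] by (simp add: incr_at_def mult.assoc)
qed

lemma monom_pderiv_incr_at: "monom_pderiv i (incr_at i \<alpha>) z = of_nat (Suc (\<alpha> i)) * monom_at \<alpha> z"
proof -
  have "(\<Prod>j\<in>UNIV - {i}. (z $ j) ^ incr_at i \<alpha> j) = (\<Prod>j\<in>UNIV - {i}. (z $ j) ^ \<alpha> j)"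
    by (intro prod.cong) (auto simp: incr_at_def)
  then show ?thesis
    unfolding monom_at_def prod.remove[OF finite UNIV_I[of i]]
    by (simp add: monom_pderiv_def incr_at_def mult.assoc)
qed

lemma monom_at_has_field_derivative_line:
  fixes z w :: "'a::real_normed_field ^ 'n"
  shows "((\<lambda>s. monom_at \<alpha> (z + s *s w)) has_field_derivative
           (\<Sum>i\<in>UNIV. w $ i * monom_pderiv i \<alpha> (z + s *s w))) (at s)"
proof -
  have "((\<lambda>s. \<Prod>i\<in>UNIV. (z $ i + s * w $ i) ^ \<alpha> i) has_field_derivative
     (\<Sum>i\<in>UNIV. (of_nat (\<alpha> i) * (w $ i * (z $ i + s * w $ i) ^ (\<alpha> i - Suc 0))) *
        (\<Prod>j\<in>UNIV - {i}. (z $ j + s * w $ j) ^ \<alpha> j))) (at s)"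
    by (intro has_field_derivative_prod DERIV_power) (auto intro!: derivative_eq_intros)
  then show ?thesis by (simp add: monom_at_def monom_pderiv_def mult_ac)
qed

lemma converges_on_ball_dominated:
  fixes c :: "('n::finite \<Rightarrow> nat) \<Rightarrow> real" and y :: "'n \<Rightarrow> real"
  assumes c: "converges_on_ball c r" and y: "\<And>i. y i \<ge> 0" "L2_set y UNIV < r"
  obtains \<delta> where "\<delta> > 0" "(\<lambda>\<alpha>. \<bar>c \<alpha>\<bar> * (\<Prod>i\<in>UNIV. (y i + \<delta>) ^ \<alpha> i)) summable_on UNIV"
proof -
  define \<delta> where "\<delta> = (r - L2_set y UNIV) / (2 * CARD('n))"
  have \<delta>: "\<delta> > 0" using y by (simp add: \<delta>_def)
  define x :: "real^'n" where "x = (\<chi> i. y i + \<delta>)"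
  have "norm x = norm ((\<chi> i. y i) + (\<chi> i. \<delta>) :: real^'n)" by (simp add: x_def plus_vec_def)
  also have "\<dots> \<le> norm ((\<chi> i. y i) :: real^'n) + norm ((\<chi> i. \<delta>) :: real^'n)"
    by (rule norm_triangle_ineq)
  also have "norm ((\<chi> i. y i) :: real^'n) = L2_set y UNIV" using y by (simp add: norm_vec_def)
  also have "norm ((\<chi> i. \<delta>) :: real^'n) \<le> (\<Sum>i\<in>(UNIV::'n set). \<bar>\<delta>\<bar>)"
    by (rule order_trans[OF norm_le_l1_cart]) simp
  also have "\<dots> = (r - L2_set y UNIV) / 2" using y by (simp add: \<delta>_def)
  finally have "norm x < r" using y(2) by (simp add: field_simps)
  then have "(\<lambda>\<alpha>. c \<alpha> * monom_at \<alpha> x) summable_on UNIV"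
    using c by (auto simp: converges_on_ball_def)
  then have "(\<lambda>\<alpha>. norm (c \<alpha> * monom_at \<alpha> x)) summable_on UNIV"
    by (rule summable_on_iff_abs_summable_on_real[THEN iffD1])
  moreover have "norm (c \<alpha> * monom_at \<alpha> x) = \<bar>c \<alpha>\<bar> * (\<Prod>i\<in>UNIV. (y i + \<delta>) ^ \<alpha> i)" for \<alpha>
    using y \<delta> by (simp add: abs_mult monom_at_def x_def abs_prod power_abs)
  ultimately show ?thesis using that \<delta> by simp
qed

lemma pseries_dominated:
  fixes z :: "complex ^ 'n"
  assumes c: "converges_on_ball c r" and z: "norm z < r"
  obtains \<delta> M where "\<delta> > 0" "M summable_on UNIV"
    "\<And>\<alpha> z'. (\<And>i. norm (z' $ i - z $ i) \<le> \<delta>) \<Longrightarrow> norm (of_real (c \<alpha>) * monom_at \<alpha> z') \<le> M \<alpha>"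
proof -
  obtain \<delta> where \<delta>: "\<delta> > 0" "(\<lambda>\<alpha>. \<bar>c \<alpha>\<bar> * (\<Prod>i\<in>UNIV. (norm (z $ i) + \<delta>) ^ \<alpha> i)) summable_on UNIV"
    using converges_on_ball_dominated[OF c, of "\<lambda>i. norm (z $ i)"] z by (auto simp: norm_vec_def)
  show ?thesis
  proof (rule that[OF \<delta>])
    fix \<alpha> and z' :: "complex ^ 'n" assume z': "\<And>i. norm (z' $ i - z $ i) \<le> \<delta>"
    have "norm (z' $ i) \<le> norm (z $ i) + \<delta>" for i
      using z'[of i] norm_triangle_ineq2[of "z' $ i" "z $ i"] by linarith
    then show "norm (of_real (c \<alpha>) * monom_at \<alpha> z') \<le> \<bar>c \<alpha>\<bar> * (\<Prod>i\<in>UNIV. (norm (z $ i) + \<delta>) ^ \<alpha> i)"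
      unfolding norm_mult norm_monom_at norm_of_real
      by (intro mult_left_mono prod_mono conjI power_mono) auto
  qed
qed

lemma pseries_has_sum:
  assumes "converges_on_ball c r" "norm z < r"
  shows "((\<lambda>\<alpha>. of_real (c \<alpha>) * monom_at \<alpha> z) has_sum pseries c z) UNIV"
proof -
  obtain \<delta> M where "\<delta> > 0" and M: "M summable_on UNIV"
    "\<And>\<alpha> z'. (\<And>i. norm (z' $ i - z $ i) \<le> \<delta>) \<Longrightarrow> norm (of_real (c \<alpha>) * monom_at \<alpha> z') \<le> M \<alpha>"
    using pseries_dominated[OF assms] by blast
  have "(\<lambda>\<alpha>. norm (of_real (c \<alpha>) * monom_at \<alpha> z)) summable_on UNIV"
    by (rule Infinite_Sum.abs_summable_on_comparison_test'[OF M(1)])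
       (rule M(2), use \<open>\<delta> > 0\<close> in simp)
  then have "(\<lambda>\<alpha>. of_real (c \<alpha>) * monom_at \<alpha> z) summable_on UNIV" by (rule abs_summable_summable)
  then show ?thesis unfolding pseries_def by simp
qed

lemma pseries_cvec_has_sum:
  assumes "converges_on_ball c r" "norm x < r"
  shows "((\<lambda>\<alpha>. c \<alpha> * monom_at \<alpha> x) has_sum Re (pseries c (cvec x))) UNIV"
  using has_sum_Re[OF pseries_has_sum[OF assms(1), of "cvec x"]] assms(2)
  by (simp add: monom_at_cvec)

lemma pseries_cvec:
  assumes "converges_on_ball c r" "norm x < r"
  shows "pseries c (cvec x) = of_real (Re (pseries c (cvec x)))"
proof -
  have "((\<lambda>\<alpha>. of_real (c \<alpha>) * monom_at \<alpha> (cvec x) :: complex) has_sum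
      of_real (Re (pseries c (cvec x)))) UNIV"
    using has_sum_of_real[OF pseries_cvec_has_sum[OF assms], where 'a = complex]
    by (simp add: monom_at_cvec)
  then show ?thesis
    using pseries_has_sum[OF assms(1), of "cvec x"] assms(2) by (intro has_sum_unique) auto
qed

lemma pseries_cnj:
  assumes "converges_on_ball c r" "norm z < r"
  shows "pseries c (\<chi> i. cnj (z $ i)) = cnj (pseries c z)"
proof (rule has_sum_unique)
  have "norm (\<chi> i. cnj (z $ i)) < r" using assms(2) by (simp add: norm_vec_def)
  from pseries_has_sum[OF assms(1) this]
  show "((\<lambda>\<alpha>. of_real (c \<alpha>) * cnj (monom_at \<alpha> z)) has_sum pseries c (\<chi> i. cnj (z $ i))) UNIV"
    by (simp add: monom_at_def)
  show "((\<lambda>\<alpha>. of_real (c \<alpha>) * cnj (monom_at \<alpha> z)) has_sum cnj (pseries c z)) UNIV"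
    using pseries_has_sum[OF assms] has_sum_cnj_iff[of "\<lambda>\<alpha>. of_real (c \<alpha>) * monom_at \<alpha> z"] by simp
qed

lemma pseries_uniform_limit:
  fixes z :: "complex ^ 'n"
  assumes "converges_on_ball c r" "norm z < r"
  obtains \<delta> where "\<delta> > 0"
    "uniform_limit (cball z \<delta>) (\<lambda>A z. \<Sum>\<alpha>\<in>A. of_real (c \<alpha>) * monom_at \<alpha> z) (pseries c)
    (finite_subsets_at_top UNIV)"
proof -
  obtain \<delta> M where \<delta>: "\<delta> > 0" and M: "M summable_on UNIV"
    "\<And>\<alpha> z'. (\<And>i. norm (z' $ i - z $ i) \<le> \<delta>) \<Longrightarrow> norm (of_real (c \<alpha>) * monom_at \<alpha> z') \<le> M \<alpha>"
    using pseries_dominated[OF assms] by blast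
  have "norm (of_real (c \<alpha>) * monom_at \<alpha> z') \<le> M \<alpha>" if "z' \<in> cball z \<delta>" for \<alpha> z'
  proof (rule M(2))
    have "norm ((z' - z) $ i) \<le> norm (z' - z)" for i by (rule Finite_Cartesian_Product.norm_nth_le)
    also have "norm (z' - z) \<le> \<delta>" using that by (simp add: dist_norm norm_minus_commute)
    finally show "norm (z' $ i - z $ i) \<le> \<delta>" for i by simp
  qed
  then have "uniform_limit (cball z \<delta>) (\<lambda>A z. \<Sum>\<alpha>\<in>A. of_real (c \<alpha>) * monom_at \<alpha> z) (pseries c)
      (finite_subsets_at_top UNIV)"
    unfolding pseries_def[abs_def] by (intro Weierstrass_m_test_general[OF _ M(1)])
  then show ?thesis by (rule that[OF \<delta>])
qed

lemma continuous_on_pseries: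
  fixes c :: "('n::finite \<Rightarrow> nat) \<Rightarrow> real"
  assumes c: "converges_on_ball c r"
  shows "continuous_on (ball 0 r) (pseries c)"
proof -
  have "isCont (pseries c) z" if z: "norm z < r" for z
  proof -
    obtain \<delta> where \<delta>: "\<delta> > 0" and limit: "uniform_limit (cball z \<delta>)
        (\<lambda>A z. \<Sum>\<alpha>\<in>A. of_real (c \<alpha>) * monom_at \<alpha> z) (pseries c) (finite_subsets_at_top UNIV)"
      by (rule pseries_uniform_limit[OF c z])
    have "continuous_on (cball z \<delta>) (pseries c)"
      by (rule uniform_limit_theorem[OF _ limit])
         (auto simp: monom_at_def intro!: always_eventually continuous_intros)
    then show ?thesis using \<delta> by (intro continuous_on_interior[of "cball z \<delta>"]) auto
  qed
  then show ?thesis by (auto simp: continuous_on_eq_continuous_at)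
qed

lemma Suc_mult_power_le_power_add:
  fixes y \<delta> :: real
  assumes "y \<ge> 0" "\<delta> \<ge> 0"
  shows "real (Suc m) * y ^ m * \<delta> \<le> (y + \<delta>) ^ Suc m"
proof (induction m)
  case (Suc m)
  have "real (Suc (Suc m)) * y ^ Suc m * \<delta> = y * (real (Suc m) * y ^ m * \<delta>) + \<delta> * y ^ Suc m"
    by (simp add: algebra_simps)
  also have "\<dots> \<le> y * (y + \<delta>) ^ Suc m + \<delta> * (y + \<delta>) ^ Suc m"
    using assms by (intro add_mono mult_left_mono Suc power_mono) auto
  also have "\<dots> = (y + \<delta>) ^ Suc (Suc m)" by (simp add: algebra_simps)
  finally show ?case .
qed (use assms in auto)

lemma converges_on_ball_pderiv_coeff:
  fixes c :: "('n::finite \<Rightarrow> nat) \<Rightarrow> real"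
  assumes c: "converges_on_ball c r"
  shows "converges_on_ball (pderiv_coeff i c) r"
  unfolding converges_on_ball_def
proof
  fix x :: "real^'n" assume x: "x \<in> ball 0 r"
  define y where "y = (\<lambda>i. \<bar>x $ i\<bar>)"
  have y_nonneg: "y j \<ge> 0" for j by (simp add: y_def)
  have "L2_set y UNIV < r" using x by (simp add: norm_vec_def y_def)
  then obtain \<delta> where \<delta>: "\<delta> > 0" and summable:
    "(\<lambda>\<alpha>. \<bar>c \<alpha>\<bar> * (\<Prod>i\<in>UNIV. (y i + \<delta>) ^ \<alpha> i)) summable_on UNIV"
    using converges_on_ball_dominated[OF c, of y] y_nonneg by blast
  define S where "S = (\<lambda>\<alpha>. \<bar>c \<alpha>\<bar> * (\<Prod>i\<in>UNIV. (y i + \<delta>) ^ \<alpha> i))"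
  have "S summable_on range (incr_at i)"
    using summable unfolding S_def by (rule summable_on_subset_banach) auto
  then have "(\<lambda>\<alpha>. S (incr_at i \<alpha>)) summable_on UNIV"
    using summable_on_reindex[OF inj_incr_at, of S] by (simp add: o_def)
  then have "(\<lambda>\<alpha>. (1/\<delta>) * S (incr_at i \<alpha>)) summable_on UNIV" by (rule summable_on_cmult_right)
  then have "(\<lambda>\<alpha>. norm (pderiv_coeff i c \<alpha> * monom_at \<alpha> x)) summable_on UNIV"
  proof (rule Infinite_Sum.abs_summable_on_comparison_test')
    fix \<alpha> :: "'n \<Rightarrow> nat"
    let ?rest = "\<lambda>y. \<Prod>j\<in>UNIV - {i}. y j ^ \<alpha> j :: real"
    have "\<bar>monom_at \<alpha> x\<bar> = y i ^ \<alpha> i * ?rest y"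
      unfolding monom_at_def prod.remove[OF finite UNIV_I[of i]]
      by (simp add: y_def abs_mult abs_prod power_abs)
    then have "norm (pderiv_coeff i c \<alpha> * monom_at \<alpha> x) =
       (1/\<delta>) * (\<bar>c (incr_at i \<alpha>)\<bar> * ((real (Suc (\<alpha> i)) * y i ^ \<alpha> i * \<delta>) * ?rest y))"
      using \<delta> by (simp add: abs_mult pderiv_coeff_def)
    also have "\<dots> \<le> (1/\<delta>) * (\<bar>c (incr_at i \<alpha>)\<bar> * ((y i + \<delta>) ^ Suc (\<alpha> i) * ?rest (\<lambda>j. y j + \<delta>)))"
      using \<delta> y_nonneg
      by (intro mult_left_mono mult_mono Suc_mult_power_le_power_add prod_mono conjI power_mono)
        (auto intro!: prod_nonneg)
    also have "(y i + \<delta>) ^ Suc (\<alpha> i) * ?rest (\<lambda>j. y j + \<delta>) = (\<Prod>j\<in>UNIV. (y j + \<delta>) ^ incr_at i \<alpha> j)"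
      unfolding prod_power_incr_at[OF finite UNIV_I] prod.remove[OF finite UNIV_I[of i]] by simp
    finally show "norm (pderiv_coeff i c \<alpha> * monom_at \<alpha> x) \<le> (1/\<delta>) * S (incr_at i \<alpha>)"
      unfolding S_def .
  qed
  then show "(\<lambda>\<alpha>. pderiv_coeff i c \<alpha> * monom_at \<alpha> x) summable_on UNIV"
    by (rule abs_summable_summable)
qed

lemma pseries_dirderiv_coeff_has_sum:
  assumes c: "converges_on_ball c r" and z: "norm z < r"
  shows "((\<lambda>\<alpha>. of_real (dirderiv_coeff v c \<alpha>) * monom_at \<alpha> z) has_sum
           (\<Sum>i\<in>UNIV. of_real (v $ i) * pseries (pderiv_coeff i c) z)) UNIV"
  unfolding dirderiv_coeff_def of_real_sum sum_distrib_right of_real_mult mult.assoc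
  by (intro has_sum_finite_sum has_sum_cmult_right
       pseries_has_sum[OF converges_on_ball_pderiv_coeff[OF c] z])

lemma pseries_dirderiv_coeff:
  assumes c: "converges_on_ball c r" and z: "norm z < r"
  shows "pseries (dirderiv_coeff v c) z = (\<Sum>i\<in>UNIV. of_real (v $ i) * pseries (pderiv_coeff i c) z)"
  unfolding pseries_def[of "dirderiv_coeff v c"]
  by (rule infsumI[OF pseries_dirderiv_coeff_has_sum[OF assms]])

lemma converges_on_ball_dirderiv_coeff:
  fixes c :: "('n::finite \<Rightarrow> nat) \<Rightarrow> real"
  assumes c: "converges_on_ball c r"
  shows "converges_on_ball (dirderiv_coeff v c) r"
  unfolding converges_on_ball_def
proof
  fix x :: "real^'n" assume "x \<in> ball 0 r"
  then have "norm (cvec x) < r" by simp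
  from has_sum_Re[OF pseries_dirderiv_coeff_has_sum[OF c this, of v]]
  show "(\<lambda>\<alpha>. dirderiv_coeff v c \<alpha> * monom_at \<alpha> x) summable_on UNIV"
    by (auto simp: monom_at_cvec summable_on_def)
qed

lemma converges_on_ball_dirderiv_coeff_funpow:
  "converges_on_ball c r \<Longrightarrow> converges_on_ball ((dirderiv_coeff v ^^ j) c) r"
  by (induction j) (simp_all add: converges_on_ball_dirderiv_coeff)

lemma exists_pos_le_scaled_norm_le:
  fixes v :: "'a::real_normed_vector"
  assumes "\<rho> > 0" "\<epsilon> > 0"
  shows "\<exists>a>0. a \<le> \<rho> \<and> a * norm v \<le> \<epsilon>"
proof -
  have v: "norm v + 1 > 0" using norm_ge_zero[of v] by linarith
  define a where "a = min \<rho> (\<epsilon> / (norm v + 1))"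
  have "a * norm v \<le> \<epsilon> / (norm v + 1) * (norm v + 1)"
    using assms v by (intro mult_mono) (auto simp: a_def)
  then show ?thesis using assms v by (intro exI[of _ a]) (auto simp: a_def)
qed

lemma monom_pderiv_has_sum:
  fixes c :: "('n::finite \<Rightarrow> nat) \<Rightarrow> real"
  assumes c: "converges_on_ball c r" and z: "norm z < r"
  shows "((\<lambda>\<alpha>. of_real (c \<alpha>) * monom_pderiv i \<alpha> z) has_sum pseries (pderiv_coeff i c) z) UNIV"
proof -
  have "((\<lambda>\<alpha>. of_real (c (incr_at i \<alpha>)) * monom_pderiv i (incr_at i \<alpha>) z) has_sum
      pseries (pderiv_coeff i c) z) UNIV"
    using pseries_has_sum[OF converges_on_ball_pderiv_coeff[OF c] z, of i]
    by (simp add: monom_pderiv_incr_at pderiv_coeff_def mult_ac)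
  then have "((\<lambda>\<alpha>. of_real (c \<alpha>) * monom_pderiv i \<alpha> z) has_sum pseries (pderiv_coeff i c) z)
      (range (incr_at i))"
    by (simp add: has_sum_reindex[OF inj_incr_at] o_def)
  then show ?thesis
    by (rule has_sum_cong_neutral[THEN iffD1, rotated 3])
       (auto simp: range_incr_at monom_pderiv_def)
qed

lemma has_field_derivative_line_shift:
  fixes \<Phi> :: "complex ^ 'n \<Rightarrow> complex"
  assumes "((\<lambda>h. \<Phi> ((z + s *s w) + h *s w)) has_field_derivative D) (at 0)"
  shows "((\<lambda>s. \<Phi> (z + s *s w)) has_field_derivative D) (at s)"
proof -
  have "(\<lambda>h. \<Phi> ((z + s *s w) + h *s w)) = (\<lambda>h. \<Phi> (z + (s + h) *s w))"
    by (simp add: vec_eq_iff algebra_simps fun_eq_iff)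
  then show ?thesis
    using assms DERIV_shift[of "\<lambda>s. \<Phi> (z + s *s w)" D 0 s] by (simp add: add.commute)
qed

lemma pseries_uniform_limit_line:
  fixes p w :: "complex ^ 'n"
  assumes "converges_on_ball c r" "norm p < r"
  obtains \<eta> where "\<eta> > 0"
    "uniform_limit (cball 0 \<eta>) (\<lambda>A h. \<Sum>\<alpha>\<in>A. of_real (c \<alpha>) * monom_at \<alpha> (p + h *s w))
      (\<lambda>h. pseries c (p + h *s w)) (finite_subsets_at_top UNIV)"
proof -
  obtain \<delta> where \<delta>: "\<delta> > 0" and limit: "uniform_limit (cball p \<delta>)
      (\<lambda>A z. \<Sum>\<alpha>\<in>A. of_real (c \<alpha>) * monom_at \<alpha> z) (pseries c) (finite_subsets_at_top UNIV)"
    by (rule pseries_uniform_limit[OF assms])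
  obtain \<eta> where \<eta>: "\<eta> > 0" "\<eta> * norm w \<le> \<delta>"
    using exists_pos_le_scaled_norm_le[OF zero_less_one \<delta>, of w] by blast
  show ?thesis
  proof (rule that[OF \<eta>(1)], rule uniform_limit_compose'[OF limit], rule Pi_I)
    fix h :: complex assume "h \<in> cball 0 \<eta>"
    then have "norm h * norm w \<le> \<eta> * norm w" by (intro mult_right_mono) auto
    then show "p + h *s w \<in> cball p \<delta>"
      using \<eta>(2) by (simp add: dist_norm norm_vector_scalar_mult)
  qed
qed

lemma pseries_has_field_derivative:
  fixes c :: "('n::finite \<Rightarrow> nat) \<Rightarrow> real"
  assumes c: "converges_on_ball c r" and zs: "norm (z + s *s cvec v) < r"
  shows "((\<lambda>s. pseries c (z + s *s cvec v)) has_field_derivative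
      pseries (dirderiv_coeff v c) (z + s *s cvec v)) (at s)"
proof (rule has_field_derivative_line_shift)
  define p w where "p = z + s *s cvec v" and "w = cvec v"
  have p: "norm p < r" using zs by (simp add: p_def)
  define f where "f = (\<lambda>A h. \<Sum>\<alpha>\<in>A. of_real (c \<alpha>) * monom_at \<alpha> (p + h *s w))"
  define f' where "f' =
      (\<lambda>A h. \<Sum>\<alpha>\<in>A. of_real (c \<alpha>) * (\<Sum>i\<in>UNIV. w $ i * monom_pderiv i \<alpha> (p + h *s w)))"
  have deriv_partial_sum: "(f A has_field_derivative f' A h) (at h)" for A h
    unfolding f_def f'_def by (intro DERIV_sum DERIV_cmult monom_at_has_field_derivative_line)
  obtain \<eta> where \<eta>: "\<eta> > 0" and limit: "uniform_limit (cball 0 \<eta>) f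
      (\<lambda>h. pseries c (p + h *s w)) (finite_subsets_at_top UNIV)"
    unfolding f_def by (rule pseries_uniform_limit_line[OF c p])
  have "\<forall>\<^sub>F A in finite_subsets_at_top UNIV. continuous_on (cball 0 \<eta>) (f A) \<and>
      (\<forall>h\<in>ball 0 \<eta>. (f A has_field_derivative f' A h) (at h))"
    using deriv_partial_sum
    by (intro always_eventually allI conjI ballI continuous_at_imp_continuous_on)
       (auto intro: DERIV_isCont)
  then obtain g' where g': "\<And>h. h \<in> ball 0 \<eta> \<Longrightarrow>
      ((\<lambda>h. pseries c (p + h *s w)) has_field_derivative g' h) (at h) \<and>
      ((\<lambda>A. f' A h) \<longlongrightarrow> g' h) (finite_subsets_at_top UNIV)"
    by (rule has_complex_derivative_uniform_limit[OF _ limit finite_subsets_at_top_neq_bot \<eta>])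
       (rule that; assumption)
  have "((\<lambda>\<alpha>. \<Sum>i\<in>UNIV. w $ i * (of_real (c \<alpha>) * monom_pderiv i \<alpha> p)) has_sum
      (\<Sum>i\<in>UNIV. w $ i * pseries (pderiv_coeff i c) p)) UNIV"
    by (intro has_sum_finite_sum has_sum_cmult_right monom_pderiv_has_sum[OF c p])
  then have "((\<lambda>A. f' A 0) \<longlongrightarrow> pseries (dirderiv_coeff v c) p) (finite_subsets_at_top UNIV)"
    unfolding has_sum_def f'_def pseries_dirderiv_coeff[OF c p]
    by (simp add: w_def sum_distrib_left mult_ac)
  moreover have "((\<lambda>A. f' A 0) \<longlongrightarrow> g' 0) (finite_subsets_at_top UNIV)" using g'[of 0] \<eta> by auto
  ultimately have "g' 0 = pseries (dirderiv_coeff v c) p"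
    by (intro tendsto_unique[OF finite_subsets_at_top_neq_bot])
  then show "((\<lambda>h. pseries c ((z + s *s cvec v) + h *s cvec v)) has_field_derivative
      pseries (dirderiv_coeff v c) (z + s *s cvec v)) (at 0)"
    using g'[of 0] \<eta> by (simp add: p_def w_def)
qed

lemma pseries_iter_deriv:
  fixes c :: "('n::finite \<Rightarrow> nat) \<Rightarrow> real"
  assumes c: "converges_on_ball c r" and U: "open U" "\<And>s. s \<in> U \<Longrightarrow> norm (z + s *s cvec v) < r"
  shows "s \<in> U \<Longrightarrow> (deriv ^^ j) (\<lambda>s. pseries c (z + s *s cvec v)) s =
     pseries ((dirderiv_coeff v ^^ j) c) (z + s *s cvec v)"
proof (induction j arbitrary: s)
  case (Suc j)
  let ?g = "\<lambda>s. pseries ((dirderiv_coeff v ^^ j) c) (z + s *s cvec v)"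
  have "\<forall>\<^sub>F s in nhds s. (deriv ^^ j) (\<lambda>s. pseries c (z + s *s cvec v)) s = ?g s"
    using eventually_nhds_in_open[OF U(1) Suc.prems] by eventually_elim (rule Suc.IH)
  then have "(deriv ^^ Suc j) (\<lambda>s. pseries c (z + s *s cvec v)) s = deriv ?g s"
    by (simp add: deriv_cong_ev)
  also have "\<dots> = pseries ((dirderiv_coeff v ^^ Suc j) c) (z + s *s cvec v)"
    using DERIV_imp_deriv[OF pseries_has_field_derivative[OF
        converges_on_ball_dirderiv_coeff_funpow[OF c] U(2)[OF Suc.prems]]] by simp
  finally show ?case .
qed auto

section \<open>Directional derivatives and real analytic functions\<close>

definition dirderiv :: "'a::real_vector \<Rightarrow> ('a \<Rightarrow> real) \<Rightarrow> 'a \<Rightarrow> real" where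
  "dirderiv v f x = deriv (\<lambda>t. f (x + t *\<^sub>R v)) 0"

definition grad :: "(real ^ 'n \<Rightarrow> real) \<Rightarrow> real ^ 'n \<Rightarrow> real ^ 'n" where
  "grad f x = (\<chi> i. dirderiv (axis i 1) f x)"

lemma partial_deriv_eq_dirderiv: "partial_deriv i f = dirderiv (axis i 1) f"
  by (simp add: fun_eq_iff partial_deriv_def dirderiv_def)

lemma has_real_derivative_line_shift:
  fixes x v :: "'a::real_vector"
  assumes "((\<lambda>s. f ((x + t *\<^sub>R v) + s *\<^sub>R v)) has_real_derivative D) (at 0)"
  shows "((\<lambda>t. f (x + t *\<^sub>R v)) has_real_derivative D) (at t)"
  using assms DERIV_shift[of "\<lambda>t. f (x + t *\<^sub>R v)" D 0 t] by (simp add: algebra_simps)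

lemma has_derivative_imp_has_real_derivative_line:
  fixes f :: "'a::real_normed_vector \<Rightarrow> real"
  assumes f: "(f has_derivative f') (at x)"
  shows "((\<lambda>t. f (x + t *\<^sub>R v)) has_real_derivative f' v) (at 0)"
proof -
  have "((\<lambda>t. f (x + t *\<^sub>R v)) has_derivative (\<lambda>t. f' (t *\<^sub>R v))) (at 0)"
    by (rule has_derivative_compose[of "\<lambda>t. x + t *\<^sub>R v" _ _ _ f])
       (use f in \<open>auto intro!: derivative_eq_intros\<close>)
  then show ?thesis
    unfolding has_field_derivative_def
    by (rule has_derivative_eq_rhs)
       (simp add: fun_eq_iff linear_scale[OF has_derivative_linear[OF f]] mult.commute)
qed

lemma has_derivative_imp_dirderiv:
  fixes f :: "'a::real_normed_vector \<Rightarrow> real"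
  assumes "(f has_derivative f') (at x)"
  shows "dirderiv v f x = f' v"
  unfolding dirderiv_def using assms
  by (intro DERIV_imp_deriv has_derivative_imp_has_real_derivative_line)

lemma abs_increment_minus_linear_le:
  fixes g g' :: "real \<Rightarrow> real"
  assumes g: "\<And>t. t \<in> closed_segment 0 s \<Longrightarrow> (g has_real_derivative g' t) (at t)"
    and g'_close: "\<And>t. t \<in> closed_segment 0 s \<Longrightarrow> \<bar>g' t - m\<bar> \<le> e"
  shows "\<bar>g s - g 0 - s * m\<bar> \<le> e * \<bar>s\<bar>"
proof -
  have "norm ((g s - s * m) - (g 0 - 0 * m)) \<le> e * norm (s - 0)"
  proof (rule field_differentiable_bound[of "closed_segment 0 s" "\<lambda>t. g t - t * m" "\<lambda>t. g' t - m"])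
    show "((\<lambda>t. g t - t * m) has_real_derivative g' t - m) (at t within closed_segment 0 s)"
      if "t \<in> closed_segment 0 s" for t
      using g[OF that] by (auto intro!: derivative_eq_intros intro: has_field_derivative_at_within)
  qed (use g'_close in auto)
  then show ?thesis by (simp add: algebra_simps)
qed

lemma norm_coordinate_path_le:
  fixes h :: "'a::euclidean_space"
  assumes "A \<subseteq> Basis" "b \<in> Basis - A" "\<bar>t\<bar> \<le> \<bar>h \<bullet> b\<bar>"
  shows "norm ((\<Sum>a\<in>A. (h \<bullet> a) *\<^sub>R a) + t *\<^sub>R b) \<le> norm h"
proof (rule norm_le_componentwise)
  fix j :: 'a assume j: "j \<in> Basis"
  have "finite A" using assms(1) finite_Basis finite_subset by blast
  have "(\<Sum>a\<in>A. (h \<bullet> a) *\<^sub>R a) \<bullet> j = (\<Sum>a\<in>A. if a = j then h \<bullet> a else 0)"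
    unfolding inner_sum_left using assms(1) j by (intro sum.cong) (auto simp: inner_Basis)
  also have "\<dots> = (if j \<in> A then h \<bullet> j else 0)" using \<open>finite A\<close> by simp
  finally show "\<bar>((\<Sum>a\<in>A. (h \<bullet> a) *\<^sub>R a) + t *\<^sub>R b) \<bullet> j\<bar> \<le> \<bar>h \<bullet> j\<bar>"
    using assms j by (auto simp: inner_add_left inner_Basis)
qed

lemma coordinate_path_increment_bound:
  fixes f :: "'a::euclidean_space \<Rightarrow> real"
  assumes f': "\<And>x b. b \<in> Basis \<Longrightarrow> dist x p < d \<Longrightarrow>
      ((\<lambda>t. f (x + t *\<^sub>R b)) has_real_derivative f' b x) (at 0)"
    and f'_close: "\<And>x b. b \<in> Basis \<Longrightarrow> dist x p < d \<Longrightarrow> \<bar>f' b x - m b\<bar> \<le> e"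
    and h: "norm h < d" and A: "A \<subseteq> Basis"
  shows "\<bar>f (p + (\<Sum>b\<in>A. (h \<bullet> b) *\<^sub>R b)) - f p - (\<Sum>b\<in>A. (h \<bullet> b) * m b)\<bar> \<le> e * (\<Sum>b\<in>A. \<bar>h \<bullet> b\<bar>)"
proof -
  have "finite A" using A finite_Basis finite_subset by blast
  then show ?thesis using A
  proof (induction A rule: finite_induct)
    case (insert b A)
    define x where "x = p + (\<Sum>a\<in>A. (h \<bullet> a) *\<^sub>R a)"
    have b: "b \<in> Basis" using insert.prems by simp
    have near: "dist (x + t *\<^sub>R b) p < d" if "t \<in> closed_segment 0 (h \<bullet> b)" for t
    proof -
      have "\<bar>t\<bar> \<le> \<bar>h \<bullet> b\<bar>" using that by (auto simp: closed_segment_eq_real_ivl split: if_splits)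
      then have "norm ((\<Sum>a\<in>A. (h \<bullet> a) *\<^sub>R a) + t *\<^sub>R b) \<le> norm h"
        using insert by (intro norm_coordinate_path_le) auto
      then show ?thesis using h by (simp add: x_def dist_norm add.assoc)
    qed
    have "\<bar>f (x + (h \<bullet> b) *\<^sub>R b) - f (x + 0 *\<^sub>R b) - (h \<bullet> b) * m b\<bar> \<le> e * \<bar>h \<bullet> b\<bar>"
    proof (rule abs_increment_minus_linear_le[where g = "\<lambda>t. f (x + t *\<^sub>R b)"
          and g' = "\<lambda>t. f' b (x + t *\<^sub>R b)"])
      fix t assume t: "t \<in> closed_segment 0 (h \<bullet> b)"
      show "((\<lambda>t. f (x + t *\<^sub>R b)) has_real_derivative f' b (x + t *\<^sub>R b)) (at t)"
        by (rule has_real_derivative_line_shift, rule f'[OF b near[OF t]])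
      show "\<bar>f' b (x + t *\<^sub>R b) - m b\<bar> \<le> e" by (rule f'_close[OF b near[OF t]])
    qed
    moreover have "\<bar>f x - f p - (\<Sum>a\<in>A. (h \<bullet> a) * m a)\<bar> \<le> e * (\<Sum>a\<in>A. \<bar>h \<bullet> a\<bar>)"
      unfolding x_def using insert by simp
    ultimately have "\<bar>f (x + (h \<bullet> b) *\<^sub>R b) - f p - ((h \<bullet> b) * m b + (\<Sum>a\<in>A. (h \<bullet> a) * m a))\<bar>
        \<le> e * \<bar>h \<bullet> b\<bar> + e * (\<Sum>a\<in>A. \<bar>h \<bullet> a\<bar>)" by simp
    then show ?case using insert.hyps by (simp add: x_def algebra_simps)
  qed simp
qed

lemma has_derivative_of_continuous_partials:
  fixes f :: "'a::euclidean_space \<Rightarrow> real"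
  assumes S: "open S" "p \<in> S"
    and f': "\<And>x b. x \<in> S \<Longrightarrow> b \<in> Basis \<Longrightarrow> ((\<lambda>t. f (x + t *\<^sub>R b)) has_real_derivative f' b x) (at 0)"
    and cont: "\<And>b. b \<in> Basis \<Longrightarrow> isCont (f' b) p"
  shows "(f has_derivative (\<lambda>h. \<Sum>b\<in>Basis. (h \<bullet> b) * f' b p)) (at p)"
  unfolding has_derivative_at_alt
proof (intro conjI allI impI)
  show "bounded_linear (\<lambda>h. \<Sum>b\<in>Basis. (h \<bullet> b) * f' b p)"
    by (intro bounded_linear_sum bounded_linear_mult_const bounded_linear_inner_left)
next
  fix e :: real assume e: "e > 0"
  define e' where "e' = e / real DIM('a)"
  have e': "e' > 0" using e by (simp add: e'_def)
  have "\<forall>\<^sub>F x in nhds p. \<forall>b\<in>Basis. dist (f' b x) (f' b p) < e'"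
    using cont e' by (intro eventually_ball_finite ballI tendstoD)
      (auto simp: isCont_def tendsto_at_iff_tendsto_nhds)
  moreover have "\<forall>\<^sub>F x in nhds p. x \<in> S" using S by (simp add: eventually_nhds_in_open)
  ultimately have "\<forall>\<^sub>F x in nhds p. x \<in> S \<and> (\<forall>b\<in>Basis. dist (f' b x) (f' b p) < e')"
    by eventually_elim auto
  then obtain d where d: "d > 0" "\<And>x. dist x p < d \<Longrightarrow>
      x \<in> S \<and> (\<forall>b\<in>Basis. dist (f' b x) (f' b p) < e')"
    unfolding eventually_nhds_metric by blast
  have "norm (f y - f p - (\<Sum>b\<in>Basis. ((y - p) \<bullet> b) * f' b p)) \<le> e * norm (y - p)"
    if y: "norm (y - p) < d" for y
  proof -
    define h where "h = y - p"
    have "\<bar>f (p + (\<Sum>b\<in>Basis. (h \<bullet> b) *\<^sub>R b)) - f p - (\<Sum>b\<in>Basis. (h \<bullet> b) * f' b p)\<bar>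
        \<le> e' * (\<Sum>b\<in>Basis. \<bar>h \<bullet> b\<bar>)"
      using d y by (intro coordinate_path_increment_bound[where f' = f' and d = d] f')
        (auto simp: h_def dist_norm intro: less_imp_le)
    also have "\<dots> \<le> e' * (\<Sum>b\<in>(Basis :: 'a set). norm h)"
      using e' by (intro mult_left_mono sum_mono Basis_le_norm) auto
    also have "\<dots> = e * norm h" by (simp add: e'_def)
    finally show ?thesis by (simp add: h_def euclidean_representation)
  qed
  then show "\<exists>d>0. \<forall>y. norm (y - p) < d \<longrightarrow>
      norm (f y - f p - (\<Sum>b\<in>Basis. ((y - p) \<bullet> b) * f' b p)) \<le> e * norm (y - p)"
    using d(1) by blast
qed

lemma has_derivative_grad:
  fixes f :: "real ^ 'n \<Rightarrow> real"
  assumes S: "open S" "p \<in> S"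
    and partials: "\<And>x i. x \<in> S \<Longrightarrow>
        ((\<lambda>t. f (x + t *\<^sub>R axis i 1)) has_real_derivative dirderiv (axis i 1) f x) (at 0)"
    and cont: "\<And>i. isCont (dirderiv (axis i 1) f) p"
  shows "(f has_derivative (\<lambda>h. grad f p \<bullet> h)) (at p)"
proof -
  have Basis: "(Basis :: (real ^ 'n) set) = range (\<lambda>i. axis i 1)"
    by (auto simp: Basis_vec_def)
  have "inj (\<lambda>i. axis i (1::real) :: real ^ 'n)" by (auto intro!: injI simp: axis_eq_axis)
  then have "(\<Sum>b\<in>Basis. (h \<bullet> b) * dirderiv b f p) = grad f p \<bullet> h" for h
    unfolding Basis inner_vec_def[of "grad f p"]
    by (simp add: sum.reindex inner_axis grad_def mult.commute)
  moreover have "(f has_derivative (\<lambda>h. \<Sum>b\<in>Basis. (h \<bullet> b) * dirderiv b f p)) (at p)"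
    using partials cont by (intro has_derivative_of_continuous_partials[OF S]) (auto simp: Basis)
  ultimately show ?thesis by simp
qed

lemma real_analytic_on_iff_pseries:
  fixes f :: "real ^ 'n \<Rightarrow> real"
  shows "real_analytic_on f S \<longleftrightarrow>
     (\<forall>p\<in>S. \<exists>r>0. \<exists>c. converges_on_ball c r \<and> (\<forall>x\<in>ball p r. f x = Re (pseries c (cvec (x - p)))))"
proof -
  have "(\<forall>x\<in>ball p r. ((\<lambda>\<alpha>. c \<alpha> * (\<Prod>i\<in>UNIV. (x $ i - p $ i) ^ \<alpha> i)) has_sum f x) UNIV) \<longleftrightarrow>
     converges_on_ball c r \<and> (\<forall>x\<in>ball p r. f x = Re (pseries c (cvec (x - p))))"
     (is "?sums \<longleftrightarrow> ?expansion")
    for p :: "real ^ 'n" and r :: real and c :: "('n \<Rightarrow> nat) \<Rightarrow> real"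
  proof
    assume ?sums
    then have sums: "((\<lambda>\<alpha>. c \<alpha> * monom_at \<alpha> y) has_sum f (p + y)) UNIV" if "norm y < r" for y
      using that by (auto simp: dist_norm monom_at_def dest: bspec[of _ _ "p + y"])
    then have conv: "converges_on_ball c r"
      unfolding converges_on_ball_def summable_on_def by fastforce
    have "f x = Re (pseries c (cvec (x - p)))" if "x \<in> ball p r" for x
    proof -
      have "norm (x - p) < r" using that by (simp add: dist_norm norm_minus_commute)
      from has_sum_unique[OF sums[OF this] pseries_cvec_has_sum[OF conv this]] show ?thesis by simp
    qed
    with conv show ?expansion by blast
  next
    assume expansion: ?expansion
    show ?sums
    proof
      fix x assume x: "x \<in> ball p r"
      then have "norm (x - p) < r" by (simp add: dist_norm norm_minus_commute)
      from pseries_cvec_has_sum[OF conjunct1[OF expansion] this]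
      show "((\<lambda>\<alpha>. c \<alpha> * (\<Prod>i\<in>UNIV. (x $ i - p $ i) ^ \<alpha> i)) has_sum f x) UNIV"
        using expansion x by (simp add: monom_at_def)
    qed
  qed
  then show ?thesis unfolding real_analytic_on_def by simp
qed

lemma real_analytic_onE:
  assumes "real_analytic_on f S" "p \<in> S"
  obtains r c where "r > 0" "converges_on_ball c r"
    "\<And>x. x \<in> ball p r \<Longrightarrow> f x = Re (pseries c (cvec (x - p)))"
  using assms unfolding real_analytic_on_iff_pseries by blast

lemma real_analytic_on_subset: "real_analytic_on f S \<Longrightarrow> T \<subseteq> S \<Longrightarrow> real_analytic_on f T"
  unfolding real_analytic_on_def by blast

lemma real_analytic_on_isCont:
  assumes "real_analytic_on f S" "p \<in> S"
  shows "isCont f p"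
proof -
  obtain r c where r: "r > 0" and c: "converges_on_ball c r"
    and f: "\<And>x. x \<in> ball p r \<Longrightarrow> f x = Re (pseries c (cvec (x - p)))"
    by (rule real_analytic_onE[OF assms]) (rule that; assumption)
  have "continuous_on (ball p r) (\<lambda>x. Re (pseries c (cvec (x - p))))"
    by (intro continuous_intros continuous_on_compose2[OF continuous_on_pseries[OF c]])
       (auto simp: dist_norm norm_minus_commute)
  then have "continuous_on (ball p r) f" using f by (metis (no_types, lifting) continuous_on_cong)
  then show ?thesis using r by (simp add: continuous_on_eq_continuous_at)
qed

lemma real_analytic_on_continuous_on: "real_analytic_on f S \<Longrightarrow> continuous_on S f"
  by (intro continuous_at_imp_continuous_on ballI real_analytic_on_isCont)

lemma pseries_has_real_derivative:
  assumes c: "converges_on_ball c r" and x: "norm (x - p) < r"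
    and f: "\<And>x. x \<in> ball p r \<Longrightarrow> f x = Re (pseries c (cvec (x - p)))"
  shows "((\<lambda>t. f (x + t *\<^sub>R v)) has_real_derivative
      Re (pseries (dirderiv_coeff v c) (cvec (x - p)))) (at 0)"
proof -
  have "((\<lambda>s. pseries c (cvec (x - p) + s *s cvec v)) has_field_derivative
      pseries (dirderiv_coeff v c) (cvec (x - p))) (at (of_real 0))"
    using pseries_has_field_derivative[OF c, of "cvec (x - p)" 0] x by simp
  from has_field_derivative_Re[OF has_vector_derivative_real_field[OF this]]
  have "((\<lambda>t. Re (pseries c (cvec (x - p) + of_real t *s cvec v))) has_real_derivative
      Re (pseries (dirderiv_coeff v c) (cvec (x - p)))) (at 0)" .
  moreover have "\<forall>\<^sub>F t in nhds 0. Re (pseries c (cvec (x - p) + of_real t *s cvec v)) =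
      f (x + t *\<^sub>R v)"
  proof -
    have "\<forall>\<^sub>F t in nhds 0. x + t *\<^sub>R v \<in> ball p r"
    proof (rule topological_tendstoD)
      show "((\<lambda>t. x + t *\<^sub>R v) \<longlongrightarrow> x + 0 *\<^sub>R v) (nhds 0)" by (intro tendsto_intros filterlim_ident)
    qed (use x in \<open>auto simp: dist_norm norm_minus_commute\<close>)
    then show ?thesis
      by eventually_elim (simp add: f cvec_add cvec_diff cvec_scaleR algebra_simps)
  qed
  ultimately show ?thesis by (subst DERIV_cong_ev[OF refl _ refl, symmetric])
qed

lemma dirderiv_pseries:
  assumes "converges_on_ball c r" "norm (x - p) < r"
    "\<And>x. x \<in> ball p r \<Longrightarrow> f x = Re (pseries c (cvec (x - p)))"
  shows "dirderiv v f x = Re (pseries (dirderiv_coeff v c) (cvec (x - p)))"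
  unfolding dirderiv_def by (rule DERIV_imp_deriv[OF pseries_has_real_derivative[OF assms]])

lemma dirderiv_funpow_pseries:
  assumes c: "converges_on_ball c r" and f: "\<And>x. x \<in> ball 0 r \<Longrightarrow> f x = Re (pseries c (cvec x))"
  shows "x \<in> ball 0 r \<Longrightarrow> (dirderiv v ^^ j) f x = Re (pseries ((dirderiv_coeff v ^^ j) c) (cvec x))"
proof (induction j arbitrary: x)
  case (Suc j)
  then show ?case
    using dirderiv_pseries[OF converges_on_ball_dirderiv_coeff_funpow[OF c], where p = 0] by simp
qed (simp add: f)

lemma real_analytic_on_dirderiv:
  assumes "real_analytic_on f S"
  shows "real_analytic_on (dirderiv v f) S"
  unfolding real_analytic_on_iff_pseries
proof
  fix p assume "p \<in> S"
  then obtain r c where r: "r > 0" and c: "converges_on_ball c r"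
    and f: "\<And>x. x \<in> ball p r \<Longrightarrow> f x = Re (pseries c (cvec (x - p)))"
    using real_analytic_onE[OF assms] by metis
  have "dirderiv v f x = Re (pseries (dirderiv_coeff v c) (cvec (x - p)))" if "x \<in> ball p r" for x
    using that by (intro dirderiv_pseries[OF c] f) (auto simp: dist_norm norm_minus_commute)
  then show "\<exists>r>0. \<exists>c. converges_on_ball c r \<and>
      (\<forall>x\<in>ball p r. dirderiv v f x = Re (pseries c (cvec (x - p))))"
    using r converges_on_ball_dirderiv_coeff[OF c] by blast
qed

lemma real_analytic_on_dirderiv_funpow:
  "real_analytic_on f S \<Longrightarrow> real_analytic_on ((dirderiv v ^^ j) f) S"
  by (induction j) (auto intro: real_analytic_on_dirderiv)

lemma real_analytic_on_has_dirderiv: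
  assumes "real_analytic_on f S" "p \<in> S"
  shows "((\<lambda>t. f (p + t *\<^sub>R v)) has_real_derivative dirderiv v f p) (at 0)"
proof -
  obtain r c where r: "r > 0" and c: "converges_on_ball c r"
    and f: "\<And>x. x \<in> ball p r \<Longrightarrow> f x = Re (pseries c (cvec (x - p)))"
    by (rule real_analytic_onE[OF assms]) (rule that; assumption)
  have "((\<lambda>t. f (p + t *\<^sub>R v)) has_real_derivative
      Re (pseries (dirderiv_coeff v c) (cvec (p - p)))) (at 0)"
    using r by (intro pseries_has_real_derivative[OF c] f) auto
  then show ?thesis using DERIV_imp_deriv dirderiv_def by metis
qed

lemma real_analytic_on_has_derivative:
  fixes f :: "real ^ 'n \<Rightarrow> real"
  assumes f: "real_analytic_on f S" and S: "open S" "p \<in> S"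
  shows "(f has_derivative (\<lambda>h. grad f p \<bullet> h)) (at p)"
  using real_analytic_on_isCont[OF real_analytic_on_dirderiv[OF f]] S
  by (intro has_derivative_grad[OF S] real_analytic_on_has_dirderiv[OF f]) auto

lemma real_analytic_on_dirderiv_eq_inner:
  assumes "real_analytic_on f S" "open S" "p \<in> S"
  shows "dirderiv v f p = grad f p \<bullet> v"
  using has_derivative_imp_dirderiv[OF real_analytic_on_has_derivative[OF assms]] .

lemma eventually_nonzero_isCont:
  fixes f :: "'a::t2_space \<Rightarrow> 'b::t1_space"
  assumes "isCont f x" "f x \<noteq> a"
  shows "\<forall>\<^sub>F y in nhds x. f y \<noteq> a"
  using assms by (simp add: isCont_def tendsto_at_iff_tendsto_nhds tendsto_imp_eventually_ne)

lemma Rolle_line: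
  fixes g :: "'a::real_vector \<Rightarrow> real"
  assumes zeros: "g p = 0" "g (p + s *\<^sub>R v) = 0" and s: "s \<noteq> 0"
    and deriv: "\<And>t. t \<in> closed_segment 0 s \<Longrightarrow>
      ((\<lambda>h. g ((p + t *\<^sub>R v) + h *\<^sub>R v)) has_real_derivative dirderiv v g (p + t *\<^sub>R v)) (at 0)"
  shows "\<exists>t\<in>closed_segment 0 s. dirderiv v g (p + t *\<^sub>R v) = 0"
proof -
  define lo hi where "lo = min 0 s" and "hi = max 0 s"
  have seg: "lo < hi" "{lo..hi} = closed_segment 0 s"
    using s by (auto simp: lo_def hi_def closed_segment_eq_real_ivl)
  have "((\<lambda>t. g (p + t *\<^sub>R v)) has_real_derivative dirderiv v g (p + t *\<^sub>R v)) (at t)"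
    if "t \<in> closed_segment 0 s" for t
    using deriv[OF that] by (rule has_real_derivative_line_shift)
  then obtain t where t: "lo < t" "t < hi" and
    "g (p + hi *\<^sub>R v) - g (p + lo *\<^sub>R v) = (hi - lo) * dirderiv v g (p + t *\<^sub>R v)"
    using MVT2[OF seg(1), of "\<lambda>t. g (p + t *\<^sub>R v)" "\<lambda>t. dirderiv v g (p + t *\<^sub>R v)"] seg(2)
    by (metis atLeastAtMost_iff)
  moreover have "g (p + lo *\<^sub>R v) = 0" "g (p + hi *\<^sub>R v) = 0"
    using zeros by (auto simp: lo_def hi_def min_def max_def)
  ultimately have "dirderiv v g (p + t *\<^sub>R v) = 0" using seg(1) by simp
  moreover have "t \<in> closed_segment 0 s" unfolding seg(2)[symmetric] using t by simp
  ultimately show ?thesis by blast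
qed

section \<open>Functions holomorphic on complex lines\<close>

text \<open>
  Only complex lines in real directions are considered; the coefficients of the power series then
  stay real.
\<close>

definition line_holomorphic :: "(complex ^ 'n \<Rightarrow> complex) \<Rightarrow> real \<Rightarrow> bool" where
  "line_holomorphic \<Phi> R \<longleftrightarrow> continuous_on (ball 0 R) \<Phi> \<and>
     (\<forall>z w. (\<lambda>s. \<Phi> (z + s *s cvec w)) holomorphic_on {s. norm (z + s *s cvec w) < R})"

lemma open_line_section: "open {s. norm (z + s *s cvec w) < R}"
  by (intro open_Collect_less continuous_intros)

lemma convex_line_section: "convex {s. norm (z + s *s cvec w) < R}"
proof -
  have "linear (\<lambda>s. s *s cvec w)"
    by (rule linearI) (auto simp: vec_eq_iff algebra_simps)
  then have "convex ((\<lambda>s. s *s cvec w) -` ((\<lambda>x. - z + x) ` ball 0 R))"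
    by (intro convex_linear_vimage convex_translation convex_ball)
  also have "(\<lambda>s. s *s cvec w) -` ((\<lambda>x. - z + x) ` ball 0 R) = {s. norm (z + s *s cvec w) < R}"
    by (auto simp: image_iff algebra_simps intro!: bexI[of _ "z + _ *s cvec w"])
  finally show ?thesis .
qed

lemma line_holomorphicD:
  assumes "line_holomorphic \<Phi> R"
  shows "continuous_on (ball 0 R) \<Phi>"
    and "(\<lambda>s. \<Phi> (z + s *s cvec w)) holomorphic_on {s. norm (z + s *s cvec w) < R}"
  using assms by (auto simp: line_holomorphic_def)

lemma line_holomorphic_pseries:
  assumes "converges_on_ball c r"
  shows "line_holomorphic (pseries c) r"
  unfolding line_holomorphic_def holomorphic_on_open[OF open_line_section]
  using continuous_on_pseries[OF assms] pseries_has_field_derivative[OF assms] by blast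

lemma line_holomorphic_cong:
  assumes "line_holomorphic \<Phi> R" and "\<And>z. norm z < R \<Longrightarrow> \<Phi> z = \<Psi> z"
  shows "line_holomorphic \<Psi> R"
  using assms unfolding line_holomorphic_def
  by (auto cong: continuous_on_cong_simp intro: holomorphic_transform)

lemma line_holomorphic_diff:
  assumes "line_holomorphic \<Phi> R" "line_holomorphic \<Psi> R"
  shows "line_holomorphic (\<lambda>z. \<Phi> z - \<Psi> z) R"
  using assms unfolding line_holomorphic_def by (auto intro!: continuous_intros holomorphic_intros)

lemma line_holomorphic_prod:
  assumes "\<And>i. i \<in> I \<Longrightarrow> line_holomorphic (\<Phi> i) R"
  shows "line_holomorphic (\<lambda>z. \<Prod>i\<in>I. \<Phi> i z) R"
  using assms unfolding line_holomorphic_def by (auto intro!: continuous_intros holomorphic_intros)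

lemma uniform_limit_section_compact:
  fixes g :: "'a::topological_space \<Rightarrow> 'b::topological_space \<Rightarrow> 'c::metric_space"
  assumes cont: "continuous_on (U \<times> C) (\<lambda>(x, t). g x t)" and C: "compact C" and U: "open U" "x0 \<in> U"
  shows "uniform_limit C g (g x0) (nhds x0)"
proof (rule uniform_limitI)
  fix e :: real assume "e > 0"
  then have "e / 2 > 0" by simp
  from continuous_on_prod_compactE[OF cont C U(2) this]
  obtain X where X: "x0 \<in> X" "open X" "\<forall>x\<in>X \<inter> U. \<forall>t\<in>C. dist (g x t) (g x0 t) \<le> e / 2"
    unfolding prod.case by blast
  have "\<forall>\<^sub>F x in nhds x0. x \<in> X \<inter> U" using X U by (intro eventually_nhds_in_open) auto
  then show "\<forall>\<^sub>F x in nhds x0. \<forall>t\<in>C. dist (g x t) (g x0 t) < e"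
  proof eventually_elim
    case (elim x)
    then have "\<forall>t\<in>C. dist (g x t) (g x0 t) \<le> e / 2" using X(3) by blast
    then show ?case using \<open>e > 0\<close> by force
  qed
qed

lemma exists_zero_free_circle:
  assumes hol: "h holomorphic_on S" and S: "open S" "connected S" and nonzero: "\<exists>t\<in>S. h t \<noteq> 0"
    and \<rho>: "0 < \<rho>" "cball 0 \<rho> \<subseteq> S"
  shows "\<exists>s. 0 < s \<and> s < \<rho> \<and> (\<forall>t. norm t = s \<longrightarrow> h t \<noteq> 0)"
proof -
  have "finite {t\<in>cball 0 \<rho>. h t = 0}"
  proof (cases "h constant_on S")
    case True
    then obtain y where "\<And>t. t \<in> S \<Longrightarrow> h t = y" by (auto simp: constant_on_def)
    then have "{t\<in>cball 0 \<rho>. h t = 0} = {}" using nonzero \<rho>(2) by auto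
    then show ?thesis by (simp only: finite.emptyI)
  next
    case False
    then show ?thesis by (intro holomorphic_compact_finite_zeros[OF hol S compact_cball \<rho>(2)])
  qed
  then have "finite (norm ` {t\<in>cball 0 \<rho>. h t = 0})" by (rule finite_imageI)
  moreover have "infinite {0<..<\<rho>}" using \<rho> by simp
  ultimately obtain s where "s \<in> {0<..<\<rho>}" "s \<notin> norm ` {t\<in>cball 0 \<rho>. h t = 0}"
    by (meson finite_subset subsetI)
  then show ?thesis by (intro exI[of _ s]) (auto simp: image_iff)
qed

lemma norm_line_less:
  fixes z w :: "complex ^ 'n"
  assumes "norm z < \<epsilon>" "\<epsilon> + s * norm w \<le> R" "norm t \<le> s"
  shows "norm (z + t *s w) < R"
proof -
  have "norm t * norm w \<le> s * norm w" using assms(3) by (rule mult_right_mono) simp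
  then show ?thesis
    using norm_triangle_ineq[of z "t *s w"] assms(1,2) by (simp add: norm_vector_scalar_mult)
qed

lemma eventually_uniform_bounds_section:
  fixes g :: "'a::topological_space \<Rightarrow> 'b::t2_space \<Rightarrow> 'c::{real_normed_vector, heine_borel}"
  assumes cont: "continuous_on (U \<times> C) (\<lambda>(x, t). g x t)" and U: "open U" "x0 \<in> U"
    and C: "compact C" and S: "compact S" "S \<subseteq> C" and nonzero: "\<And>t. t \<in> S \<Longrightarrow> g x0 t \<noteq> 0"
  shows "\<exists>c>0. \<exists>M. \<forall>\<^sub>F x in nhds x0. (\<forall>t\<in>C. norm (g x t) \<le> M) \<and> (\<forall>t\<in>S. c \<le> norm (g x t))"
proof -
  have cont_C: "continuous_on C (g x0)"
    using continuous_on_compose2[OF cont, of C "\<lambda>t. (x0, t)"] U(2)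
    by (simp add: image_subset_iff continuous_intros)
  have "bounded (g x0 ` C)" by (intro compact_imp_bounded compact_continuous_image cont_C C)
  then obtain M where M: "\<And>t. t \<in> C \<Longrightarrow> norm (g x0 t) \<le> M" by (auto simp: bounded_iff)
  have "closed (g x0 ` S)"
    by (intro compact_imp_closed compact_continuous_image continuous_on_subset[OF cont_C] S)
  then obtain d where d: "d > 0" "\<And>t. t \<in> S \<Longrightarrow> d \<le> norm (g x0 t)"
    using separate_point_closed[of "g x0 ` S" 0] nonzero by force
  have "\<forall>\<^sub>F x in nhds x0. \<forall>t\<in>C. dist (g x t) (g x0 t) < d / 2"
    using uniform_limitD[OF uniform_limit_section_compact[OF cont C U] half_gt_zero[OF d(1)]] .
  then have "\<forall>\<^sub>F x in nhds x0. (\<forall>t\<in>C. norm (g x t) \<le> M + d / 2) \<and> (\<forall>t\<in>S. d / 2 \<le> norm (g x t))"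
  proof eventually_elim
    case (elim x)
    have "norm (g x t) \<le> M + d / 2" if "t \<in> C" for t
      using norm_triangle_ineq2[of "g x t" "g x0 t"] bspec[OF elim that] M[OF that]
      by (simp add: dist_norm)
    moreover have "d / 2 \<le> norm (g x t)" if "t \<in> S" for t
      using norm_triangle_ineq2[of "g x0 t" "g x t"] bspec[OF elim, of t] d(2)[OF that] that S(2)
      by (auto simp: dist_norm norm_minus_commute)
    ultimately show ?case by blast
  qed
  then show ?thesis using d(1) half_gt_zero by blast
qed

lemma line_holomorphic_zero_free_circle:
  fixes \<Phi> :: "complex ^ 'n \<Rightarrow> complex" and v :: "real ^ 'n"
  assumes \<Phi>: "line_holomorphic \<Phi> R" and nonzero: "norm v < R" "\<Phi> (cvec v) \<noteq> 0" and \<rho>0: "\<rho>0 > 0"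
  obtains \<rho> where "0 < \<rho>" "\<rho> < \<rho>0" "5 * \<rho> * norm v \<le> R / 2" "\<And>t. norm t = \<rho> \<Longrightarrow> \<Phi> (t *s cvec v) \<noteq> 0"
proof -
  have R: "R > 0" using nonzero(1) norm_ge_zero[of v] by linarith
  obtain \<rho>1 where \<rho>1: "\<rho>1 > 0" "\<rho>1 \<le> \<rho>0" "\<rho>1 * norm v \<le> R / 10"
    using exists_pos_le_scaled_norm_le[OF \<rho>0, of "R / 10" v] R by auto
  let ?S = "{s. norm (0 + s *s cvec v) < R}"
  have hol: "(\<lambda>s. \<Phi> (0 + s *s cvec v)) holomorphic_on ?S" by (rule line_holomorphicD(2)[OF \<Phi>])
  have "1 *s cvec v = cvec v" by (simp add: vec_eq_iff)
  then have ex: "\<exists>s\<in>?S. \<Phi> (0 + s *s cvec v) \<noteq> 0" using nonzero by (intro bexI[of _ 1]) auto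
  have sub: "cball 0 \<rho>1 \<subseteq> ?S"
    using \<rho>1 R by (auto intro!: norm_line_less[where \<epsilon> = "R / 2" and s = \<rho>1, of 0, simplified])
  obtain \<rho> where \<rho>: "0 < \<rho>" "\<rho> < \<rho>1" "\<forall>t. norm t = \<rho> \<longrightarrow> \<Phi> (0 + t *s cvec v) \<noteq> 0"
    using exists_zero_free_circle[OF hol open_line_section convex_connected[OF convex_line_section]
        ex \<rho>1(1) sub]
    by blast
  have "\<rho> * norm v \<le> \<rho>1 * norm v" using \<rho>(2) by (intro mult_right_mono) auto
  then show ?thesis using that[of \<rho>] \<rho> \<rho>1 by simp
qed

lemma line_holomorphic_bounded_disc_functions:
  fixes \<Phi> :: "complex ^ 'n \<Rightarrow> complex" and v :: "real ^ 'n"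
  assumes \<Phi>: "line_holomorphic \<Phi> R" and nonzero: "norm v < R" "\<Phi> (cvec v) \<noteq> 0" and \<rho>0: "\<rho>0 > 0"
  obtains \<rho> c M \<epsilon> where "0 < \<epsilon>" "0 < \<rho>" "\<rho> < \<rho>0" "\<epsilon> + 5 * \<rho> * norm v < R"
    "\<And>z. norm z < \<epsilon> \<Longrightarrow> bounded_disc_function (\<lambda>t. \<Phi> (z + t *s cvec v)) \<rho> c M"
proof -
  obtain \<rho> where \<rho>: "0 < \<rho>" "\<rho> < \<rho>0" "5 * \<rho> * norm v \<le> R / 2"
    and circle: "\<And>t. norm t = \<rho> \<Longrightarrow> \<Phi> (t *s cvec v) \<noteq> 0"
    by (rule line_holomorphic_zero_free_circle[OF assms]) (rule that; assumption)
  have R: "R > 0" using nonzero(1) norm_ge_zero[of v] by linarith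
  define g where "g = (\<lambda>z t. \<Phi> (z + t *s cvec v))"
  have in_ball: "norm (z + t *s cvec v) < R"
    if "norm z < R / 2" "norm t \<le> 5 * \<rho>" for z :: "complex ^ 'n" and t
    using that \<rho>(3) by (intro norm_line_less[of z "R / 2" "5 * \<rho>"]) auto
  have cont: "continuous_on (ball 0 (R / 2) \<times> cball 0 (5 * \<rho>)) (\<lambda>(z, t). g z t)"
    unfolding g_def case_prod_unfold using in_ball
    by (intro continuous_on_compose2[OF line_holomorphicD(1)[OF \<Phi>]] continuous_intros) auto
  have sphere: "compact (sphere (0::complex) \<rho>)" "sphere (0::complex) \<rho> \<subseteq> cball 0 (5 * \<rho>)"
    using \<rho> by auto
  have nonzero_sphere: "g 0 t \<noteq> 0" if "t \<in> sphere 0 \<rho>" for t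
    using circle[of t] that by (simp add: g_def)
  have "0 \<in> ball (0 :: complex ^ 'n) (R / 2)" using R by simp
  from eventually_uniform_bounds_section[OF cont open_ball this compact_cball sphere nonzero_sphere]
  obtain c M where c: "c > 0" and "\<forall>\<^sub>F z in nhds 0.
      (\<forall>t\<in>cball 0 (5 * \<rho>). norm (g z t) \<le> M) \<and> (\<forall>t\<in>sphere 0 \<rho>. c \<le> norm (g z t))" by blast
  then obtain d where d: "d > 0" and bounds: "\<And>z. norm z < d \<Longrightarrow>
      (\<forall>t\<in>cball 0 (5 * \<rho>). norm (g z t) \<le> M) \<and> (\<forall>t\<in>sphere 0 \<rho>. c \<le> norm (g z t))"
    by (auto simp: eventually_nhds_metric)
  define \<epsilon> where "\<epsilon> = min d (R / 4)"
  show ?thesis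
  proof (rule that)
    show "0 < \<epsilon>" "\<epsilon> + 5 * \<rho> * norm v < R" using d R \<rho> by (auto simp: \<epsilon>_def)
    fix z :: "complex ^ 'n" assume z: "norm z < \<epsilon>"
    show "bounded_disc_function (\<lambda>t. \<Phi> (z + t *s cvec v)) \<rho> c M"
    proof
      show "(\<lambda>t. \<Phi> (z + t *s cvec v)) holomorphic_on ball 0 (5 * \<rho>)"
        using z R in_ball
        by (intro holomorphic_on_subset[OF line_holomorphicD(2)[OF \<Phi>]]) (auto simp: \<epsilon>_def)
    qed (use bounds[of z] z \<rho> c in \<open>auto simp: \<epsilon>_def g_def\<close>)
  qed (use \<rho> in auto)
qed

lemma norm_add_scaleR_ge_half:
  fixes x v :: "'a::real_normed_vector"
  assumes "\<bar>t\<bar> \<le> a" "a * norm v \<le> \<epsilon> / 2" "norm x \<ge> \<epsilon>"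
  shows "norm (x + t *\<^sub>R v) \<ge> \<epsilon> / 2"
proof -
  have "\<bar>t\<bar> * norm v \<le> a * norm v" using assms(1) by (rule mult_right_mono) simp
  then show ?thesis using assms(2,3) norm_diff_ineq[of x "t *\<^sub>R v"] by simp
qed

lemma nn_integral_finite_by_lines:
  fixes g K :: "'a::euclidean_space \<Rightarrow> ennreal"
  assumes [measurable]: "g \<in> borel_measurable borel" and \<rho>: "\<rho> > 0" and \<epsilon>: "\<epsilon> > 0"
    and support: "\<And>x. norm x \<ge> \<epsilon> / 2 \<Longrightarrow> g x = 0"
    and line: "AE x in lborel. norm x < \<epsilon> \<longrightarrow> (\<integral>\<^sup>+t\<in>{-\<rho>..\<rho>}. g (x + t *\<^sub>R v) \<partial>lborel) \<le> K x"
    and K: "(\<integral>\<^sup>+x\<in>ball 0 \<epsilon>. K x \<partial>lborel) < \<infinity>"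
  shows "(\<integral>\<^sup>+x. g x \<partial>lborel) < \<infinity>"
proof -
  obtain a where a: "a > 0" "a \<le> \<rho>" and av: "a * norm v \<le> \<epsilon> / 2"
    using exists_pos_le_scaled_norm_le[of \<rho> "\<epsilon> / 2" v] \<rho> \<epsilon> by auto
  have "ennreal (2 * a) * (\<integral>\<^sup>+x. g x \<partial>lborel) =
     (\<integral>\<^sup>+x. (\<integral>\<^sup>+t\<in>{-a..a}. g (x + t *\<^sub>R v) \<partial>lborel) \<partial>lborel)"
    by (rule nn_integral_line_average) (use a in auto)
  also have "\<dots> \<le> (\<integral>\<^sup>+x\<in>ball 0 \<epsilon>. K x \<partial>lborel)"
  proof (rule nn_integral_mono_AE)
    show "AE x in lborel. (\<integral>\<^sup>+t\<in>{-a..a}. g (x + t *\<^sub>R v) \<partial>lborel) \<le> K x * indicator (ball 0 \<epsilon>) x"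
      using line
    proof eventually_elim
      case (elim x)
      show ?case
      proof (cases "norm x < \<epsilon>")
        case True
        have "(\<integral>\<^sup>+t\<in>{-a..a}. g (x + t *\<^sub>R v) \<partial>lborel) \<le> (\<integral>\<^sup>+t\<in>{-\<rho>..\<rho>}. g (x + t *\<^sub>R v) \<partial>lborel)"
          using a by (intro nn_integral_mono) (auto simp: indicator_def)
        then show ?thesis using elim True by auto
      next
        case False
        then have "g (x + t *\<^sub>R v) * indicator {-a..a} t = 0" for t
          using support norm_add_scaleR_ge_half[OF _ av, of t x] by (auto simp: indicator_def)
        then show ?thesis by (simp only: nn_integral_const mult_zero_left zero_le)
      qed
    qed
  qed
  finally have "ennreal (2 * a) * (\<integral>\<^sup>+x. g x \<partial>lborel) < \<infinity>" using K by (rule order_le_less_trans)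
  then show ?thesis using a by (auto simp: ennreal_mult_less_top)
qed

lemma borel_measurable_comp_indicator:
  fixes u :: "'a \<Rightarrow> 'b::real_normed_vector" and \<phi> :: "'b \<Rightarrow> ennreal"
  assumes "set_borel_measurable M A u" and [measurable]: "\<phi> \<in> borel_measurable borel" "A \<in> sets M"
  shows "(\<lambda>x. \<phi> (u x) * indicator A x) \<in> borel_measurable M"
proof -
  have [measurable]: "(\<lambda>x. indicator A x *\<^sub>R u x) \<in> borel_measurable M"
    using assms(1) by (simp add: set_borel_measurable_def)
  have "(\<lambda>x. \<phi> (u x) * indicator A x) = (\<lambda>x. \<phi> (indicator A x *\<^sub>R u x) * indicator A x)"
    by (auto simp: indicator_def fun_eq_iff)
  also have "\<dots> \<in> borel_measurable M" by measurable
  finally show ?thesis .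
qed

lemma set_borel_measurable_line_holomorphic:
  fixes \<Phi> :: "complex ^ 'n \<Rightarrow> complex"
  assumes "line_holomorphic \<Phi> R" "\<epsilon> \<le> R"
  shows "set_borel_measurable borel (ball 0 \<epsilon>) (\<lambda>x. \<Phi> (cvec x))"
proof -
  have "continuous_on (ball 0 \<epsilon>) (\<lambda>x. \<Phi> (cvec x))"
    using assms(2)
    by (intro continuous_on_compose2[OF line_holomorphicD(1)[OF assms(1)]] continuous_intros) auto
  then show ?thesis
    unfolding set_borel_measurable_def by (intro borel_measurable_continuous_on_indicator) auto
qed

lemma line_holomorphic_nn_integral_abs_ln_finite:
  fixes \<Phi> :: "complex ^ 'n \<Rightarrow> complex" and v :: "real ^ 'n"
  assumes \<Phi>: "line_holomorphic \<Phi> R" and nonzero: "norm v < R" "\<Phi> (cvec v) \<noteq> 0"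
  obtains \<epsilon> where "0 < \<epsilon>" "\<epsilon> < R" "(\<integral>\<^sup>+x\<in>ball 0 \<epsilon>. abs_ln (norm (\<Phi> (cvec x))) \<partial>lborel) < \<infinity>"
proof -
  obtain \<rho> c M \<epsilon> where \<epsilon>: "0 < \<epsilon>" "\<epsilon> + 5 * \<rho> * norm v < R" and \<rho>: "0 < \<rho>"
    and family: "\<And>z. norm z < \<epsilon> \<Longrightarrow> bounded_disc_function (\<lambda>t. \<Phi> (z + t *s cvec v)) \<rho> c M"
    by (rule line_holomorphic_bounded_disc_functions[OF assms zero_less_one])
       (rule that; assumption)
  have "0 \<le> 5 * \<rho> * norm v" using \<rho> by simp
  then have \<epsilon>R: "\<epsilon> < R" using \<epsilon> by linarith
  define C where "C = ennreal ((\<bar>ln c\<bar> + \<bar>ln M\<bar>) * (2 * \<rho>) + zero_count_bound c M * (16 * \<rho>))"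
  define g where "g = (\<lambda>x. abs_ln (norm (\<Phi> (cvec x))) * indicator (ball 0 (\<epsilon> / 2)) x)"
  have "(\<integral>\<^sup>+x. g x \<partial>lborel) < \<infinity>"
  proof (rule nn_integral_finite_by_lines[where K = "\<lambda>_. C" and \<rho> = \<rho> and v = v and \<epsilon> = \<epsilon>])
    show "g \<in> borel_measurable borel"
      unfolding g_def using \<epsilon> \<epsilon>R
      by (intro borel_measurable_comp_indicator[where \<phi> = "\<lambda>y. abs_ln (norm y)"]
          set_borel_measurable_line_holomorphic[OF \<Phi>]) auto
    show "AE x in lborel. norm x < \<epsilon> \<longrightarrow> (\<integral>\<^sup>+t\<in>{-\<rho>..\<rho>}. g (x + t *\<^sub>R v) \<partial>lborel) \<le> C"
    proof (intro AE_I2 impI)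
      fix x :: "real ^ 'n" assume x: "norm x < \<epsilon>"
      interpret bounded_disc_function "\<lambda>t. \<Phi> (cvec x + t *s cvec v)" \<rho> c M
        using x by (intro family) simp
      have "(\<integral>\<^sup>+t\<in>{-\<rho>..\<rho>}. g (x + t *\<^sub>R v) \<partial>lborel) \<le>
         (\<integral>\<^sup>+t\<in>{-\<rho>..\<rho>}. abs_ln (norm (\<Phi> (cvec x + of_real t *s cvec v))) \<partial>lborel)"
        by (intro nn_integral_mono) (auto simp: g_def indicator_def cvec_add cvec_scaleR)
      also have "\<dots> \<le> C" unfolding C_def by (rule nn_integral_abs_ln_norm_le)
      finally show "(\<integral>\<^sup>+t\<in>{-\<rho>..\<rho>}. g (x + t *\<^sub>R v) \<partial>lborel) \<le> C" .
    qed
    show "(\<integral>\<^sup>+x\<in>ball 0 \<epsilon>. C \<partial>(lborel :: (real^'n) measure)) < \<infinity>"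
      by (subst nn_integral_cmult_indicator)
         (use emeasure_lborel_ball_finite[of "0::real^'n" \<epsilon>]
             in \<open>auto simp: C_def ennreal_mult_less_top\<close>)
  qed (use \<rho> \<epsilon> in \<open>auto simp: g_def\<close>)
  then show ?thesis using that[of "\<epsilon> / 2"] \<epsilon>(1) \<epsilon>R by (simp add: g_def)
qed

section \<open>Power sums of zeros and the discriminant\<close>

text \<open>All ordered pairs are used, so that reordering the points does not change the product.\<close>

definition distinct_pairs :: "'i set \<Rightarrow> ('i \<times> 'i) set" where
  "distinct_pairs A = {(a, b). a \<in> A \<and> b \<in> A \<and> a \<noteq> b}"

definition root_product :: "complex set \<Rightarrow> complex" where
  "root_product A = (\<Prod>(\<xi>, \<zeta>)\<in>distinct_pairs A. \<xi> - \<zeta>)"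

lemma finite_distinct_pairs: "finite A \<Longrightarrow> finite (distinct_pairs A)"
  by (rule finite_subset[of _ "A \<times> A"]) (auto simp: distinct_pairs_def)

lemma prod_differences_inj_on:
  assumes "inj_on \<tau> I"
  shows "(\<Prod>(a, b)\<in>distinct_pairs I. \<tau> a - \<tau> b) = root_product (\<tau> ` I)"
proof -
  have "distinct_pairs (\<tau> ` I) = map_prod \<tau> \<tau> ` distinct_pairs I"
    using assms by (auto simp: distinct_pairs_def image_iff inj_on_def)
  moreover have "inj_on (map_prod \<tau> \<tau>) (distinct_pairs I)"
    using assms by (auto simp: distinct_pairs_def inj_on_def)
  ultimately show ?thesis by (simp add: root_product_def prod.reindex case_prod_unfold)
qed

lemma prod_differences_not_inj_on:
  fixes \<tau> :: "'i \<Rightarrow> 'a::idom"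
  assumes "finite I" "\<not> inj_on \<tau> I"
  shows "(\<Prod>(a, b)\<in>distinct_pairs I. \<tau> a - \<tau> b) = 0"
proof -
  obtain a b where "(a, b) \<in> distinct_pairs I" "\<tau> a - \<tau> b = 0"
    using assms(2) by (auto simp: inj_on_def distinct_pairs_def)
  then show ?thesis
    using finite_distinct_pairs[OF assms(1)] by (intro prod_zero bexI[of _ "(a, b)"]) auto
qed

lemma root_product_nonzero: "finite A \<Longrightarrow> root_product A \<noteq> 0"
  unfolding root_product_def
  by (subst prod_zero_iff) (auto simp: finite_distinct_pairs, simp add: distinct_pairs_def)

lemma norm_root_product_le_dist:
  assumes A: "finite A" "A \<subseteq> cball 0 (1/2)" and pair: "\<xi> \<in> A" "\<zeta> \<in> A" "\<xi> \<noteq> \<zeta>"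
  shows "norm (root_product A) \<le> norm (\<xi> - \<zeta>)"
proof -
  have "root_product A = (\<xi> - \<zeta>) * (\<Prod>(p, q)\<in>distinct_pairs A - {(\<xi>, \<zeta>)}. p - q)"
    unfolding root_product_def using pair finite_distinct_pairs[OF A(1)]
    by (subst prod.remove[of _ "(\<xi>, \<zeta>)"]) (auto simp: distinct_pairs_def)
  moreover have "norm (\<Prod>(p, q)\<in>distinct_pairs A - {(\<xi>, \<zeta>)}. p - q) \<le> 1"
    unfolding prod_norm[symmetric]
  proof (intro prod_le_1 conjI)
    fix x assume "x \<in> distinct_pairs A - {(\<xi>, \<zeta>)}"
    then obtain p q where x: "x = (p, q)" "p \<in> A" "q \<in> A" by (auto simp: distinct_pairs_def)
    then have "norm p \<le> 1/2" "norm q \<le> 1/2" using A(2) by auto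
    then show "norm (case x of (p, q) \<Rightarrow> p - q) \<le> 1"
      using norm_triangle_ineq4[of p q] by (simp add: x(1))
  qed auto
  ultimately show ?thesis by (simp add: norm_mult mult_left_le)
qed

lemma card_inj_on_lessThan:
  assumes "finite A" "card A = k"
  shows "card {\<tau> \<in> {..<k} \<rightarrow>\<^sub>E A. inj_on \<tau> {..<k}} = fact k"
  using card_inj_on_subset_funcset[of "{..<k}" A "{..<k}"] assms fact_prod_rev[of k, where 'a = nat]
  by simp

locale line_family =
  fixes c :: "('n::finite \<Rightarrow> nat) \<Rightarrow> real" and r \<rho> m M \<epsilon> :: real and v :: "real ^ 'n"
  assumes converges: "converges_on_ball c r" and radius_le: "\<rho> \<le> 1/2"
    and base_pos: "0 < \<epsilon>" and margin: "\<epsilon> + 5 * \<rho> * norm v < r"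
    and bounded_disc: "\<And>z. norm z < \<epsilon> \<Longrightarrow>
        bounded_disc_function (\<lambda>t. pseries c (z + t *s cvec v)) \<rho> m M"
begin

abbreviation H :: "complex ^ 'n \<Rightarrow> complex \<Rightarrow> complex" where
  "H z t \<equiv> pseries c (z + t *s cvec v)"

abbreviation zeros :: "complex ^ 'n \<Rightarrow> complex set" where
  "zeros z \<equiv> disc_zeros (H z) \<rho>"

abbreviation mult_at :: "complex ^ 'n \<Rightarrow> complex \<Rightarrow> nat" where
  "mult_at z \<equiv> zero_mult (H z)"

definition circle_point :: "real \<Rightarrow> complex" where
  "circle_point \<theta> = of_real \<rho> * exp (2 * of_real pi * \<i> * of_real \<theta>)"

text \<open>The contour integral of \<open>t ^ j * (deriv (H z) t / H z t)\<close>, visibly analytic in \<open>z\<close>.\<close>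

definition power_sum :: "nat \<Rightarrow> complex ^ 'n \<Rightarrow> complex" where
  "power_sum j z = integral (cbox 0 1) (\<lambda>\<theta>. circle_point \<theta> ^ (j + 1) *
     (pseries (dirderiv_coeff v c) (z + circle_point \<theta> *s cvec v) / H z (circle_point \<theta>)))"

lemma \<rho>_pos: "0 < \<rho>"
  using bounded_disc_function.radius_pos[OF bounded_disc[of 0]] base_pos by simp

lemma m_pos: "0 < m"
  using bounded_disc_function.lower_bound_pos[OF bounded_disc[of 0]] base_pos by simp

lemma base_less: "\<epsilon> < r"
proof -
  have "0 \<le> 5 * \<rho> * norm v" using \<rho>_pos by simp
  then show ?thesis using margin by linarith
qed

lemma line_in_ball: "norm z < \<epsilon> \<Longrightarrow> norm t \<le> 5 * \<rho> \<Longrightarrow> norm (z + t *s cvec v) < r"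
  by (rule norm_line_less[of z \<epsilon> "5 * \<rho>"]) (use margin in auto)

lemma finite_zeros: "norm z < \<epsilon> \<Longrightarrow> finite (zeros z)"
  by (rule bounded_disc_function.finite_Z[OF bounded_disc])

lemma H_holomorphic: "norm z < \<epsilon> \<Longrightarrow> H z holomorphic_on ball 0 (5 * \<rho>)"
  by (rule bounded_disc_function.holomorphic_h[OF bounded_disc])

lemma deriv_H:
  "norm z < \<epsilon> \<Longrightarrow> norm t \<le> 5 * \<rho> \<Longrightarrow> deriv (H z) t = pseries (dirderiv_coeff v c) (z + t *s cvec v)"
  by (intro DERIV_imp_deriv pseries_has_field_derivative[OF converges] line_in_ball)

lemma norm_circle_point [simp]: "norm (circle_point \<theta>) = \<rho>"
  using \<rho>_pos by (simp add: circle_point_def norm_mult)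

lemma continuous_on_circle_point [continuous_intros]:
  "continuous_on S g \<Longrightarrow> continuous_on S (\<lambda>x. circle_point (g x))"
  unfolding circle_point_def by (intro continuous_intros)

lemma H_nonzero_on_circle: "norm z < \<epsilon> \<Longrightarrow> norm t = \<rho> \<Longrightarrow> H z t \<noteq> 0"
  using bounded_disc_function.norm_h_ge[OF bounded_disc, of z t] m_pos by auto

lemma power_sum_eq_contour_integral:
  assumes "norm z < \<epsilon>"
  shows "2 * of_real pi * \<i> * power_sum j z =
    contour_integral (circlepath 0 \<rho>) (\<lambda>t. t ^ j * (deriv (H z) t / H z t))"
proof -
  let ?g = "\<lambda>\<theta>. circle_point \<theta> ^ (j + 1) *
    (pseries (dirderiv_coeff v c) (z + circle_point \<theta> *s cvec v) / H z (circle_point \<theta>))"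
  have circlepath: "circlepath 0 \<rho> \<theta> = circle_point \<theta>" for \<theta>
    by (simp add: circlepath circle_point_def)
  have deriv: "deriv (H z) (circle_point \<theta>) =
      pseries (dirderiv_coeff v c) (z + circle_point \<theta> *s cvec v)" for \<theta>
    using assms \<rho>_pos by (intro deriv_H) auto
  have "contour_integral (circlepath 0 \<rho>) (\<lambda>t. t ^ j * (deriv (H z) t / H z t)) =
     integral {0..1} (\<lambda>\<theta>. 2 * of_real pi * \<i> * ?g \<theta>)"
    unfolding contour_integral_integral circlepath vector_derivative_circlepath deriv
    by (intro integral_cong) (simp add: circle_point_def mult_ac)
  also have "\<dots> = 2 * of_real pi * \<i> * power_sum j z"
    unfolding power_sum_def cbox_interval by (rule integral_mult_right)
  finally show ?thesis by (rule sym)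
qed

lemma power_sum_eq_sum_zeros:
  assumes "norm z < \<epsilon>"
  shows "power_sum j z = (\<Sum>\<xi>\<in>zeros z. of_nat (mult_at z \<xi>) * \<xi> ^ j)"
  using power_sum_eq_contour_integral[OF assms, of j]
    bounded_disc_function.contour_integral_power_log_derivative[OF bounded_disc[OF assms], of j]
  by simp

lemma continuous_on_pseries_circle:
  assumes "converges_on_ball c' r"
  shows "continuous_on (ball 0 \<epsilon> \<times> T) (\<lambda>p. pseries c' (fst p + circle_point (snd p) *s cvec v))"
  using \<rho>_pos
  by (intro continuous_on_compose2[OF continuous_on_pseries[OF assms]] continuous_intros)
     (auto simp: image_subset_iff intro!: line_in_ball)

lemma continuous_on_power_sum: "continuous_on (ball 0 \<epsilon>) (power_sum j)"
  unfolding power_sum_def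
proof (rule integral_continuous_on_param)
  show "continuous_on (ball 0 \<epsilon> \<times> cbox 0 1) (\<lambda>(z, \<theta>). circle_point \<theta> ^ (j + 1) *
     (pseries (dirderiv_coeff v c) (z + circle_point \<theta> *s cvec v) / H z (circle_point \<theta>)))"
    unfolding case_prod_unfold using H_nonzero_on_circle
    by (intro continuous_intros continuous_on_pseries_circle converges
         converges_on_ball_dirderiv_coeff) auto
qed

lemma continuous_on_pseries_line_circle:
  fixes z :: "complex ^ 'n" and w :: "real ^ 'n"
  assumes "converges_on_ball c' r"
  shows "continuous_on ({s. norm (z + s *s cvec w) < \<epsilon>} \<times> T)
    (\<lambda>p. pseries c' ((z + fst p *s cvec w) + circle_point (snd p) *s cvec v))"
  using continuous_on_compose2[OF continuous_on_pseries_circle[OF assms, of T],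
      of "{s. norm (z + s *s cvec w) < \<epsilon>} \<times> T" "\<lambda>p. (z + fst p *s cvec w, snd p)"]
  by (simp add: image_subset_iff continuous_intros case_prod_unfold mem_Times_iff)

lemma continuous_on_pseries_fixed_circle:
  assumes "converges_on_ball c' r" "norm z < \<epsilon>"
  shows "continuous_on T (\<lambda>\<theta>. pseries c' (z + circle_point \<theta> *s cvec v))"
  using \<rho>_pos assms(2)
  by (intro continuous_on_compose2[OF continuous_on_pseries[OF assms(1)]] continuous_intros)
     (auto intro!: line_in_ball)

lemma pseries_line_circle_has_field_derivative:
  fixes z :: "complex ^ 'n" and w :: "real ^ 'n"
  assumes "converges_on_ball c' r" "norm (z + s *s cvec w) < \<epsilon>"
  shows "((\<lambda>s. pseries c' ((z + s *s cvec w) + circle_point \<theta> *s cvec v)) has_field_derivative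
    pseries (dirderiv_coeff w c') ((z + s *s cvec w) + circle_point \<theta> *s cvec v)) (at s)"
proof -
  have swap: "(z + s *s cvec w) + circle_point \<theta> *s cvec v =
      (z + circle_point \<theta> *s cvec v) + s *s cvec w" for s
    by (simp add: algebra_simps)
  have "norm ((z + circle_point \<theta> *s cvec v) + s *s cvec w) < r"
    using line_in_ball[of "z + s *s cvec w" "circle_point \<theta>"] assms(2) \<rho>_pos by (simp add: swap)
  from pseries_has_field_derivative[OF assms(1) this] show ?thesis unfolding swap .
qed

lemma power_sum_holomorphic:
  "(\<lambda>s. power_sum j (z + s *s cvec w)) holomorphic_on {s. norm (z + s *s cvec w) < \<epsilon>}"
proof -
  define U where "U = {s. norm (z + s *s cvec w) < \<epsilon>}"
  define q where "q = (\<lambda>c' s \<theta>. pseries c' ((z + s *s cvec w) + circle_point \<theta> *s cvec v))"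
  define c\<^sub>v where "c\<^sub>v = dirderiv_coeff v c"
  have converges_derivs: "converges_on_ball c\<^sub>v r" "converges_on_ball (dirderiv_coeff w c) r"
      "converges_on_ball (dirderiv_coeff w c\<^sub>v) r"
    unfolding c\<^sub>v_def by (intro converges_on_ball_dirderiv_coeff converges)+
  have cont: "continuous_on (U \<times> T) (\<lambda>p. q c' (fst p) (snd p))"
    if "converges_on_ball c' r" for c' and T :: "real set"
    unfolding q_def U_def by (rule continuous_on_pseries_line_circle[OF that])
  have cont_section: "continuous_on (cbox 0 1) (q c' s)"
    if "converges_on_ball c' r" "s \<in> U" for c' s
    using that unfolding q_def U_def by (intro continuous_on_pseries_fixed_circle) auto
  have nonzero: "q c s \<theta> \<noteq> 0" if "s \<in> U" for s \<theta>
    using that H_nonzero_on_circle[of "z + s *s cvec w" "circle_point \<theta>"] by (simp add: q_def U_def)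
  have deriv_q: "((\<lambda>s. q c' s \<theta>) has_field_derivative q (dirderiv_coeff w c') s \<theta>) (at s)"
    if "s \<in> U" "converges_on_ball c' r" for c' s \<theta>
    using that unfolding q_def U_def by (intro pseries_line_circle_has_field_derivative) auto
  define D where "D = (\<lambda>s \<theta>.
      (q (dirderiv_coeff w c\<^sub>v) s \<theta> * q c s \<theta> - q c\<^sub>v s \<theta> * q (dirderiv_coeff w c) s \<theta>) /
      (q c s \<theta> * q c s \<theta>))"
  have "(\<lambda>s. integral (cbox 0 1)
      (\<lambda>\<theta>. circle_point \<theta> ^ (j + 1) * (q c\<^sub>v s \<theta> / q c s \<theta>))) holomorphic_on U"
  proof (rule leibniz_rule_holomorphic[where fx = "\<lambda>s \<theta>. circle_point \<theta> ^ (j + 1) * D s \<theta>"])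
    show "((\<lambda>s. circle_point \<theta> ^ (j + 1) * (q c\<^sub>v s \<theta> / q c s \<theta>)) has_field_derivative
        circle_point \<theta> ^ (j + 1) * D s \<theta>) (at s within U)" if "s \<in> U" for s \<theta>
      unfolding D_def using that nonzero
      by (intro has_field_derivative_at_within[OF DERIV_cmult] DERIV_divide deriv_q converges
          converges_derivs)
    show "(\<lambda>\<theta>. circle_point \<theta> ^ (j + 1) * (q c\<^sub>v s \<theta> / q c s \<theta>)) integrable_on cbox 0 1"
      if "s \<in> U" for s
      using that nonzero converges converges_derivs
      by (intro integrable_continuous continuous_intros cont_section) auto
    show "continuous_on (U \<times> cbox 0 1) (\<lambda>(s, \<theta>). circle_point \<theta> ^ (j + 1) * D s \<theta>)"
      unfolding case_prod_unfold D_def using nonzero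
      by (intro continuous_intros cont converges converges_derivs) auto
    show "convex U" unfolding U_def by (rule convex_line_section)
  qed
  then show ?thesis by (simp add: power_sum_def q_def U_def c\<^sub>v_def)
qed

lemma line_holomorphic_power_sum: "line_holomorphic (power_sum j) \<epsilon>"
  unfolding line_holomorphic_def using continuous_on_power_sum power_sum_holomorphic by blast

definition tuple_sum :: "nat \<Rightarrow> (nat \<Rightarrow> nat) \<Rightarrow> (nat \<times> nat) set \<Rightarrow> complex ^ 'n \<Rightarrow> complex" where
  "tuple_sum k e P z = (\<Sum>\<tau>\<in>{..<k} \<rightarrow>\<^sub>E zeros z.
     (\<Prod>a<k. of_nat (mult_at z (\<tau> a))) * (\<Prod>a<k. \<tau> a ^ e a) * (\<Prod>(a, b)\<in>P. \<tau> a - \<tau> b))"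

text \<open>Multiplying out one difference at a time leads to products of power sums.\<close>

lemma line_holomorphic_tuple_sum:
  assumes "finite P" "P \<subseteq> {..<k} \<times> {..<k}"
  shows "line_holomorphic (tuple_sum k e P) \<epsilon>"
  using assms
proof (induction P arbitrary: e rule: finite_induct)
  case empty
  have "line_holomorphic (\<lambda>z. \<Prod>a<k. power_sum (e a) z) \<epsilon>"
    by (intro line_holomorphic_prod line_holomorphic_power_sum)
  moreover have "(\<Prod>a<k. power_sum (e a) z) = tuple_sum k e {} z" if z: "norm z < \<epsilon>" for z
  proof -
    have "(\<Prod>a<k. power_sum (e a) z) =
        (\<Sum>\<tau>\<in>{..<k} \<rightarrow>\<^sub>E zeros z. \<Prod>a<k. of_nat (mult_at z (\<tau> a)) * \<tau> a ^ e a)"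
      unfolding power_sum_eq_sum_zeros[OF z] by (rule prod_sum_PiE) (use finite_zeros[OF z] in auto)
    then show ?thesis by (simp add: tuple_sum_def prod.distrib)
  qed
  ultimately show ?case by (rule line_holomorphic_cong)
next
  case (insert p P)
  obtain a b where p: "p = (a, b)" by force
  have ab: "a < k" "b < k" using insert.prems by (auto simp: p)
  have "tuple_sum k e (insert p P) z =
      tuple_sum k (incr_at a e) P z - tuple_sum k (incr_at b e) P z" for z
    unfolding tuple_sum_def p prod.insert[OF insert.hyps[unfolded p]] sum_subtractf[symmetric]
    using ab by (intro sum.cong refl) (simp add: prod_power_incr_at algebra_simps)
  then show ?case
    using insert.IH insert.prems by (auto intro!: line_holomorphic_diff)
qed

definition discriminant :: "nat \<Rightarrow> complex ^ 'n \<Rightarrow> complex" where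
  "discriminant k = tuple_sum k (\<lambda>_. 0) (distinct_pairs {..<k})"

definition discriminant_const :: "nat \<Rightarrow> real" where
  "discriminant_const k = fact k * zero_count_bound m M ^ k"

lemma line_holomorphic_discriminant: "line_holomorphic (discriminant k) \<epsilon>"
proof -
  have "distinct_pairs {..<k} \<subseteq> {..<k} \<times> {..<k}" by (auto simp: distinct_pairs_def)
  then show ?thesis
    unfolding discriminant_def by (intro line_holomorphic_tuple_sum finite_distinct_pairs) auto
qed

lemma discriminant_eq_sum_inj:
  assumes z: "norm z < \<epsilon>"
  shows "discriminant k z = (\<Sum>\<tau>\<in>{\<tau> \<in> {..<k} \<rightarrow>\<^sub>E zeros z. inj_on \<tau> {..<k}}.
     (\<Prod>a<k. of_nat (mult_at z (\<tau> a))) * root_product (\<tau> ` {..<k}))"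
proof -
  have "finite ({..<k} \<rightarrow>\<^sub>E zeros z)" using finite_zeros[OF z] by (intro finite_PiE) auto
  then show ?thesis
    unfolding discriminant_def tuple_sum_def
    by (intro sum.mono_neutral_cong_right)
       (auto simp: prod_differences_inj_on prod_differences_not_inj_on)
qed

lemma discriminant_eq_0:
  assumes z: "norm z < \<epsilon>" and card: "card (zeros z) < k"
  shows "discriminant k z = 0"
proof -
  have "\<not> inj_on \<tau> {..<k}" if "\<tau> \<in> {..<k} \<rightarrow>\<^sub>E zeros z" for \<tau>
    using card_inj_on_le[of \<tau> "{..<k}" "zeros z"] that finite_zeros[OF z] card
    by (auto simp: PiE_def Pi_def)
  then have "{\<tau> \<in> {..<k} \<rightarrow>\<^sub>E zeros z. inj_on \<tau> {..<k}} = {}" by blast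
  then show ?thesis unfolding discriminant_eq_sum_inj[OF z] by (simp only: sum.empty)
qed

lemma discriminant_eq:
  assumes z: "norm z < \<epsilon>" and card: "card (zeros z) = k"
  shows "discriminant k z = of_nat (fact k * (\<Prod>\<xi>\<in>zeros z. mult_at z \<xi>)) * root_product (zeros z)"
proof -
  let ?I = "{\<tau> \<in> {..<k} \<rightarrow>\<^sub>E zeros z. inj_on \<tau> {..<k}}"
  have "(\<Prod>a<k. of_nat (mult_at z (\<tau> a))) * root_product (\<tau> ` {..<k}) =
      of_nat (\<Prod>\<xi>\<in>zeros z. mult_at z \<xi>) * root_product (zeros z)" if "\<tau> \<in> ?I" for \<tau>
  proof -
    have inj: "inj_on \<tau> {..<k}" and "\<tau> ` {..<k} \<subseteq> zeros z" using that by auto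
    moreover have "card (\<tau> ` {..<k}) = card (zeros z)" using inj card by (simp add: card_image)
    ultimately have "\<tau> ` {..<k} = zeros z" using finite_zeros[OF z] by (intro card_subset_eq) auto
    moreover have "(\<Prod>a<k. of_nat (mult_at z (\<tau> a)) :: complex) =
        (\<Prod>\<xi>\<in>\<tau> ` {..<k}. of_nat (mult_at z \<xi>))"
      using inj by (simp add: prod.reindex)
    ultimately show ?thesis by simp
  qed
  then have "discriminant k z = (\<Sum>\<tau>\<in>?I. of_nat (\<Prod>\<xi>\<in>zeros z. mult_at z \<xi>) * root_product (zeros z))"
    unfolding discriminant_eq_sum_inj[OF z] by (rule sum.cong[OF refl])
  also have "\<dots> = of_nat (fact k) * (of_nat (\<Prod>\<xi>\<in>zeros z. mult_at z \<xi>) * root_product (zeros z))"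
    unfolding sum_constant card_inj_on_lessThan[OF finite_zeros[OF z] card] ..
  finally show ?thesis by (simp add: mult.assoc)
qed

lemma discriminant_nonzero_iff:
  assumes z: "norm z < \<epsilon>" and card: "card (zeros z) \<le> k"
  shows "discriminant k z \<noteq> 0 \<longleftrightarrow> card (zeros z) = k"
proof (cases "card (zeros z) = k")
  case True
  have "mult_at z \<xi> \<noteq> 0" if "\<xi> \<in> zeros z" for \<xi>
    using bounded_disc_function.zero_mult_pos[OF bounded_disc[OF z] that] by simp
  then show ?thesis
    using True finite_zeros[OF z] root_product_nonzero by (simp add: discriminant_eq[OF z True])
qed (use discriminant_eq_0[OF z, of k] card in auto)

lemma prod_mult_le:
  assumes z: "norm z < \<epsilon>"
  shows "real (\<Prod>\<xi>\<in>zeros z. mult_at z \<xi>) \<le> zero_count_bound m M ^ card (zeros z)"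
proof -
  have "real (mult_at z \<xi>) \<le> zero_count_bound m M" if "\<xi> \<in> zeros z" for \<xi>
  proof -
    have "mult_at z \<xi> \<le> (\<Sum>\<xi>\<in>zeros z. mult_at z \<xi>)"
      using finite_zeros[OF z] that by (intro member_le_sum) auto
    then show ?thesis
      using bounded_disc_function.sum_zero_mult_le[OF bounded_disc[OF z]] by linarith
  qed
  then have "(\<Prod>\<xi>\<in>zeros z. real (mult_at z \<xi>)) \<le> (\<Prod>\<xi>\<in>zeros z. zero_count_bound m M)"
    by (intro prod_mono) auto
  then show ?thesis by simp
qed

lemma norm_discriminant_le_dist:
  assumes z: "norm z < \<epsilon>" and card: "card (zeros z) = k"
    and pair: "\<xi> \<in> zeros z" "\<zeta> \<in> zeros z" "\<xi> \<noteq> \<zeta>"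
  shows "norm (discriminant k z) \<le> discriminant_const k * norm (\<xi> - \<zeta>)"
proof -
  have "norm (discriminant k z) =
      real (fact k * (\<Prod>\<xi>\<in>zeros z. mult_at z \<xi>)) * norm (root_product (zeros z))"
    unfolding discriminant_eq[OF z card] norm_mult norm_of_nat ..
  also have "\<dots> \<le> discriminant_const k * norm (\<xi> - \<zeta>)"
  proof (rule mult_mono)
    show "real (fact k * (\<Prod>\<xi>\<in>zeros z. mult_at z \<xi>)) \<le> discriminant_const k"
      using prod_mult_le[OF z] unfolding card discriminant_const_def of_nat_mult of_nat_fact
      by (intro mult_left_mono) auto
    show "0 \<le> discriminant_const k"
      using bounded_disc_function.zero_count_bound_nonneg[OF bounded_disc[OF z]]
      by (simp add: discriminant_const_def)
    show "norm (root_product (zeros z)) \<le> norm (\<xi> - \<zeta>)"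
      using radius_le
      by (intro norm_root_product_le_dist finite_zeros z pair) (auto simp: disc_zeros_def)
  qed auto
  finally show ?thesis .
qed

lemma card_zeros_le: "norm z < \<epsilon> \<Longrightarrow> card (zeros z) \<le> nat \<lfloor>zero_count_bound m M\<rfloor>"
  by (rule bounded_disc_function.card_Z_le[OF bounded_disc])

lemma exists_max_card_zeros:
  obtains k x0 where "norm x0 < \<epsilon>" "card (zeros (cvec x0)) = k"
    "\<And>x. norm x < \<epsilon> \<Longrightarrow> card (zeros (cvec x)) \<le> k"
proof -
  let ?N = "(\<lambda>x. card (zeros (cvec x))) ` ball 0 \<epsilon>"
  have "?N \<subseteq> {..nat \<lfloor>zero_count_bound m M\<rfloor>}" using card_zeros_le by auto
  then have "finite ?N" by (rule finite_subset) simp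
  then have Max: "Max ?N \<in> ?N" "\<And>x. norm x < \<epsilon> \<Longrightarrow> card (zeros (cvec x)) \<le> Max ?N"
    using base_pos by (auto intro!: Max_in Max_ge)
  then obtain x0 where "norm x0 < \<epsilon>" "card (zeros (cvec x0)) = Max ?N" by auto
  then show ?thesis using that[of x0 "Max ?N"] Max(2) by blast
qed

end

section \<open>Absence of real zeros on generic lines\<close>

lemma smooth_point_regular_hypersurface:
  fixes g :: "real ^ 'n \<Rightarrow> real"
  assumes V: "open V" "q \<in> V" and g: "real_analytic_on g V" "\<And>x. x \<in> V \<Longrightarrow> dirderiv v g x \<noteq> 0"
    and X: "\<And>x. x \<in> V \<Longrightarrow> x \<in> X \<longleftrightarrow> g x = 0" and q: "q \<in> X"
  shows "smooth_point X q (CARD('n) - 1)"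
proof -
  have codim: "CARD('n) - (CARD('n) - 1) = 1"
    using zero_less_card_finite[where 'a='n] by linarith
  have "analytic_submanifold (V \<inter> X) V (CARD('n) - 1)"
    unfolding analytic_submanifold_def codim
  proof (intro conjI ballI exI[of _ V] exI[of _ "\<lambda>_. g"])
    show "\<exists>D :: nat \<Rightarrow> real^'n. (\<forall>j < (1::nat). (g has_derivative (\<lambda>h. D j \<bullet> h)) (at x)) \<and>
      (\<forall>a :: nat \<Rightarrow> real. (\<Sum>j < 1. a j *\<^sub>R D j) = 0 \<longrightarrow> (\<forall>j < 1. a j = 0))" if x: "x \<in> V" for x
    proof -
      have "grad g x \<noteq> 0"
        using g(2)[OF x] real_analytic_on_dirderiv_eq_inner[OF g(1) V(1) x] by auto
      then show ?thesis
        using real_analytic_on_has_derivative[OF g(1) V(1) x]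
        by (intro exI[of _ "\<lambda>_. grad g x"]) auto
    qed
  qed (use V g X in auto)
  then show ?thesis unfolding smooth_point_def using V q by auto
qed

lemma eventually_at_right_separated:
  fixes A :: "'a::metric_space set"
  assumes "finite A"
  shows "\<forall>\<^sub>F d in at_right 0. \<forall>x\<in>A. \<forall>y\<in>A. x \<noteq> y \<longrightarrow> 2 * d < dist x y"
proof (intro eventually_ball_finite assms ballI)
  fix x y :: 'a
  show "\<forall>\<^sub>F d in at_right 0. x \<noteq> y \<longrightarrow> 2 * d < dist x y"
  proof (cases "x = y")
    case False
    then have "\<forall>\<^sub>F d in at_right 0. d < dist x y / 2"
      by (intro order_tendstoD(2)[OF tendsto_ident_at]) simp
    then show ?thesis by eventually_elim simp
  qed simp
qed

lemma ex1_nearby_point: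
  fixes A B :: "'a::metric_space set"
  assumes fin: "finite A" "finite B" and card: "card B \<le> card A"
    and near: "\<And>x. x \<in> A \<Longrightarrow> \<exists>y\<in>B. dist y x < d"
    and separated: "\<And>x x'. x \<in> A \<Longrightarrow> x' \<in> A \<Longrightarrow> x \<noteq> x' \<Longrightarrow> 2 * d < dist x x'" and x0: "x0 \<in> A"
  shows "\<exists>!y. y \<in> B \<and> dist y x0 < d"
proof -
  obtain \<tau> where \<tau>: "\<And>x. x \<in> A \<Longrightarrow> \<tau> x \<in> B \<and> dist (\<tau> x) x < d" using near by metis
  have same_center: "x = x'" if "x \<in> A" "x' \<in> A" "dist y x < d" "dist y x' < d" for x x' y
    using separated[OF that(1,2)] dist_triangle2[of x x' y] that(3,4) by (auto simp: dist_commute)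
  then have "inj_on \<tau> A" using \<tau> by (metis inj_onI)
  moreover have "\<tau> ` A \<subseteq> B" using \<tau> by auto
  ultimately have "\<tau> ` A = B" using fin card by (intro card_seteq) (auto simp: card_image)
  then have "y = \<tau> x0" if "y \<in> B" "dist y x0 < d" for y
    using that same_center[OF _ x0, of _ y] \<tau> by blast
  then show ?thesis using \<tau>[OF x0] by blast
qed

context line_family
begin

lemma uniform_limit_H:
  assumes X: "X \<longlonglongrightarrow> z0" and z0: "norm z0 < \<epsilon>" and K: "compact K" "K \<subseteq> cball 0 (5 * \<rho>)"
  shows "uniform_limit K (\<lambda>n. H (X n)) (H z0) sequentially"
proof -
  have "uniform_limit K H (H z0) (nhds z0)"
  proof (rule uniform_limit_section_compact[OF _ K(1) open_ball])
    have "norm (fst p + snd p *s cvec v) < r" if "p \<in> ball 0 \<epsilon> \<times> K" for p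
      using that K(2) by (intro line_in_ball) auto
    then show "continuous_on (ball 0 \<epsilon> \<times> K) (\<lambda>(z, t). H z t)"
      unfolding case_prod_unfold
      by (intro continuous_on_compose2[OF continuous_on_pseries[OF converges]] continuous_intros)
         auto
  qed (use z0 in auto)
  then show ?thesis
    unfolding uniform_limit_iff using eventually_compose_filterlim[OF _ X] by fast
qed

lemma eventually_zero_nearby:
  assumes z0: "norm z0 < \<epsilon>" and \<xi>: "\<xi> \<in> zeros z0" and d: "d > 0"
  shows "\<forall>\<^sub>F z in nhds z0. \<exists>t\<in>zeros z. dist t \<xi> < d"
proof (rule ccontr)
  assume "\<not> ?thesis"
  moreover have "\<forall>\<^sub>F z in nhds z0. norm z < \<epsilon>"
    using z0 eventually_nhds_in_open[of "ball 0 \<epsilon>" z0] by simp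
  ultimately have "\<exists>\<^sub>F z in nhds z0. norm z < \<epsilon> \<and> \<not> (\<exists>t\<in>zeros z. dist t \<xi> < d)"
    unfolding not_eventually by (rule frequently_eventually_conj)
  then have "z0 \<in> closure {z. norm z < \<epsilon> \<and> \<not> (\<exists>t\<in>zeros z. dist t \<xi> < d)}"
    by (auto simp: closure_approachable frequently_def eventually_nhds_metric)
  then obtain X where X: "X \<longlonglongrightarrow> z0" and X_base: "\<And>n. norm (X n) < \<epsilon>"
    and X_far: "\<And>n t. t \<in> zeros (X n) \<Longrightarrow> d \<le> dist t \<xi>"
    unfolding closure_sequential by force
  define S where "S = ball \<xi> d \<inter> ball 0 \<rho>"
  have S: "open S" "connected S" "\<xi> \<in> S"
    using d \<xi> by (auto simp: S_def disc_zeros_def intro: convex_connected convex_Int)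
  have S_sub: "S \<subseteq> ball 0 (5 * \<rho>)" using \<rho>_pos by (auto simp: S_def)
  have "H z0 \<xi> \<noteq> 0"
  proof (rule Hurwitz_no_zeros[OF S(1,2), where \<F> = "\<lambda>n. H (X n)" and g = "H z0"])
    show "H (X n) holomorphic_on S" for n
      by (rule holomorphic_on_subset[OF H_holomorphic[OF X_base] S_sub])
    show "H z0 holomorphic_on S" by (rule holomorphic_on_subset[OF H_holomorphic[OF z0] S_sub])
    show "uniform_limit K (\<lambda>n. H (X n)) (H z0) sequentially" if "compact K" "K \<subseteq> S" for K
      using that S_sub ball_subset_cball by (intro uniform_limit_H X z0) blast+
    show "H (X n) t \<noteq> 0" if "t \<in> S" for n t
      using that X_far[of t n] by (auto simp: S_def disc_zeros_def dist_commute)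
    show "\<not> H z0 constant_on S"
    proof
      assume "H z0 constant_on S"
      then obtain y where y: "\<And>t. t \<in> S \<Longrightarrow> H z0 t = y" by (auto simp: constant_on_def)
      moreover have "H z0 \<xi> = 0" using \<xi> by (simp add: disc_zeros_def)
      ultimately have "S \<subseteq> zeros z0" using S(3) by (auto simp: disc_zeros_def S_def)
      then show False using finite_zeros[OF z0] finite_subset finite_imp_not_open[OF _ S(1)] S(3)
        by blast
    qed
  qed (use S in auto)
  then show False using \<xi> by (simp add: disc_zeros_def)
qed

lemma eventually_ex1_zero_nearby:
  assumes z0: "norm z0 < \<epsilon>" and \<xi>0: "\<xi>0 \<in> zeros z0"
  shows "\<forall>\<^sub>F d in at_right 0. \<forall>\<^sub>F z in nhds z0.
    card (zeros z) \<le> card (zeros z0) \<longrightarrow> (\<exists>!t. t \<in> zeros z \<and> dist t \<xi>0 < d)"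
  using eventually_at_right_separated[OF finite_zeros[OF z0]] eventually_at_right_less[of 0]
proof eventually_elim
  case (elim d)
  have "\<forall>\<^sub>F z in nhds z0. \<forall>\<xi>\<in>zeros z0. \<exists>t\<in>zeros z. dist t \<xi> < d"
    using elim by (intro eventually_ball_finite finite_zeros[OF z0] ballI eventually_zero_nearby z0)
  moreover have "\<forall>\<^sub>F z in nhds z0. norm z < \<epsilon>"
    using z0 eventually_nhds_in_open[of "ball 0 \<epsilon>" z0] by simp
  ultimately show ?case
  proof eventually_elim
    case near: (elim z)
    then show ?case
      using elim \<xi>0 by (intro impI ex1_nearby_point[where A = "zeros z0"] finite_zeros z0) auto
  qed
qed

lemma cnj_mem_zeros:
  assumes x: "norm x < \<epsilon>" and t: "t \<in> zeros (cvec x)"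
  shows "cnj t \<in> zeros (cvec x)"
proof -
  have "norm (cvec x + t *s cvec v) < r"
    using x t \<rho>_pos by (intro line_in_ball) (auto simp: disc_zeros_def)
  from pseries_cnj[OF converges this] have "H (cvec x) (cnj t) = cnj (H (cvec x) t)"
    by (simp add: plus_vec_def vector_scalar_mult_def)
  then show ?thesis using t by (simp add: disc_zeros_def)
qed

end

lemma exists_derivative_with_simple_zero:
  fixes f :: "real ^ 'n \<Rightarrow> real"
  assumes f: "real_analytic_on f \<Omega>" and p0: "p0 \<in> W" "f p0 = 0"
    and order: "(dirderiv v ^^ j0) f p0 \<noteq> 0"
  obtains q g where "q \<in> W" "f q = 0" "real_analytic_on g \<Omega>" "dirderiv v g q \<noteq> 0"
    "\<And>p. p \<in> W \<Longrightarrow> f p = 0 \<Longrightarrow> g p = 0"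
proof -
  \<comment> \<open>Minimality over all zeros in \<open>W\<close> makes the derivative of one order less vanish on all of them.\<close>
  let ?order = "\<lambda>j. \<exists>p\<in>W. f p = 0 \<and> (dirderiv v ^^ j) f p \<noteq> 0"
  define \<mu> where "\<mu> = (LEAST j. ?order j)"
  have "?order \<mu>" unfolding \<mu>_def using p0 order by (intro LeastI[of ?order j0]) blast
  then obtain q where q: "q \<in> W" "f q = 0" "(dirderiv v ^^ \<mu>) f q \<noteq> 0" by blast
  then have "\<mu> \<noteq> 0" by (intro notI) simp
  then obtain j where j: "\<mu> = Suc j" by (cases \<mu>) auto
  have "(dirderiv v ^^ j) f p = 0" if "p \<in> W" "f p = 0" for p
    using not_less_Least[of j ?order] that by (auto simp: \<mu>_def[symmetric] j)
  then show ?thesis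
    using that[OF q(1,2) real_analytic_on_dirderiv_funpow[OF f, of j]] q(3) by (simp add: j)
qed

lemma unique_zero_on_line:
  fixes g :: "real ^ 'n \<Rightarrow> real"
  assumes g: "real_analytic_on g \<Omega>" and B: "convex B" "B \<subseteq> \<Omega>"
    and regular: "\<And>p. p \<in> B \<Longrightarrow> dirderiv v g p \<noteq> 0"
    and zeros: "p \<in> B" "p + s *\<^sub>R v \<in> B" "g p = 0" "g (p + s *\<^sub>R v) = 0"
  shows "s = 0"
proof (rule ccontr)
  assume s: "s \<noteq> 0"
  have segment: "p + t *\<^sub>R v \<in> B" if "t \<in> closed_segment 0 s" for t
  proof -
    obtain u where u: "0 \<le> u" "u \<le> 1" "t = u * s"
      using \<open>t \<in> closed_segment 0 s\<close> unfolding in_segment by auto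
    have "p + t *\<^sub>R v = (1 - u) *\<^sub>R p + u *\<^sub>R (p + s *\<^sub>R v)" by (simp add: u algebra_simps)
    then show ?thesis using convexD[OF B(1) zeros(1,2), of "1 - u" u] u by simp
  qed
  have "\<exists>t\<in>closed_segment 0 s. dirderiv v g (p + t *\<^sub>R v) = 0"
    using segment B(2) by (intro Rolle_line zeros s real_analytic_on_has_dirderiv[OF g]) blast
  then show False using segment regular by blast
qed

lemma eventually_zero_iff_of_nearby_zeros:
  fixes f g :: "real ^ 'n \<Rightarrow> real"
  assumes W: "open W" "q \<in> W" "W \<subseteq> \<Omega>" and g: "real_analytic_on g \<Omega>" "dirderiv v g q \<noteq> 0"
    and g_zero: "\<And>p. p \<in> W \<Longrightarrow> f p = 0 \<Longrightarrow> g p = 0"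
    and nearby_zero: "\<And>d. d > 0 \<Longrightarrow> \<forall>\<^sub>F p in nhds q. \<exists>s. \<bar>s\<bar> < d \<and> f (p + s *\<^sub>R v) = 0"
  shows "\<forall>\<^sub>F p in nhds q. p \<in> W \<and> dirderiv v g p \<noteq> 0 \<and> (f p = 0 \<longleftrightarrow> g p = 0)"
proof -
  have "isCont (dirderiv v g) q"
    using W by (intro real_analytic_on_isCont[OF real_analytic_on_dirderiv[OF g(1)]]) auto
  from eventually_nonzero_isCont[OF this g(2)] eventually_nhds_in_open[OF W(1,2)]
  have "\<forall>\<^sub>F p in nhds q. p \<in> W \<and> dirderiv v g p \<noteq> 0" by eventually_elim simp
  then obtain \<delta> where \<delta>: "\<delta> > 0" "\<And>p. p \<in> ball q \<delta> \<Longrightarrow> p \<in> W \<and> dirderiv v g p \<noteq> 0"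
    unfolding eventually_nhds_metric by (auto simp: dist_commute)
  obtain d where d: "d > 0" "d * norm v \<le> \<delta> / 2"
    using exists_pos_le_scaled_norm_le[of 1 "\<delta> / 2" v] \<delta> by auto
  have "\<forall>\<^sub>F p in nhds q. p \<in> ball q (\<delta> / 2)" using \<delta> by (intro eventually_nhds_in_open) auto
  with nearby_zero[OF d(1)] show ?thesis
  proof eventually_elim
    case (elim p)
    then obtain s where s: "\<bar>s\<bar> < d" "f (p + s *\<^sub>R v) = 0" by blast
    have "\<bar>s\<bar> * norm v \<le> d * norm v" using s(1) by (intro mult_right_mono) auto
    then have "dist (p + s *\<^sub>R v) p \<le> \<delta> / 2" using d(2) by (simp add: dist_norm)
    moreover have "dist p q < \<delta> / 2" using elim(2) by (simp add: dist_commute)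
    ultimately have near: "p \<in> ball q \<delta>" "p + s *\<^sub>R v \<in> ball q \<delta>"
      using dist_triangle[of "p + s *\<^sub>R v" q p] \<delta>(1) by (auto simp: dist_commute)
    have "f p = 0" if "g p = 0"
    proof -
      have "s = 0"
      proof (rule unique_zero_on_line[OF g(1) convex_ball, where p = p and v = v])
        show "ball q \<delta> \<subseteq> \<Omega>" using \<delta>(2) W(3) by blast
        show "g (p + s *\<^sub>R v) = 0" using g_zero \<delta>(2)[OF near(2)] s(2) by blast
      qed (use that near \<delta>(2) in auto)
      then show ?thesis using s(2) by simp
    qed
    then show ?case using \<delta>(2)[OF near(1)] g_zero by blast
  qed
qed

locale analytic_germ =
  fixes c :: "('n::finite \<Rightarrow> nat) \<Rightarrow> real" and r :: real
    and f :: "real ^ 'n \<Rightarrow> real" and \<Omega> :: "(real ^ 'n) set"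
  assumes series_converges: "converges_on_ball c r"
    and f_series: "\<And>x. norm x < r \<Longrightarrow> f x = Re (pseries c (cvec x))"
    and ball_sub: "ball 0 r \<subseteq> \<Omega>" and analytic: "real_analytic_on f \<Omega>"
    and no_hypersurface: "\<And>q. norm q < r \<Longrightarrow> \<not> smooth_point {x\<in>\<Omega>. f x = 0} q (CARD('n) - 1)"
begin

lemma of_real_f: "norm x < r \<Longrightarrow> of_real (f x) = pseries c (cvec x)"
  using f_series pseries_cvec[OF series_converges] by simp

lemma of_real_dirderiv_funpow_f:
  "norm x < r \<Longrightarrow> of_real ((dirderiv v ^^ j) f x) = pseries ((dirderiv_coeff v ^^ j) c) (cvec x)"
  using dirderiv_funpow_pseries[OF series_converges, of f x j v] f_series
    pseries_cvec[OF converges_on_ball_dirderiv_coeff_funpow[OF series_converges], of x j v] by simp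

lemma of_real_dirderiv_f: "norm x < r \<Longrightarrow>
    of_real (dirderiv v f x) = pseries (dirderiv_coeff v c) (cvec x)"
  using of_real_dirderiv_funpow_f[of x 1 v] by simp

end

locale analytic_line_family = line_family c r \<rho> m M \<epsilon> v + analytic_germ c r f \<Omega>
  for c :: "('n::finite \<Rightarrow> nat) \<Rightarrow> real" and r \<rho> m M \<epsilon> :: real and v :: "real ^ 'n"
    and f :: "real ^ 'n \<Rightarrow> real" and \<Omega> :: "(real ^ 'n) set"
begin

lemma real_line_in_ball: "norm x < \<epsilon> \<Longrightarrow> \<bar>t\<bar> \<le> 5 * \<rho> \<Longrightarrow> norm (x + t *\<^sub>R v) < r"
  using line_in_ball[of "cvec x" "of_real t"] by (simp flip: cvec_add cvec_scaleR)

lemma of_real_f_line: "norm x < \<epsilon> \<Longrightarrow> \<bar>t\<bar> \<le> 5 * \<rho> \<Longrightarrow>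
    of_real (f (x + t *\<^sub>R v)) = H (cvec x) (of_real t)"
  using of_real_f[OF real_line_in_ball] by (simp add: cvec_add cvec_scaleR)

lemma of_real_mem_zeros_iff:
  assumes "norm x < \<epsilon>" "\<bar>t\<bar> < \<rho>"
  shows "of_real t \<in> zeros (cvec x) \<longleftrightarrow> f (x + t *\<^sub>R v) = 0"
  using of_real_f_line[of x t] assms \<rho>_pos by (auto simp: disc_zeros_def)

lemma exists_dirderiv_funpow_nonzero:
  assumes x: "norm x < \<epsilon>" and t: "\<bar>t\<bar> < \<rho>"
  shows "\<exists>j. (dirderiv v ^^ j) f (x + t *\<^sub>R v) \<noteq> 0"
proof (rule ccontr)
  assume "\<not> ?thesis"
  then have vanish: "(dirderiv v ^^ j) f (x + t *\<^sub>R v) = 0" for j by auto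
  have "(deriv ^^ j) (H (cvec x)) (of_real t) = 0" for j
  proof -
    have "(deriv ^^ j) (H (cvec x)) (of_real t) =
        pseries ((dirderiv_coeff v ^^ j) c) (cvec (x + t *\<^sub>R v))"
      using x t by (subst pseries_iter_deriv[OF converges, of "ball 0 (5 * \<rho>)"])
        (auto simp: cvec_add cvec_scaleR intro!: line_in_ball)
    also have "\<dots> = 0"
      using of_real_dirderiv_funpow_f[OF real_line_in_ball, of x t j v] x t vanish by simp
    finally show ?thesis .
  qed
  moreover have "ball (complex_of_real t) (4 * \<rho>) \<subseteq> ball 0 (5 * \<rho>)"
    using t by (intro ball_subset_ball_iff[THEN iffD2]) (auto simp: dist_norm)
  ultimately have "H (cvec x) (of_real \<rho>) = 0"
    using H_holomorphic[of "cvec x"] x t \<rho>_pos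
    by (intro holomorphic_fun_eq_0_on_ball[of "H (cvec x)" "of_real t" "4 * \<rho>"])
       (auto simp: dist_norm simp flip: of_real_diff intro: holomorphic_on_subset)
  then show False using H_nonzero_on_circle[of "cvec x" "of_real \<rho>"] x \<rho>_pos by simp
qed

text \<open>A unique zero near a real zero is fixed by conjugation, hence real.\<close>

lemma eventually_real_zero_nearby:
  assumes x0: "norm x0 < \<epsilon>" and t0: "\<bar>t0\<bar> < \<rho>" "f (x0 + t0 *\<^sub>R v) = 0" and d0: "d0 > 0"
    and max_card: "\<And>x. norm x < \<epsilon> \<Longrightarrow> card (zeros (cvec x)) \<le> card (zeros (cvec x0))"
  shows "\<forall>\<^sub>F x in nhds x0. \<exists>t. \<bar>t - t0\<bar> < d0 \<and> f (x + t *\<^sub>R v) = 0"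
proof -
  have zero: "of_real t0 \<in> zeros (cvec x0)" using of_real_mem_zeros_iff[OF x0 t0(1)] t0(2) by simp
  have "\<forall>\<^sub>F d in at_right 0. d < d0" by (rule order_tendstoD(2)[OF tendsto_ident_at d0])
  then obtain d where d: "d < d0" and unique: "\<forall>\<^sub>F z in nhds (cvec x0).
      card (zeros z) \<le> card (zeros (cvec x0)) \<longrightarrow> (\<exists>!t. t \<in> zeros z \<and> dist t (of_real t0) < d)"
    using eventually_happens'[OF trivial_limit_at_right_real
        eventually_conj[OF eventually_ex1_zero_nearby[OF _ zero]]] x0 by auto
  have "continuous_on UNIV (\<lambda>x :: real ^ 'n. cvec x)" by (intro continuous_intros)
  then have "isCont cvec x0" by (simp add: continuous_on_eq_continuous_at)
  then have "filterlim cvec (nhds (cvec x0)) (nhds x0)"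
    by (simp add: isCont_def tendsto_at_iff_tendsto_nhds)
  from eventually_compose_filterlim[OF unique this]
  have "\<forall>\<^sub>F x in nhds x0. card (zeros (cvec x)) \<le> card (zeros (cvec x0)) \<longrightarrow>
      (\<exists>!t. t \<in> zeros (cvec x) \<and> dist t (of_real t0) < d)" .
  moreover have "\<forall>\<^sub>F x in nhds x0. norm x < \<epsilon>"
    using x0 eventually_nhds_in_open[of "ball 0 \<epsilon>" x0] by simp
  ultimately show ?thesis
  proof eventually_elim
    case (elim x)
    then obtain t where t: "t \<in> zeros (cvec x)" "dist t (of_real t0) < d"
      and only: "\<And>t'. t' \<in> zeros (cvec x) \<Longrightarrow> dist t' (of_real t0) < d \<Longrightarrow> t' = t"
      using max_card by blast
    have "dist (cnj t) (of_real t0) = dist t (of_real t0)"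
      by (metis complex_cnj_complex_of_real complex_cnj_diff complex_mod_cnj dist_norm)
    then have "cnj t = t" using only[of "cnj t"] cnj_mem_zeros[OF elim(2) t(1)] t(2) by simp
    then obtain \<tau> where \<tau>: "t = of_real \<tau>" by (metis Reals_cases Reals_cnj_iff)
    have "\<bar>\<tau>\<bar> < \<rho>" using t(1) by (simp add: disc_zeros_def \<tau>)
    then have "f (x + \<tau> *\<^sub>R v) = 0" using of_real_mem_zeros_iff[OF elim(2)] t(1) by (simp add: \<tau>)
    moreover have "\<bar>\<tau> - t0\<bar> < d" using t(2) by (simp add: \<tau> dist_norm flip: of_real_diff)
    ultimately show ?case using d by (intro exI[of _ \<tau>]) simp
  qed
qed

lemma open_discriminant_nonzero: "open {x. norm x < \<epsilon> \<and> discriminant k (cvec x) \<noteq> 0}"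
proof -
  have "continuous_on (ball 0 \<epsilon>) (\<lambda>x. discriminant k (cvec x))"
    by (intro continuous_on_compose2[OF line_holomorphicD(1)[OF line_holomorphic_discriminant]]
         continuous_intros) auto
  then have "open (ball 0 \<epsilon> \<inter> (\<lambda>x. discriminant k (cvec x)) -` (- {0}))"
    by (intro continuous_open_preimage) auto
  moreover have "ball 0 \<epsilon> \<inter> (\<lambda>x. discriminant k (cvec x)) -` (- {0}) =
      {x. norm x < \<epsilon> \<and> discriminant k (cvec x) \<noteq> 0}"
    by auto
  ultimately show ?thesis by simp
qed

lemma eventually_zero_on_line_nearby:
  assumes x0: "norm x0 < \<epsilon>" and t0: "\<bar>t0\<bar> < \<rho>" "f (x0 + t0 *\<^sub>R v) = 0" and d: "d > 0"
    and max_card: "\<And>x. norm x < \<epsilon> \<Longrightarrow> card (zeros (cvec x)) \<le> card (zeros (cvec x0))"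
  shows "\<forall>\<^sub>F p in nhds (x0 + t0 *\<^sub>R v). \<exists>s. \<bar>s\<bar> < d \<and> f (p + s *\<^sub>R v) = 0"
proof -
  have "filterlim (\<lambda>p. p - t0 *\<^sub>R v) (nhds ((x0 + t0 *\<^sub>R v) - t0 *\<^sub>R v)) (nhds (x0 + t0 *\<^sub>R v))"
    by (intro tendsto_intros filterlim_ident)
  then have "filterlim (\<lambda>p. p - t0 *\<^sub>R v) (nhds x0) (nhds (x0 + t0 *\<^sub>R v))" by simp
  moreover have "\<forall>\<^sub>F x in nhds x0. \<exists>t. \<bar>t - t0\<bar> < d \<and> f (x + t *\<^sub>R v) = 0"
    by (rule eventually_real_zero_nearby[OF x0 t0 d max_card])
  ultimately have "\<forall>\<^sub>F p in nhds (x0 + t0 *\<^sub>R v).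
      \<exists>t. \<bar>t - t0\<bar> < d \<and> f ((p - t0 *\<^sub>R v) + t *\<^sub>R v) = 0"
    by (rule eventually_compose_filterlim[rotated])
  then show ?thesis
  proof eventually_elim
    case (elim p)
    then obtain t where "\<bar>t - t0\<bar> < d" "f ((p - t0 *\<^sub>R v) + t *\<^sub>R v) = 0" by blast
    then show ?case by (intro exI[of _ "t - t0"]) (simp add: algebra_simps)
  qed
qed

lemma no_real_zero:
  assumes max_card: "\<And>x. norm x < \<epsilon> \<Longrightarrow> card (zeros (cvec x)) \<le> k"
    and x0: "norm x0 < \<epsilon>" "discriminant k (cvec x0) \<noteq> 0" and t0: "\<bar>t0\<bar> < \<rho>"
  shows "f (x0 + t0 *\<^sub>R v) \<noteq> 0"
proof
  assume zero: "f (x0 + t0 *\<^sub>R v) = 0"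
  define W where "W = (\<lambda>x. x - t0 *\<^sub>R v) -` {x. norm x < \<epsilon> \<and> discriminant k (cvec x) \<noteq> 0}"
  have W: "open W"
    unfolding W_def by (intro open_vimage open_discriminant_nonzero continuous_intros)
  have W_ball: "norm p < r" if "p \<in> W" for p
    using real_line_in_ball[of "p - t0 *\<^sub>R v" t0] that t0 by (auto simp: W_def)
  then have W_sub: "W \<subseteq> \<Omega>" using ball_sub by auto
  have "x0 + t0 *\<^sub>R v \<in> W" using x0 by (simp add: W_def)
  then obtain q g where q: "q \<in> W" "f q = 0" and g: "real_analytic_on g \<Omega>" "dirderiv v g q \<noteq> 0"
    and g_zero: "\<And>p. p \<in> W \<Longrightarrow> f p = 0 \<Longrightarrow> g p = 0"
    using exists_dirderiv_funpow_nonzero[OF x0(1) t0]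
      exists_derivative_with_simple_zero[OF analytic _ zero, where W = W and v = v] by metis
  define x where "x = q - t0 *\<^sub>R v"
  have "norm x < \<epsilon>" "card (zeros (cvec x)) = k" "f (x + t0 *\<^sub>R v) = 0"
    using q discriminant_nonzero_iff[of "cvec x" k] max_card by (auto simp: W_def x_def)
  then have "\<forall>\<^sub>F p in nhds q. \<exists>s. \<bar>s\<bar> < d \<and> f (p + s *\<^sub>R v) = 0" if "d > 0" for d
    using eventually_zero_on_line_nearby[of x t0 d] max_card t0 that by (simp add: x_def)
  with eventually_zero_iff_of_nearby_zeros[OF W q(1) W_sub g g_zero]
  have "\<forall>\<^sub>F p in nhds q. p \<in> W \<and> dirderiv v g p \<noteq> 0 \<and> (f p = 0 \<longleftrightarrow> g p = 0)" by blast
  then obtain V where V: "open V" "q \<in> V"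
    and defining: "\<And>p. p \<in> V \<Longrightarrow> p \<in> W \<and> dirderiv v g p \<noteq> 0 \<and> (f p = 0 \<longleftrightarrow> g p = 0)"
    unfolding eventually_nhds by blast
  have "V \<subseteq> \<Omega>" using defining W_sub by blast
  then have "smooth_point {x\<in>\<Omega>. f x = 0} q (CARD('n) - 1)"
    using V defining q
    by (intro smooth_point_regular_hypersurface[OF V real_analytic_on_subset[OF g(1)]]) blast+
  then show False using no_hypersurface[OF W_ball[OF q(1)]] by simp
qed

end

section \<open>Integrability of the logarithmic derivative\<close>

lemma ln_divide_min_le:
  fixes D B :: real
  assumes "0 < D" "1 \<le> B"
  shows "ln (3 / min 1 (D / B)) \<le> ln 3 + ln B + \<bar>ln D\<bar>"
proof (cases "D / B \<le> 1")
  case True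
  then have "ln (3 / min 1 (D / B)) = ln 3 - (ln D - ln B)"
    using assms by (simp add: min_def ln_div)
  then show ?thesis by simp
qed (use assms in auto)

lemma set_borel_measurable_divide:
  fixes f g :: "'a \<Rightarrow> real"
  assumes "set_borel_measurable M A f" "set_borel_measurable M A g"
  shows "set_borel_measurable M A (\<lambda>x. f x / g x)"
proof -
  have [measurable]: "(\<lambda>x. indicator A x *\<^sub>R f x) \<in> borel_measurable M"
    "(\<lambda>x. indicator A x *\<^sub>R g x) \<in> borel_measurable M"
    using assms by (simp_all add: set_borel_measurable_def)
  have "(\<lambda>x. indicator A x *\<^sub>R (f x / g x)) =
      (\<lambda>x. (indicator A x *\<^sub>R f x) / (indicator A x *\<^sub>R g x))"
    by (auto simp: indicator_def fun_eq_iff)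
  also have "\<dots> \<in> borel_measurable M" by measurable
  finally show ?thesis unfolding set_borel_measurable_def .
qed

lemma set_borel_measurable_real_analytic:
  assumes "real_analytic_on f S" "A \<subseteq> S" "A \<in> sets borel"
  shows "set_borel_measurable borel A f"
  unfolding set_borel_measurable_def
  by (intro borel_measurable_continuous_on_indicator assms(3)
      continuous_on_subset[OF real_analytic_on_continuous_on[OF assms(1)] assms(2)])

lemma norm_diff_cnj: "norm (z - cnj z) = 2 * \<bar>Im z\<bar>"
proof -
  have "z - cnj z = of_real (2 * Im z) * \<i>" by (simp add: complex_eq_iff)
  then show ?thesis by (simp only: norm_mult norm_of_real norm_ii)
qed

lemma nn_integral_ball_affine_finite:
  fixes G :: "'a::euclidean_space \<Rightarrow> ennreal"
  assumes [measurable]: "(\<lambda>x. G x * indicator (ball 0 \<epsilon>) x) \<in> borel_measurable borel"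
    and finite: "(\<integral>\<^sup>+x\<in>ball 0 \<epsilon>. G x \<partial>lborel) < \<infinity>"
  shows "(\<integral>\<^sup>+x\<in>ball 0 \<epsilon>. (ennreal a + ennreal b * G x) \<partial>lborel) < \<infinity>"
proof -
  have [measurable]: "ball (0::'a) \<epsilon> \<in> sets borel" by simp
  have "(\<integral>\<^sup>+x\<in>ball 0 \<epsilon>. (ennreal a + ennreal b * G x) \<partial>lborel) =
      (\<integral>\<^sup>+x. ennreal a * indicator (ball 0 \<epsilon>) x + ennreal b * (G x * indicator (ball 0 \<epsilon>) x)
          \<partial>lborel)"
    by (intro nn_integral_cong) (auto simp: indicator_def)
  also have "\<dots> = ennreal a * emeasure lborel (ball (0::'a) \<epsilon>) +
      ennreal b * (\<integral>\<^sup>+x\<in>ball 0 \<epsilon>. G x \<partial>lborel)"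
    by (subst nn_integral_add) (simp_all add: nn_integral_cmult nn_integral_cmult_indicator)
  also have "\<dots> < \<infinity>"
    using finite emeasure_lborel_ball_finite[of "0::'a" \<epsilon>] by (auto simp: ennreal_mult_less_top)
  finally show ?thesis .
qed

context analytic_line_family
begin

lemma norm_discriminant_le_Im:
  assumes max_card: "\<And>x. norm x < \<epsilon> \<Longrightarrow> card (zeros (cvec x)) \<le> k"
    and x: "norm x < \<epsilon>" "discriminant k (cvec x) \<noteq> 0" and \<xi>: "\<xi> \<in> zeros (cvec x)"
  shows "norm (discriminant k (cvec x)) \<le> 2 * discriminant_const k * \<bar>Im \<xi>\<bar>"
proof -
  have "\<xi> \<noteq> cnj \<xi>"
  proof
    assume "\<xi> = cnj \<xi>"
    then obtain t where t: "\<xi> = of_real t" by (metis Reals_cases Reals_cnj_iff)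
    then have "\<bar>t\<bar> < \<rho>" using \<xi> by (simp add: disc_zeros_def)
    then show False using no_real_zero[OF max_card x] of_real_mem_zeros_iff[OF x(1)] \<xi> t by blast
  qed
  moreover have "card (zeros (cvec x)) = k"
    using discriminant_nonzero_iff[of "cvec x" k] max_card x by simp
  ultimately have "norm (discriminant k (cvec x)) \<le> discriminant_const k * norm (\<xi> - cnj \<xi>)"
    using x(1) \<xi> by (intro norm_discriminant_le_dist cnj_mem_zeros) auto
  then show ?thesis by (simp add: norm_diff_cnj mult_ac)
qed

lemma log_derivative_H_of_real:
  assumes x: "norm x < \<epsilon>" and t: "\<bar>t\<bar> \<le> 5 * \<rho>"
  shows "deriv (H (cvec x)) (of_real t) / H (cvec x) (of_real t) =
    of_real (dirderiv v f (x + t *\<^sub>R v) / f (x + t *\<^sub>R v))"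
  using deriv_H[of "cvec x" "of_real t"] of_real_dirderiv_f[OF real_line_in_ball[OF x t], of v]
    of_real_f_line[OF x t] x t
  by (simp add: cvec_add cvec_scaleR)

lemma nn_integral_log_dirderiv_line_le:
  assumes max_card: "\<And>x. norm x < \<epsilon> \<Longrightarrow> card (zeros (cvec x)) \<le> k"
    and x: "norm x < \<epsilon>" "discriminant k (cvec x) \<noteq> 0" and B: "B = 1 + 2 * discriminant_const k"
  shows "(\<integral>\<^sup>+t\<in>{-\<rho>..\<rho>}. ennreal \<bar>dirderiv v f (x + t *\<^sub>R v) / f (x + t *\<^sub>R v)\<bar> \<partial>lborel) \<le>
    ennreal (M / (\<rho> * m) * (2 * \<rho>) + zero_count_bound m M * (2 * (ln 3 + ln B)) +
      2 * zero_count_bound m M * \<bar>ln (norm (discriminant k (cvec x)))\<bar>)"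
proof -
  interpret line: bounded_disc_function "H (cvec x)" \<rho> m M using x by (intro bounded_disc) simp
  define D where "D = norm (discriminant k (cvec x))"
  define \<delta> where "\<delta> = min 1 (D / B)"
  have D: "D > 0" using x by (simp add: D_def)
  have B1: "B \<ge> 1" using line.zero_count_bound_nonneg by (simp add: B discriminant_const_def)
  have \<delta>: "0 < \<delta>" "\<delta> \<le> 1" using D B1 by (auto simp: \<delta>_def)
  have "(\<integral>\<^sup>+t\<in>{-\<rho>..\<rho>}. ennreal \<bar>dirderiv v f (x + t *\<^sub>R v) / f (x + t *\<^sub>R v)\<bar> \<partial>lborel) \<le>
     (\<integral>\<^sup>+t\<in>{-\<rho>..\<rho>}. ennreal (norm (deriv (H (cvec x)) (of_real t) / H (cvec x) (of_real t)))
         \<partial>lborel)"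
    using log_derivative_H_of_real[OF x(1)] \<rho>_pos
    by (intro nn_integral_mono) (auto simp: indicator_def simp del: of_real_divide)
  also have "\<dots> \<le> ennreal (M / (\<rho> * m) * (2 * \<rho>) + zero_count_bound m M * (2 * ln (3 / \<delta>)))"
  proof (rule line.nn_integral_log_derivative_le[OF radius_le \<delta>])
    fix \<xi> assume "\<xi> \<in> zeros (cvec x)"
    then have "D \<le> 2 * discriminant_const k * \<bar>Im \<xi>\<bar>"
      unfolding D_def by (intro norm_discriminant_le_Im max_card x)
    also have "\<dots> \<le> B * \<bar>Im \<xi>\<bar>" unfolding B by (intro mult_right_mono) auto
    finally show "\<delta> \<le> \<bar>Im \<xi>\<bar>" using B1 by (simp add: \<delta>_def min_le_iff_disj field_simps)
  qed
  also have "\<dots> \<le> ennreal (M / (\<rho> * m) * (2 * \<rho>) +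
      zero_count_bound m M * (2 * (ln 3 + ln B + \<bar>ln D\<bar>)))"
    using line.zero_count_bound_nonneg ln_divide_min_le[OF D B1] unfolding \<delta>_def
    by (intro ennreal_leI add_left_mono mult_left_mono) auto
  finally show ?thesis by (simp add: D_def algebra_simps)
qed

lemma exists_generic_discriminant:
  obtains k \<epsilon>1 where "0 < \<epsilon>1" "\<epsilon>1 < \<epsilon>" "\<And>x. norm x < \<epsilon> \<Longrightarrow> card (zeros (cvec x)) \<le> k"
    "(\<integral>\<^sup>+x\<in>ball 0 \<epsilon>1. abs_ln (norm (discriminant k (cvec x))) \<partial>lborel) < \<infinity>"
proof -
  obtain k x0 where x0: "norm x0 < \<epsilon>" "card (zeros (cvec x0)) = k"
    and max_card: "\<And>x. norm x < \<epsilon> \<Longrightarrow> card (zeros (cvec x)) \<le> k"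
    by (rule exists_max_card_zeros) (rule that; assumption)
  then have "discriminant k (cvec x0) \<noteq> 0" using discriminant_nonzero_iff[of "cvec x0" k] by simp
  from line_holomorphic_nn_integral_abs_ln_finite[OF line_holomorphic_discriminant x0(1) this]
  show ?thesis using that max_card by blast
qed

lemma abs_ln_discriminant_measurable:
  "\<epsilon>1 \<le> \<epsilon> \<Longrightarrow>
    (\<lambda>x. abs_ln (norm (discriminant k (cvec x))) * indicator (ball 0 \<epsilon>1) x)
      \<in> borel_measurable borel"
  by (intro borel_measurable_comp_indicator[where \<phi> = "\<lambda>y. abs_ln (norm y)"]
      set_borel_measurable_line_holomorphic[OF line_holomorphic_discriminant]) auto

lemma set_borel_measurable_log_dirderiv:
  assumes "e \<le> r"
  shows "set_borel_measurable borel (ball 0 e) (\<lambda>x. dirderiv v f x / f x)"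
proof -
  have "ball 0 e \<subseteq> \<Omega>" using assms ball_sub by force
  then show ?thesis
    by (intro set_borel_measurable_divide set_borel_measurable_real_analytic[OF analytic]
        set_borel_measurable_real_analytic[OF real_analytic_on_dirderiv[OF analytic]]) auto
qed

lemma nn_integral_log_dirderiv_finite:
  assumes \<epsilon>1: "0 < \<epsilon>1" "\<epsilon>1 < \<epsilon>" and max_card: "\<And>x. norm x < \<epsilon> \<Longrightarrow> card (zeros (cvec x)) \<le> k"
    and finite_integral: "(\<integral>\<^sup>+x\<in>ball 0 \<epsilon>1. abs_ln (norm (discriminant k (cvec x))) \<partial>lborel) < \<infinity>"
    and generic: "AE x in lborel. norm x < \<epsilon>1 \<longrightarrow> discriminant k (cvec x) \<noteq> 0"
  shows "(\<integral>\<^sup>+x. ennreal \<bar>dirderiv v f x / f x\<bar> * indicator (ball 0 (\<epsilon>1 / 2)) x \<partial>lborel) < \<infinity>"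
proof -
  have N: "0 \<le> zero_count_bound m M"
    using bounded_disc_function.zero_count_bound_nonneg[OF bounded_disc[of 0]] base_pos by simp
  define g where "g = (\<lambda>x. ennreal \<bar>dirderiv v f x / f x\<bar> * indicator (ball 0 (\<epsilon>1 / 2)) x)"
  define A where "A = M / (\<rho> * m) * (2 * \<rho>) +
      zero_count_bound m M * (2 * (ln 3 + ln (1 + 2 * discriminant_const k)))"
  define C where "C = 2 * zero_count_bound m M"
  define K where "K = (\<lambda>x. ennreal \<bar>A\<bar> + ennreal C * abs_ln (norm (discriminant k (cvec x))))"
  have "(\<integral>\<^sup>+x. g x \<partial>lborel) < \<infinity>"
  proof (rule nn_integral_finite_by_lines[OF _ \<rho>_pos \<epsilon>1(1), where v = v and K = K])
    show "g \<in> borel_measurable borel"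
      unfolding g_def using \<epsilon>1 base_less
      by (intro borel_measurable_comp_indicator[where \<phi> = "\<lambda>y. ennreal \<bar>y\<bar>"]
           set_borel_measurable_log_dirderiv) auto
    show "AE x in lborel. norm x < \<epsilon>1 \<longrightarrow> (\<integral>\<^sup>+t\<in>{-\<rho>..\<rho>}. g (x + t *\<^sub>R v) \<partial>lborel) \<le> K x"
      using generic
    proof (eventually_elim, intro impI)
      fix x assume "norm x < \<epsilon>1 \<longrightarrow> discriminant k (cvec x) \<noteq> 0" "norm x < \<epsilon>1"
      then have x: "norm x < \<epsilon>" "discriminant k (cvec x) \<noteq> 0" using \<epsilon>1 by auto
      have "(\<integral>\<^sup>+t\<in>{-\<rho>..\<rho>}. g (x + t *\<^sub>R v) \<partial>lborel) \<le>
          (\<integral>\<^sup>+t\<in>{-\<rho>..\<rho>}. ennreal \<bar>dirderiv v f (x + t *\<^sub>R v) / f (x + t *\<^sub>R v)\<bar> \<partial>lborel)"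
        by (intro nn_integral_mono) (auto simp: g_def indicator_def)
      also have "\<dots> \<le> ennreal (A + C * \<bar>ln (norm (discriminant k (cvec x)))\<bar>)"
        unfolding A_def C_def by (rule nn_integral_log_dirderiv_line_le[OF max_card x refl])
      also have "\<dots> \<le> ennreal (\<bar>A\<bar> + C * \<bar>ln (norm (discriminant k (cvec x)))\<bar>)"
        by (intro ennreal_leI) simp
      also have "\<dots> = K x" using N x(2) by (simp add: K_def C_def abs_ln_def ennreal_mult')
      finally show "(\<integral>\<^sup>+t\<in>{-\<rho>..\<rho>}. g (x + t *\<^sub>R v) \<partial>lborel) \<le> K x" .
    qed
    show "(\<integral>\<^sup>+x\<in>ball 0 \<epsilon>1. K x \<partial>lborel) < \<infinity>"
      unfolding K_def using \<epsilon>1 finite_integral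
      by (intro nn_integral_ball_affine_finite abs_ln_discriminant_measurable) auto
  qed (auto simp: g_def)
  then show ?thesis by (simp add: g_def)
qed

lemma set_integrable_log_dirderiv:
  obtains e where "0 < e" "2 * e < \<epsilon>"
    "AE x in lborel. norm x < 2 * e \<longrightarrow> (\<forall>t. \<bar>t\<bar> < \<rho> \<longrightarrow> f (x + t *\<^sub>R v) \<noteq> 0)"
    "set_integrable lborel (ball 0 e) (\<lambda>x. dirderiv v f x / f x)"
proof -
  obtain k \<epsilon>1 where \<epsilon>1: "0 < \<epsilon>1" "\<epsilon>1 < \<epsilon>" and max_card: "\<And>x. norm x < \<epsilon> \<Longrightarrow> card (zeros (cvec x)) \<le> k"
    and finite_integral: "(\<integral>\<^sup>+x\<in>ball 0 \<epsilon>1. abs_ln (norm (discriminant k (cvec x))) \<partial>lborel) < \<infinity>"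
    by (rule exists_generic_discriminant) (rule that; assumption)
  have "AE x in lborel. abs_ln (norm (discriminant k (cvec x))) * indicator (ball 0 \<epsilon>1) x \<noteq> \<infinity>"
    using finite_integral \<epsilon>1 abs_ln_discriminant_measurable[of \<epsilon>1 k]
    by (intro nn_integral_PInf_AE) auto
  then have generic: "AE x in lborel. norm x < \<epsilon>1 \<longrightarrow> discriminant k (cvec x) \<noteq> 0"
    by eventually_elim (auto simp: abs_ln_def)
  define e where "e = \<epsilon>1 / 2"
  have "AE x in lborel. norm x < 2 * e \<longrightarrow> (\<forall>t. \<bar>t\<bar> < \<rho> \<longrightarrow> f (x + t *\<^sub>R v) \<noteq> 0)"
    using generic by eventually_elim (use no_real_zero[OF max_card] \<epsilon>1 in \<open>auto simp: e_def\<close>)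
  moreover have "set_integrable lborel (ball 0 e) (\<lambda>x. dirderiv v f x / f x)"
    unfolding set_integrable_def
  proof (rule integrableI_bounded)
    show "(\<lambda>x. indicator (ball 0 e) x *\<^sub>R (dirderiv v f x / f x)) \<in> borel_measurable lborel"
      using set_borel_measurable_log_dirderiv[of e] \<epsilon>1 base_less
      by (simp add: e_def set_borel_measurable_def)
    have "(\<integral>\<^sup>+x. ennreal (norm (indicator (ball 0 e) x *\<^sub>R (dirderiv v f x / f x))) \<partial>lborel) =
       (\<integral>\<^sup>+x. ennreal \<bar>dirderiv v f x / f x\<bar> * indicator (ball 0 (\<epsilon>1 / 2)) x \<partial>lborel)"
      by (intro nn_integral_cong) (auto simp: e_def indicator_def)
    also have "\<dots> < \<infinity>"
      by (rule nn_integral_log_dirderiv_finite[OF \<epsilon>1 max_card finite_integral generic])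
    finally show "(\<integral>\<^sup>+x. ennreal (norm (indicator (ball 0 e) x *\<^sub>R (dirderiv v f x / f x)))
        \<partial>lborel) < \<infinity>" .
  qed
  ultimately show ?thesis using that[of e] \<epsilon>1 by (simp add: e_def)
qed

end

section \<open>Weak derivatives along a direction\<close>

lemma smooth_fun_continuous_on:
  assumes "smooth_fun \<phi>"
  shows "continuous_on UNIV \<phi>" "continuous_on UNIV (dirderiv (axis i 1) \<phi>)"
proof -
  have "continuous_on UNIV (iter_partial [] \<phi>)" "continuous_on UNIV (iter_partial [i] \<phi>)"
    using assms unfolding smooth_fun_def by blast+
  then show "continuous_on UNIV \<phi>" "continuous_on UNIV (dirderiv (axis i 1) \<phi>)"
    by (simp_all add: partial_deriv_eq_dirderiv)
qed

lemma smooth_fun_has_derivative: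
  fixes \<phi> :: "real ^ 'n \<Rightarrow> real"
  assumes "smooth_fun \<phi>"
  shows "(\<phi> has_derivative (\<lambda>h. grad \<phi> x \<bullet> h)) (at x)"
proof (rule has_derivative_grad[of UNIV])
  fix x and i :: 'n
  have "(\<lambda>t. iter_partial [] \<phi> (x + t *\<^sub>R axis i 1)) differentiable (at 0)"
    using assms unfolding smooth_fun_def by blast
  then show "((\<lambda>t. \<phi> (x + t *\<^sub>R axis i 1)) has_real_derivative dirderiv (axis i 1) \<phi> x) (at 0)"
    unfolding dirderiv_def by (simp add: DERIV_deriv_iff_real_differentiable)
  show "isCont (dirderiv (axis i 1) \<phi>) x" for x
    using smooth_fun_continuous_on(2)[OF assms] by (simp add: continuous_on_eq_continuous_at)
qed auto

lemma smooth_fun_dirderiv_eq_inner: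
  fixes \<phi> :: "real ^ 'n \<Rightarrow> real"
  assumes "smooth_fun \<phi>"
  shows "dirderiv v \<phi> x = grad \<phi> x \<bullet> v"
  by (rule has_derivative_imp_dirderiv[OF smooth_fun_has_derivative[OF assms]])

lemma smooth_fun_has_real_derivative_line:
  fixes \<phi> :: "real ^ 'n \<Rightarrow> real"
  assumes "smooth_fun \<phi>"
  shows "((\<lambda>t. \<phi> (x + t *\<^sub>R v)) has_real_derivative dirderiv v \<phi> (x + t *\<^sub>R v)) (at t)"
  unfolding smooth_fun_dirderiv_eq_inner[OF assms]
  by (rule has_real_derivative_line_shift)
     (rule has_derivative_imp_has_real_derivative_line[OF smooth_fun_has_derivative[OF assms]])

lemma smooth_fun_continuous_on_dirderiv:
  fixes \<phi> :: "real ^ 'n \<Rightarrow> real"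
  assumes "smooth_fun \<phi>"
  shows "continuous_on UNIV (dirderiv v \<phi>)"
proof -
  have "dirderiv v \<phi> x = (\<Sum>i\<in>UNIV. dirderiv (axis i 1) \<phi> x * v $ i)" for x
    unfolding smooth_fun_dirderiv_eq_inner[OF assms, of v] by (simp add: inner_vec_def grad_def)
  then have "dirderiv v \<phi> = (\<lambda>x. \<Sum>i\<in>UNIV. dirderiv (axis i 1) \<phi> x * v $ i)" by (rule ext)
  then show ?thesis using smooth_fun_continuous_on(2)[OF assms] by (auto intro!: continuous_intros)
qed

lemma test_fun_mono: "test_fun U \<phi> \<Longrightarrow> U \<subseteq> V \<Longrightarrow> test_fun V \<phi>"
  by (auto simp: test_fun_def)

lemma test_fun_support: "test_fun U \<phi> \<Longrightarrow> test_fun (closure {x. \<phi> x \<noteq> 0}) \<phi>"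
  by (simp add: test_fun_def)

lemma eventually_nhds_line:
  fixes x v :: "'a::real_normed_vector"
  assumes "\<forall>\<^sub>F y in nhds (x + t *\<^sub>R v). P y"
  shows "\<forall>\<^sub>F s in nhds t. P (x + s *\<^sub>R v)"
  by (rule eventually_compose_filterlim[OF assms]) (intro tendsto_intros filterlim_ident)

lemma test_fun_eventually_0:
  assumes "test_fun U \<phi>" "x \<notin> U"
  shows "\<forall>\<^sub>F y in nhds x. \<phi> y = 0 \<and> dirderiv v \<phi> y = 0"
proof -
  have "\<forall>\<^sub>F y in nhds x. y \<in> - closure {y. \<phi> y \<noteq> 0}"
    using assms by (intro eventually_nhds_in_open) (auto simp: test_fun_def)
  then have "\<forall>\<^sub>F y in nhds x. \<phi> y = 0"
    by eventually_elim (use closure_subset[of "{y. \<phi> y \<noteq> 0}"] in auto)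
  then have "\<forall>\<^sub>F y in nhds x. \<forall>\<^sub>F y' in nhds y. \<phi> y' = 0" by (simp add: eventually_eventually)
  then show ?thesis
  proof eventually_elim
    case (elim y)
    then have "\<forall>\<^sub>F s in nhds 0. \<phi> (y + s *\<^sub>R v) = 0" by (intro eventually_nhds_line) simp
    then have "dirderiv v \<phi> y = deriv (\<lambda>s. 0) 0"
      unfolding dirderiv_def by (intro deriv_cong_ev) auto
    then show ?case using eventually_nhds_x_imp_x[OF elim] by simp
  qed
qed

lemma test_fun_eq_0:
  assumes "test_fun U \<phi>" "x \<notin> U"
  shows "\<phi> x = 0" "dirderiv v \<phi> x = 0"
  using eventually_nhds_x_imp_x[OF test_fun_eventually_0[OF assms]] by auto

lemma integrable_mult_continuous_compact_support:
  fixes w \<psi> :: "'a::euclidean_space \<Rightarrow> real"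
  assumes w: "set_integrable lborel U w" and \<psi>: "continuous_on UNIV \<psi>"
    and K: "compact K" "K \<subseteq> U" "\<And>x. x \<notin> K \<Longrightarrow> \<psi> x = 0"
  shows "integrable lborel (\<lambda>x. w x * \<psi> x)"
proof -
  have "bounded (\<psi> ` K)"
    using K(1) \<psi> by (intro compact_imp_bounded compact_continuous_image)
      (auto intro: continuous_on_subset)
  then obtain B where "B > 0" "\<And>x. x \<in> K \<Longrightarrow> \<bar>\<psi> x\<bar> \<le> B" by (auto simp: bounded_pos)
  then have B: "\<bar>\<psi> x\<bar> \<le> B" for x using K(3)[of x] by (cases "x \<in> K") auto
  have [measurable]: "\<psi> \<in> borel_measurable borel" using \<psi> by (rule borel_measurable_continuous_onI)
  have [measurable]: "(\<lambda>x. indicator U x *\<^sub>R w x) \<in> borel_measurable lborel"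
    using w unfolding set_integrable_def by (rule borel_measurable_integrable)
  have "integrable lborel (\<lambda>x. (indicator U x *\<^sub>R w x) * \<psi> x)"
  proof (rule Bochner_Integration.integrable_bound)
    show "integrable lborel (\<lambda>x. B * (indicator U x *\<^sub>R w x))"
      using w unfolding set_integrable_def by (rule integrable_mult_right)
    have "norm ((indicator U x *\<^sub>R w x) * \<psi> x) \<le> norm (B * (indicator U x *\<^sub>R w x))" for x
      using mult_left_mono[OF B[of x], of "\<bar>indicator U x *\<^sub>R w x\<bar>"] \<open>B > 0\<close>
      by (simp add: abs_mult mult_ac)
    then show "AE x in lborel. norm ((indicator U x *\<^sub>R w x) * \<psi> x) \<le>
        norm (B * (indicator U x *\<^sub>R w x))" by simp
  qed measurable
  also have "(\<lambda>x. (indicator U x *\<^sub>R w x) * \<psi> x) = (\<lambda>x. w x * \<psi> x)"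
    using K(2,3) by (fastforce simp: indicator_def)
  finally show ?thesis .
qed

lemma integrable_mult_test_fun:
  fixes w \<phi> :: "real ^ 'n \<Rightarrow> real"
  assumes w: "set_integrable lborel U w" and \<phi>: "test_fun U \<phi>"
  shows "integrable lborel (\<lambda>x. w x * \<phi> x)" "integrable lborel (\<lambda>x. w x * dirderiv v \<phi> x)"
proof -
  have K: "compact (closure {x. \<phi> x \<noteq> 0})" "closure {x. \<phi> x \<noteq> 0} \<subseteq> U" and s: "smooth_fun \<phi>"
    using \<phi> by (auto simp: test_fun_def)
  show "integrable lborel (\<lambda>x. w x * \<phi> x)"
    by (rule integrable_mult_continuous_compact_support[OF w smooth_fun_continuous_on(1)[OF s] K
        test_fun_eq_0(1)[OF test_fun_support[OF \<phi>]]])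
  show "integrable lborel (\<lambda>x. w x * dirderiv v \<phi> x)"
    by (rule integrable_mult_continuous_compact_support[OF w
        smooth_fun_continuous_on_dirderiv[OF s] K
        test_fun_eq_0(2)[OF test_fun_support[OF \<phi>]]])
qed

text \<open>Test functions vanish off \<open>U\<close>, so the integrals may be taken over the whole space.\<close>

definition weak_dirderiv_on ::
    "(real ^ 'n) set \<Rightarrow> real ^ 'n \<Rightarrow> (real ^ 'n \<Rightarrow> real) \<Rightarrow> (real ^ 'n \<Rightarrow> real) \<Rightarrow> bool" where
  "weak_dirderiv_on U v u g \<longleftrightarrow> set_integrable lborel U u \<and> set_integrable lborel U g \<and>
     (\<forall>\<phi>. test_fun U \<phi> \<longrightarrow> (LINT x|lborel. u x * dirderiv v \<phi> x) = - (LINT x|lborel. g x * \<phi> x))"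

lemma weak_dirderiv_onD:
  assumes "weak_dirderiv_on U v u g"
  shows "set_integrable lborel U u" "set_integrable lborel U g"
    "test_fun U \<phi> \<Longrightarrow> (LINT x|lborel. u x * dirderiv v \<phi> x) = - (LINT x|lborel. g x * \<phi> x)"
  using assms by (auto simp: weak_dirderiv_on_def)

lemma weak_dirderiv_on_subset:
  assumes "weak_dirderiv_on U v u g" "V \<subseteq> U" "V \<in> sets borel"
  shows "weak_dirderiv_on V v u g"
  using assms set_integrable_subset[of lborel U _ V] test_fun_mono[of V _ U]
  by (auto simp: weak_dirderiv_on_def)

lemma weak_dirderiv_on_cong:
  assumes u: "weak_dirderiv_on U v u g" and g: "\<And>x. x \<in> U \<Longrightarrow> g x = g' x"
  shows "weak_dirderiv_on U v u g'"
proof -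
  have "(LINT x|lborel. g x * \<phi> x) = (LINT x|lborel. g' x * \<phi> x)" if "test_fun U \<phi>" for \<phi>
  proof (rule Bochner_Integration.integral_cong[OF refl])
    show "g x * \<phi> x = g' x * \<phi> x" for x
      using g[of x] test_fun_eq_0(1)[OF that, of x] by (cases "x \<in> U") auto
  qed
  moreover have "set_integrable lborel U g \<longleftrightarrow> set_integrable lborel U g'"
    using g unfolding set_integrable_def
    by (intro Bochner_Integration.integrable_cong) (auto simp: indicator_def)
  ultimately show ?thesis using u by (simp add: weak_dirderiv_on_def)
qed

lemma weak_dirderiv_on_linear_combination:
  assumes v: "weak_dirderiv_on U v u g" and w: "weak_dirderiv_on U w u h"
  shows "weak_dirderiv_on U (a *\<^sub>R v + b *\<^sub>R w) u (\<lambda>x. a * g x + b * h x)"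
  unfolding weak_dirderiv_on_def
proof (intro conjI allI impI)
  show "set_integrable lborel U u" by (rule weak_dirderiv_onD(1)[OF v])
  show "set_integrable lborel U (\<lambda>x. a * g x + b * h x)"
    using weak_dirderiv_onD(2)[OF v] weak_dirderiv_onD(2)[OF w]
    by (intro set_integral_add set_integrable_mult_right)
  fix \<phi> :: "real ^ 'a \<Rightarrow> real" assume \<phi>: "test_fun U \<phi>"
  note u\<phi> = integrable_mult_test_fun(2)[OF weak_dirderiv_onD(1)[OF v] \<phi>]
  have "u x * dirderiv (a *\<^sub>R v + b *\<^sub>R w) \<phi> x =
      a * (u x * dirderiv v \<phi> x) + b * (u x * dirderiv w \<phi> x)" for x
    using \<phi> by (simp add: test_fun_def smooth_fun_dirderiv_eq_inner inner_add_right algebra_simps)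
  then have "(LINT x|lborel. u x * dirderiv (a *\<^sub>R v + b *\<^sub>R w) \<phi> x) =
      a * (LINT x|lborel. u x * dirderiv v \<phi> x) + b * (LINT x|lborel. u x * dirderiv w \<phi> x)"
    using u\<phi> by simp
  also have "\<dots> = - (a * (LINT x|lborel. g x * \<phi> x) + b * (LINT x|lborel. h x * \<phi> x))"
    using weak_dirderiv_onD(3)[OF v \<phi>] weak_dirderiv_onD(3)[OF w \<phi>] by simp
  also have "a * (LINT x|lborel. g x * \<phi> x) + b * (LINT x|lborel. h x * \<phi> x) =
      (LINT x|lborel. a * (g x * \<phi> x) + b * (h x * \<phi> x))"
    using integrable_mult_test_fun(1)[OF weak_dirderiv_onD(2)[OF v] \<phi>]
      integrable_mult_test_fun(1)[OF weak_dirderiv_onD(2)[OF w] \<phi>] by simp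
  finally show "(LINT x|lborel. u x * dirderiv (a *\<^sub>R v + b *\<^sub>R w) \<phi> x) =
      - (LINT x|lborel. (a * g x + b * h x) * \<phi> x)"
    by (simp add: algebra_simps)
qed

lemma mult_test_fun_has_real_derivative_line:
  fixes u g \<phi> :: "real ^ 'n \<Rightarrow> real"
  assumes \<phi>: "test_fun U \<phi>"
    and u: "x + t *\<^sub>R v \<in> U \<Longrightarrow> ((\<lambda>s. u (x + s *\<^sub>R v)) has_real_derivative g (x + t *\<^sub>R v)) (at t)"
    and g: "x + t *\<^sub>R v \<in> U \<Longrightarrow> isCont (\<lambda>s. g (x + s *\<^sub>R v)) t"
  defines "\<Psi> \<equiv> \<lambda>y. u y * dirderiv v \<phi> y + g y * \<phi> y"
  shows "((\<lambda>s. u (x + s *\<^sub>R v) * \<phi> (x + s *\<^sub>R v)) has_real_derivative \<Psi> (x + t *\<^sub>R v)) (at t)"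
    and "isCont (\<lambda>s. \<Psi> (x + s *\<^sub>R v)) t"
proof -
  have s: "smooth_fun \<phi>" using \<phi> by (simp add: test_fun_def)
  note deriv_\<phi> = smooth_fun_has_real_derivative_line[OF s, of x v t]
  have "((\<lambda>s. u (x + s *\<^sub>R v) * \<phi> (x + s *\<^sub>R v)) has_real_derivative \<Psi> (x + t *\<^sub>R v)) (at t) \<and>
      isCont (\<lambda>s. \<Psi> (x + s *\<^sub>R v)) t"
  proof (cases "x + t *\<^sub>R v \<in> U")
    case True
    have "isCont (dirderiv v \<phi>) (x + t *\<^sub>R v)"
      using smooth_fun_continuous_on_dirderiv[OF s] by (simp add: continuous_on_eq_continuous_at)
    then have "isCont (\<lambda>s. dirderiv v \<phi> (x + s *\<^sub>R v)) t"
      by (rule isCont_o2[where g = "dirderiv v \<phi>", rotated]) (intro continuous_intros)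
    then have "isCont (\<lambda>s. \<Psi> (x + s *\<^sub>R v)) t"
      unfolding \<Psi>_def using g[OF True] DERIV_isCont[OF u[OF True]] DERIV_isCont[OF deriv_\<phi>]
      by (intro continuous_intros)
    then show ?thesis using DERIV_mult[OF u[OF True] deriv_\<phi>] by (simp add: \<Psi>_def algebra_simps)
  next
    case False
    have vanish: "\<forall>\<^sub>F s in nhds t. \<phi> (x + s *\<^sub>R v) = 0 \<and> dirderiv v \<phi> (x + s *\<^sub>R v) = 0"
      by (rule eventually_nhds_line[OF test_fun_eventually_0[OF \<phi> False]])
    then have "\<forall>\<^sub>F s in nhds t. u (x + s *\<^sub>R v) * \<phi> (x + s *\<^sub>R v) = 0" by eventually_elim simp
    from DERIV_cong_ev[OF refl this refl]
    have "((\<lambda>s. u (x + s *\<^sub>R v) * \<phi> (x + s *\<^sub>R v)) has_real_derivative 0) (at t)" by simp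
    moreover have "\<forall>\<^sub>F s in nhds t. \<Psi> (x + s *\<^sub>R v) = 0"
      using vanish by eventually_elim (simp add: \<Psi>_def)
    then have "isCont (\<lambda>s. \<Psi> (x + s *\<^sub>R v)) t" by (subst isCont_cong) auto
    moreover have "\<Psi> (x + t *\<^sub>R v) = 0" using test_fun_eq_0[OF \<phi> False] by (simp add: \<Psi>_def)
    ultimately show ?thesis by simp
  qed
  then show "((\<lambda>s. u (x + s *\<^sub>R v) * \<phi> (x + s *\<^sub>R v)) has_real_derivative \<Psi> (x + t *\<^sub>R v)) (at t)"
    "isCont (\<lambda>s. \<Psi> (x + s *\<^sub>R v)) t" by auto
qed

lemma integral_eq_0_of_line_increments:
  fixes \<Psi> w :: "'a::euclidean_space \<Rightarrow> real"
  assumes \<Psi>: "integrable lborel \<Psi>" and w: "integrable lborel w" and a: "a > 0"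
    and increments: "AE x in lborel.
      (LINT t|lborel. \<Psi> (x + t *\<^sub>R v) * indicator {-a..a} t) = w (x + a *\<^sub>R v) - w (x + (-a) *\<^sub>R v)"
  shows "(LINT x|lborel. \<Psi> x) = 0"
proof -
  have [measurable]: "\<Psi> \<in> borel_measurable borel" "w \<in> borel_measurable borel" using \<Psi> w by auto
  have "2 * a * (LINT x|lborel. \<Psi> x) =
      (LINT x|lborel. (LINT t|lborel. \<Psi> (x + t *\<^sub>R v) * indicator {-a..a} t))"
    by (rule integral_line_average[OF \<Psi> a])
  also have "\<dots> = (LINT x|lborel. w (x + a *\<^sub>R v) - w (x + (-a) *\<^sub>R v))"
    using increments by (intro integral_cong_AE) measurable
  also have "\<dots> = 0"
    using integrable_translate[OF w] by (simp add: integral_translate del: scaleR_minus_left)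
  finally show ?thesis using a by simp
qed

lemma weak_dirderiv_on_of_lines:
  fixes u g :: "real ^ 'n \<Rightarrow> real"
  assumes \<tau>: "0 < \<tau>" and u: "set_integrable lborel U u" and g: "set_integrable lborel U g"
    and lines: "AE x in lborel. \<forall>t. \<bar>t\<bar> < \<tau> \<longrightarrow> x + t *\<^sub>R v \<in> U \<longrightarrow>
      ((\<lambda>s. u (x + s *\<^sub>R v)) has_real_derivative g (x + t *\<^sub>R v)) (at t) \<and>
      isCont (\<lambda>s. g (x + s *\<^sub>R v)) t"
  shows "weak_dirderiv_on U v u g"
  unfolding weak_dirderiv_on_def
proof (intro conjI allI impI u g)
  fix \<phi> :: "real ^ 'n \<Rightarrow> real" assume \<phi>: "test_fun U \<phi>"
  define \<Psi> where "\<Psi> = (\<lambda>x. u x * dirderiv v \<phi> x + g x * \<phi> x)"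
  define w where "w = (\<lambda>x. u x * \<phi> x)"
  define a where "a = \<tau> / 2"
  have a: "0 < a" "a < \<tau>" using \<tau> by (auto simp: a_def)
  note u\<phi> = integrable_mult_test_fun[OF u \<phi>] and g\<phi> = integrable_mult_test_fun(1)[OF g \<phi>]
  have "(LINT x|lborel. \<Psi> x) = 0"
  proof (rule integral_eq_0_of_line_increments[OF _ _ a(1)])
    show "integrable lborel \<Psi>" "integrable lborel w" unfolding \<Psi>_def w_def using u\<phi> g\<phi> by auto
    show "AE x in lborel. (LINT t|lborel. \<Psi> (x + t *\<^sub>R v) * indicator {-a..a} t) =
        w (x + a *\<^sub>R v) - w (x + (-a) *\<^sub>R v)"
      using lines
    proof eventually_elim
      case (elim x)
      show ?case
      proof (rule integral_FTC_Icc_real)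
        fix t assume "-a \<le> t" "t \<le> a"
        then have "\<bar>t\<bar> < \<tau>" using a by linarith
        then show "((\<lambda>t. w (x + t *\<^sub>R v)) has_real_derivative \<Psi> (x + t *\<^sub>R v)) (at t)"
          "isCont (\<lambda>t. \<Psi> (x + t *\<^sub>R v)) t"
          unfolding w_def \<Psi>_def using elim
          by (intro mult_test_fun_has_real_derivative_line[OF \<phi>]; blast)+
      qed (use a in auto)
    qed
  qed
  then show "(LINT x|lborel. u x * dirderiv v \<phi> x) = - (LINT x|lborel. g x * \<phi> x)"
    unfolding \<Psi>_def using u\<phi> g\<phi> by simp
qed

lemma L1_on_of_lborel:
  fixes u :: "real ^ 'n \<Rightarrow> real"
  assumes "set_integrable lborel U u"
  shows "L1_on U u"
  using assms unfolding L1_on_def set_integrable_def by (subst integrable_completion) auto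

lemma set_integral_lebesgue_eq_integral_lborel:
  fixes h :: "'a::euclidean_space \<Rightarrow> real"
  assumes "integrable lborel h" "\<And>x. x \<notin> U \<Longrightarrow> h x = 0"
  shows "(LINT x:U|lebesgue. h x) = (LINT x|lborel. h x)"
proof -
  have "(LINT x:U|lebesgue. h x) = (LINT x|lebesgue. h x)" unfolding set_lebesgue_integral_def
    using assms(2) by (intro Bochner_Integration.integral_cong refl) (auto simp: indicator_def)
  also have "\<dots> = (LINT x|lborel. h x)" using assms(1) by (intro integral_completion) auto
  finally show ?thesis .
qed

lemma weak_gradient_on_of_partials:
  assumes "\<And>i. weak_dirderiv_on U (axis i 1) u (\<lambda>x. G x $ i)"
  shows "weak_gradient_on U u G"
  unfolding weak_gradient_on_def
proof (intro allI impI)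
  fix \<phi> :: "real ^ 'a \<Rightarrow> real" and i assume \<phi>: "test_fun U \<phi>"
  note partial = weak_dirderiv_onD[OF assms[of i]]
  have "(LINT x:U|lebesgue. u x * dirderiv (axis i 1) \<phi> x) =
      (LINT x|lborel. u x * dirderiv (axis i 1) \<phi> x)"
    "(LINT x:U|lebesgue. G x $ i * \<phi> x) = (LINT x|lborel. G x $ i * \<phi> x)"
    using test_fun_eq_0[OF \<phi>]
    by (auto intro!: set_integral_lebesgue_eq_integral_lborel integrable_mult_test_fun[OF _ \<phi>]
         partial(1,2))
  then show "(LINT x:U|lebesgue. u x * partial_deriv i \<phi> x) = - (LINT x:U|lebesgue. G x $ i * \<phi> x)"
    using partial(3)[OF \<phi>] by (simp add: partial_deriv_eq_dirderiv)
qed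

section \<open>The logarithm of an analytic function with thin zero set\<close>

lemma DERIV_ln_abs:
  fixes y :: real
  assumes "y \<noteq> 0"
  shows "((\<lambda>y. ln \<bar>y\<bar>) has_real_derivative 1 / y) (at y)"
proof (cases "y > 0")
  case True
  have "(ln has_real_derivative 1 / y) (at y)" using True by (auto intro!: derivative_eq_intros)
  then show ?thesis
    by (rule has_field_derivative_transform_within_open[where S = "{0<..}"]) (use True in auto)
next
  case False
  then have y: "y < 0" using assms by simp
  have "((\<lambda>y. ln (- y)) has_real_derivative 1 / y) (at y)"
    using y by (auto intro!: derivative_eq_intros)
  then show ?thesis
    by (rule has_field_derivative_transform_within_open[where S = "{..<0}"]) (use y in auto)
qed

lemma ln_abs_real_analytic_line:
  fixes f :: "real ^ 'n \<Rightarrow> real"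
  assumes f: "real_analytic_on f \<Omega>" and p: "x + t *\<^sub>R v \<in> \<Omega>" "f (x + t *\<^sub>R v) \<noteq> 0"
  shows "((\<lambda>s. ln \<bar>f (x + s *\<^sub>R v)\<bar>) has_real_derivative
      dirderiv v f (x + t *\<^sub>R v) / f (x + t *\<^sub>R v)) (at t)"
    and "isCont (\<lambda>s. dirderiv v f (x + s *\<^sub>R v) / f (x + s *\<^sub>R v)) t"
proof -
  have deriv_f: "((\<lambda>s. f (x + s *\<^sub>R v)) has_real_derivative dirderiv v f (x + t *\<^sub>R v)) (at t)"
    by (rule has_real_derivative_line_shift, rule real_analytic_on_has_dirderiv[OF f p(1)])
  show "((\<lambda>s. ln \<bar>f (x + s *\<^sub>R v)\<bar>) has_real_derivative
      dirderiv v f (x + t *\<^sub>R v) / f (x + t *\<^sub>R v)) (at t)"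
    using DERIV_chain2[OF DERIV_ln_abs[OF p(2)] deriv_f] by simp
  have "isCont (\<lambda>s. dirderiv v f (x + s *\<^sub>R v)) t"
    using real_analytic_on_isCont[OF real_analytic_on_dirderiv[OF f] p(1)]
    by (rule isCont_o2[where g = "dirderiv v f", rotated]) (intro continuous_intros)
  then show "isCont (\<lambda>s. dirderiv v f (x + s *\<^sub>R v) / f (x + s *\<^sub>R v)) t"
    using DERIV_isCont[OF deriv_f] p(2) by (intro isCont_divide)
qed

lemma analytic_codim_ge_2_imp_not_smooth_nearby:
  fixes X :: "(real ^ 'n) set"
  assumes codim: "analytic_codim_at X p \<ge> 2" and d: "d \<ge> CARD('n) - 1"
  shows "\<forall>\<^sub>F q in nhds p. \<not> smooth_point X q d"
proof -
  define S where "S = {d. p \<in> closure {q. smooth_point X q d}}"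
  have "d \<le> CARD('n)" if "d \<in> S" for d
  proof -
    have "{q. smooth_point X q d} \<noteq> {}"
      using that unfolding S_def by (metis closure_empty empty_iff mem_Collect_eq)
    then show ?thesis by (auto simp: smooth_point_def analytic_submanifold_def)
  qed
  then have "bdd_above S" by (auto simp: bdd_above_def)
  then have "d \<le> Sup S" if "d \<in> S" using that by (intro cSup_upper)
  then have "d \<notin> S" using codim d by (auto simp: analytic_codim_at_def analytic_dim_at_def S_def)
  then show ?thesis by (auto simp: S_def closure_approachable eventually_nhds_metric)
qed

lemma smooth_point_interior:
  fixes X :: "(real ^ 'n) set"
  assumes "open W" "q \<in> W" "W \<subseteq> X"
  shows "smooth_point X q (CARD('n))"
proof -
  have "W \<inter> X = W" using assms(3) by auto
  then have "analytic_submanifold (W \<inter> X) W (CARD('n))"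
    unfolding analytic_submanifold_def using assms(1) by (auto intro!: exI[of _ W])
  then show ?thesis unfolding smooth_point_def using assms by blast
qed

lemma analytic_germ_of_codim_ge_2:
  fixes f :: "real ^ 'n \<Rightarrow> real"
  assumes "open \<Omega>" "0 \<in> \<Omega>" and f: "real_analytic_on f \<Omega>"
    and codim: "analytic_codim_at {x\<in>\<Omega>. f x = 0} 0 \<ge> 2"
  obtains c r x0 where "analytic_germ c r f \<Omega>" "norm x0 < r" "f x0 \<noteq> 0"
proof -
  let ?X = "{x\<in>\<Omega>. f x = 0}"
  obtain r0 c where r0: "r0 > 0" "converges_on_ball c r0"
    and series: "\<And>x. x \<in> ball 0 r0 \<Longrightarrow> f x = Re (pseries c (cvec (x - 0)))"
    by (rule real_analytic_onE[OF f \<open>0 \<in> \<Omega>\<close>]) (rule that; assumption)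
  have "\<forall>\<^sub>F q in nhds 0. q \<in> \<Omega>" using assms(1,2) by (rule eventually_nhds_in_open)
  moreover have "\<forall>\<^sub>F q in nhds 0. \<not> smooth_point ?X q (CARD('n) - 1)"
    "\<forall>\<^sub>F q in nhds 0. \<not> smooth_point ?X q (CARD('n))"
    using codim by (auto intro: analytic_codim_ge_2_imp_not_smooth_nearby)
  ultimately have "\<forall>\<^sub>F q in nhds 0. q \<in> \<Omega> \<and> \<not> smooth_point ?X q (CARD('n) - 1) \<and>
      \<not> smooth_point ?X q (CARD('n))"
    by eventually_elim simp
  then obtain r1 where r1: "r1 > 0"
    and near: "\<And>q. norm q < r1 \<Longrightarrow> q \<in> \<Omega> \<and> \<not> smooth_point ?X q (CARD('n) - 1) \<and>
        \<not> smooth_point ?X q (CARD('n))"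
    by (auto simp: eventually_nhds_metric)
  define r where "r = min r0 r1"
  have germ: "analytic_germ c r f \<Omega>"
    using r0 r1 series near f by unfold_locales (auto simp: r_def converges_on_ball_def)
  have "\<exists>x0. norm x0 < r \<and> f x0 \<noteq> 0"
  proof (rule ccontr)
    assume "\<not> ?thesis"
    then have "ball 0 r \<subseteq> ?X" using near by (auto simp: r_def)
    then have "smooth_point ?X 0 (CARD('n))"
      using r0 r1 by (intro smooth_point_interior) (auto simp: r_def)
    then show False using near[of 0] r1 by simp
  qed
  then show ?thesis using that germ by blast
qed

lemma (in analytic_line_family) ln_abs_weak_dirderiv_on_of_nonzero_lines:
  assumes e: "0 < e" "2 * e < \<epsilon>"
    and nonzero: "AE x in lborel. norm x < 2 * e \<longrightarrow> (\<forall>t. \<bar>t\<bar> < \<rho> \<longrightarrow> f (x + t *\<^sub>R v) \<noteq> 0)"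
    and L1: "set_integrable lborel (ball 0 e) (\<lambda>x. ln \<bar>f x\<bar>)"
      "set_integrable lborel (ball 0 e) (\<lambda>x. dirderiv v f x / f x)"
  shows "weak_dirderiv_on (ball 0 e) v (\<lambda>x. ln \<bar>f x\<bar>) (\<lambda>x. dirderiv v f x / f x)"
proof -
  obtain \<tau> where \<tau>: "0 < \<tau>" "\<tau> \<le> \<rho>" "\<tau> * norm v \<le> (2 * e) / 2"
    using exists_pos_le_scaled_norm_le[OF \<rho>_pos, of "(2 * e) / 2" v] e by auto
  have "AE x in lborel. \<forall>t. \<bar>t\<bar> < \<tau> \<longrightarrow> x + t *\<^sub>R v \<in> ball 0 e \<longrightarrow> f (x + t *\<^sub>R v) \<noteq> 0"
    using nonzero
  proof (eventually_elim, intro allI impI)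
    fix x t assume nonzero_x: "norm x < 2 * e \<longrightarrow> (\<forall>t. \<bar>t\<bar> < \<rho> \<longrightarrow> f (x + t *\<^sub>R v) \<noteq> 0)"
      and t: "\<bar>t\<bar> < \<tau>" and "x + t *\<^sub>R v \<in> ball 0 e"
    then have "norm x < 2 * e"
      using norm_add_scaleR_ge_half[of t \<tau> v "2 * e" x] \<tau>(3) by force
    then show "f (x + t *\<^sub>R v) \<noteq> 0" using nonzero_x t \<tau>(2) by auto
  qed
  moreover have "ball 0 e \<subseteq> \<Omega>" using e base_less ball_sub by force
  ultimately show ?thesis
    using ln_abs_real_analytic_line[OF analytic]
    by (intro weak_dirderiv_on_of_lines[OF \<tau>(1) L1]) (auto elim!: eventually_mono)
qed

context analytic_germ
begin

lemma grad_f: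
  assumes "norm x < r"
  shows "(f has_derivative (\<lambda>h. grad f x \<bullet> h)) (at x)" "dirderiv v f x = grad f x \<bullet> v"
proof -
  have "real_analytic_on f (ball 0 r)" "x \<in> ball 0 r"
    using real_analytic_on_subset[OF analytic ball_sub] assms by auto
  then show "(f has_derivative (\<lambda>h. grad f x \<bullet> h)) (at x)" "dirderiv v f x = grad f x \<bullet> v"
    by (auto intro: real_analytic_on_has_derivative real_analytic_on_dirderiv_eq_inner)
qed

lemma pseries_nonzero: "norm x < r \<Longrightarrow> f x \<noteq> 0 \<Longrightarrow> pseries c (cvec x) \<noteq> 0"
  by (metis of_real_f of_real_eq_0_iff)

lemma set_integrable_ln_abs:
  assumes x0: "norm x0 < r" "f x0 \<noteq> 0"
  obtains e where "0 < e" "e < r" "set_integrable lborel (ball 0 e) (\<lambda>x. ln \<bar>f x\<bar>)"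
    "AE x in lborel. norm x < e \<longrightarrow> f x \<noteq> 0"
proof -
  have "pseries c (cvec x0) \<noteq> 0" by (rule pseries_nonzero[OF x0])
  then obtain e where e: "0 < e" "e < r"
    and finite_series: "(\<integral>\<^sup>+x\<in>ball 0 e. abs_ln (norm (pseries c (cvec x))) \<partial>lborel) < \<infinity>"
    using line_holomorphic_nn_integral_abs_ln_finite
        [OF line_holomorphic_pseries[OF series_converges] x0(1)]
    by blast
  have norm_series: "norm (pseries c (cvec x)) = \<bar>f x\<bar>" if "norm x < e" for x
    using of_real_f[of x] that e(2) by (metis norm_of_real order_less_trans real_norm_def)
  have "(\<integral>\<^sup>+x\<in>ball 0 e. abs_ln \<bar>f x\<bar> \<partial>lborel) =
      (\<integral>\<^sup>+x\<in>ball 0 e. abs_ln (norm (pseries c (cvec x))) \<partial>lborel)"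
    by (intro nn_integral_cong) (auto simp: indicator_def norm_series)
  with finite_series have finite_f: "(\<integral>\<^sup>+x\<in>ball 0 e. abs_ln \<bar>f x\<bar> \<partial>lborel) < \<infinity>" by simp
  have f_measurable: "set_borel_measurable borel (ball 0 e) f"
    using e(2) ball_sub by (intro set_borel_measurable_real_analytic[OF analytic]) auto
  then have "(\<lambda>x. abs_ln \<bar>f x\<bar> * indicator (ball 0 e) x) \<in> borel_measurable borel"
    by (rule borel_measurable_comp_indicator) auto
  then have "AE x in lborel. abs_ln \<bar>f x\<bar> * indicator (ball 0 e) x \<noteq> \<infinity>"
    using finite_f by (intro nn_integral_PInf_AE) auto
  then have "AE x in lborel. norm x < e \<longrightarrow> f x \<noteq> 0" by eventually_elim (auto simp: abs_ln_def)
  moreover have "set_integrable lborel (ball 0 e) (\<lambda>x. ln \<bar>f x\<bar>)"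
    unfolding set_integrable_def
  proof (rule integrableI_bounded)
    have [measurable]: "(\<lambda>x. indicator (ball 0 e) x *\<^sub>R f x) \<in> borel_measurable borel"
      using f_measurable by (simp add: set_borel_measurable_def)
    have "(\<lambda>x. indicator (ball 0 e) x *\<^sub>R ln \<bar>f x\<bar>) = (\<lambda>x. ln \<bar>indicator (ball 0 e) x *\<^sub>R f x\<bar>)"
      by (auto simp: indicator_def fun_eq_iff)
    also have "\<dots> \<in> borel_measurable borel" by measurable
    finally show "(\<lambda>x. indicator (ball 0 e) x *\<^sub>R ln \<bar>f x\<bar>) \<in> borel_measurable lborel" by simp
    have "(\<integral>\<^sup>+x. ennreal (norm (indicator (ball 0 e) x *\<^sub>R ln \<bar>f x\<bar>)) \<partial>lborel) \<le>
        (\<integral>\<^sup>+x\<in>ball 0 e. abs_ln \<bar>f x\<bar> \<partial>lborel)"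
      by (intro nn_integral_mono) (auto simp: indicator_def abs_ln_def)
    then show "(\<integral>\<^sup>+x. ennreal (norm (indicator (ball 0 e) x *\<^sub>R ln \<bar>f x\<bar>)) \<partial>lborel) < \<infinity>"
      using finite_f by (rule order_le_less_trans)
  qed
  ultimately show ?thesis using that e by blast
qed

definition has_log_weak_dirderiv :: "real \<Rightarrow> real ^ 'n \<Rightarrow> bool" where
  "has_log_weak_dirderiv e v \<longleftrightarrow>
      weak_dirderiv_on (ball 0 e) v (\<lambda>x. ln \<bar>f x\<bar>) (\<lambda>x. dirderiv v f x / f x)"

lemma has_log_weak_dirderiv_mono:
  "has_log_weak_dirderiv e v \<Longrightarrow> e' \<le> e \<Longrightarrow> has_log_weak_dirderiv e' v"
  unfolding has_log_weak_dirderiv_def by (erule weak_dirderiv_on_subset) auto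

lemma exists_log_weak_dirderiv_nonzero_direction:
  assumes v: "norm v < r" "f v \<noteq> 0"
  shows "\<exists>e>0. e < r \<and> has_log_weak_dirderiv e v"
proof -
  have "pseries c (cvec v) \<noteq> 0" by (rule pseries_nonzero[OF v])
  then obtain \<rho> m M \<epsilon> where "0 < \<epsilon>" "0 < \<rho>" "\<rho> < 1/2" "\<epsilon> + 5 * \<rho> * norm v < r"
    "\<And>z. norm z < \<epsilon> \<Longrightarrow> bounded_disc_function (\<lambda>t. pseries c (z + t *s cvec v)) \<rho> m M"
    by (rule line_holomorphic_bounded_disc_functions
          [OF line_holomorphic_pseries[OF series_converges] v(1)
            _ half_gt_zero[OF zero_less_one]]) (rule that; assumption)
  then interpret analytic_line_family c r \<rho> m M \<epsilon> v f \<Omega>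
    by (intro analytic_line_family.intro line_family.intro analytic_germ_axioms series_converges)
       auto
  obtain e1 where e1: "0 < e1" "2 * e1 < \<epsilon>"
    and nonzero: "AE x in lborel. norm x < 2 * e1 \<longrightarrow> (\<forall>t. \<bar>t\<bar> < \<rho> \<longrightarrow> f (x + t *\<^sub>R v) \<noteq> 0)"
    and log_deriv: "set_integrable lborel (ball 0 e1) (\<lambda>x. dirderiv v f x / f x)"
    by (rule set_integrable_log_dirderiv) (rule that; assumption)
  obtain e2 where e2: "0 < e2" "set_integrable lborel (ball 0 e2) (\<lambda>x. ln \<bar>f x\<bar>)"
    using set_integrable_ln_abs[OF v] by blast
  define e where "e = min e1 e2"
  have "weak_dirderiv_on (ball 0 e) v (\<lambda>x. ln \<bar>f x\<bar>) (\<lambda>x. dirderiv v f x / f x)"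
  proof (rule ln_abs_weak_dirderiv_on_of_nonzero_lines)
    show "AE x in lborel. norm x < 2 * e \<longrightarrow> (\<forall>t. \<bar>t\<bar> < \<rho> \<longrightarrow> f (x + t *\<^sub>R v) \<noteq> 0)"
      using nonzero by eventually_elim (simp add: e_def)
    show "set_integrable lborel (ball 0 e) (\<lambda>x. ln \<bar>f x\<bar>)"
      by (rule set_integrable_subset[OF e2(2)]) (auto simp: e_def)
    show "set_integrable lborel (ball 0 e) (\<lambda>x. dirderiv v f x / f x)"
      by (rule set_integrable_subset[OF log_deriv]) (auto simp: e_def)
  qed (use e1 e2(1) in \<open>auto simp: e_def\<close>)
  then show ?thesis
    using e1 e2(1) base_less by (intro exI[of _ e]) (auto simp: has_log_weak_dirderiv_def e_def)
qed

text \<open>Any direction is a combination of \<open>x0\<close> and a vector near \<open>x0\<close>, where \<open>f\<close> does not vanish.\<close>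

lemma exists_log_weak_dirderiv:
  assumes x0: "norm x0 < r" "f x0 \<noteq> 0"
  shows "\<exists>e>0. has_log_weak_dirderiv e v"
proof -
  have "isCont f x0" using x0 ball_sub by (intro real_analytic_on_isCont[OF analytic]) auto
  then have "\<forall>\<^sub>F x in nhds x0. f x \<noteq> 0" using x0(2) by (rule eventually_nonzero_isCont)
  moreover have "\<forall>\<^sub>F x in nhds x0. x \<in> ball 0 r" using x0 by (intro eventually_nhds_in_open) auto
  ultimately have "\<forall>\<^sub>F x in nhds (x0 + 0 *\<^sub>R v). norm x < r \<and> f x \<noteq> 0"
    by (auto elim: eventually_elim2)
  then have "\<forall>\<^sub>F s in nhds 0. norm (x0 + s *\<^sub>R v) < r \<and> f (x0 + s *\<^sub>R v) \<noteq> 0"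
    by (rule eventually_nhds_line)
  then have "\<forall>\<^sub>F s in at_right 0. norm (x0 + s *\<^sub>R v) < r \<and> f (x0 + s *\<^sub>R v) \<noteq> 0"
    by (simp add: eventually_at_filter eventually_mono)
  then obtain s where s: "s > 0" and w: "norm (x0 + s *\<^sub>R v) < r" "f (x0 + s *\<^sub>R v) \<noteq> 0"
    using eventually_happens'[OF trivial_limit_at_right_real
        eventually_conj[OF _ eventually_at_right_less[of 0]]]
    by blast
  obtain e1 e2 where e: "e1 > 0" "e1 < r" "has_log_weak_dirderiv e1 x0"
      "e2 > 0" "has_log_weak_dirderiv e2 (x0 + s *\<^sub>R v)"
    using exists_log_weak_dirderiv_nonzero_direction x0 w by metis
  define e where "e = min e1 e2"
  have "has_log_weak_dirderiv e x0" "has_log_weak_dirderiv e (x0 + s *\<^sub>R v)"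
    using e by (auto simp: e_def elim: has_log_weak_dirderiv_mono)
  then have "weak_dirderiv_on (ball 0 e)
      ((1/s) *\<^sub>R (x0 + s *\<^sub>R v) + (- (1/s)) *\<^sub>R x0) (\<lambda>x. ln \<bar>f x\<bar>)
      (\<lambda>x. (1/s) * (dirderiv (x0 + s *\<^sub>R v) f x / f x) + (- (1/s)) * (dirderiv x0 f x / f x))"
    unfolding has_log_weak_dirderiv_def by (intro weak_dirderiv_on_linear_combination)
  moreover have "(1/s) *\<^sub>R (x0 + s *\<^sub>R v) + (- (1/s)) *\<^sub>R x0 = v"
    using s by (simp add: algebra_simps)
  moreover have "(1/s) * (dirderiv (x0 + s *\<^sub>R v) f x / f x) + (- (1/s)) * (dirderiv x0 f x / f x) =
      dirderiv v f x / f x" if "x \<in> ball 0 e" for x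
    using that e(2) s
    by (simp add: e_def grad_f(2) inner_add_right add_divide_distrib ring_distribs)
  ultimately have "has_log_weak_dirderiv e v"
    unfolding has_log_weak_dirderiv_def by (auto intro: weak_dirderiv_on_cong)
  then show ?thesis using e by (intro exI[of _ e]) (auto simp: e_def)
qed

lemma exists_ball_log_weak_gradient:
  assumes x0: "norm x0 < r" "f x0 \<noteq> 0"
  obtains e where "0 < e" "e < r" "AE x in lborel. norm x < e \<longrightarrow> f x \<noteq> 0"
    "\<And>i. weak_dirderiv_on (ball 0 e) (axis i 1) (\<lambda>x. ln \<bar>f x\<bar>) (\<lambda>x. dirderiv (axis i 1) f x / f x)"
proof -
  obtain d where d: "0 < d" "d < r" "AE x in lborel. norm x < d \<longrightarrow> f x \<noteq> 0"
    using set_integrable_ln_abs[OF x0] by blast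
  have "\<forall>i. \<exists>e>0. has_log_weak_dirderiv e (axis i 1)" using exists_log_weak_dirderiv[OF x0] by blast
  then obtain \<eta> where \<eta>: "\<And>i. \<eta> i > 0" "\<And>i. has_log_weak_dirderiv (\<eta> i) (axis i 1)" by metis
  define e where "e = Min (insert d (range \<eta>))"
  have "0 < e" using d(1) \<eta>(1) by (auto simp: e_def)
  moreover have "e \<le> d" "e \<le> \<eta> i" for i
    unfolding e_def by (auto intro!: Min_le simp del: Min_insert)
  ultimately have e: "0 < e" "e \<le> d" "\<And>i. e \<le> \<eta> i" by blast+
  have "AE x in lborel. norm x < e \<longrightarrow> f x \<noteq> 0" using d(3) by eventually_elim (use e(2) in auto)
  moreover have "has_log_weak_dirderiv e (axis i 1)" for i
    by (rule has_log_weak_dirderiv_mono[OF \<eta>(2) e(3)])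
  ultimately show ?thesis using that[of e] e d(2) by (simp add: has_log_weak_dirderiv_def)
qed

end

theorem theorem1p1:
  fixes f :: "real^'n \<Rightarrow> real" and \<Omega> :: "(real^'n) set"
  assumes n2: "CARD('n) \<ge> 2"
    and "open \<Omega>" and "0 \<in> \<Omega>"
    and ana: "real_analytic_on f \<Omega>"
    and codim: "analytic_codim_at {x\<in>\<Omega>. f x = 0} 0 \<ge> 2"
  shows "\<exists>U. open U \<and> 0 \<in> U \<and> U \<subseteq> \<Omega> \<and>
           L1_on U (\<lambda>x. ln \<bar>f x\<bar>) \<and>
           (\<exists>G :: real^'n \<Rightarrow> real^'n.
              (\<forall>i. L1_on U (\<lambda>x. G x $ i)) \<and>
              weak_gradient_on U (\<lambda>x. ln \<bar>f x\<bar>) G \<and>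
              (AE x in lebesgue. x \<in> U \<longrightarrow>
                 f x \<noteq> 0 \<and> (f has_derivative (\<lambda>h. (f x *\<^sub>R G x) \<bullet> h)) (at x)))"
proof -
  obtain c r x0 where "analytic_germ c r f \<Omega>" and x0: "norm x0 < r" "f x0 \<noteq> 0"
    using analytic_germ_of_codim_ge_2[OF \<open>open \<Omega>\<close> \<open>0 \<in> \<Omega>\<close> ana codim] by blast
  then interpret analytic_germ c r f \<Omega> by simp
  obtain e where e: "0 < e" "e < r" and nonzero: "AE x in lborel. norm x < e \<longrightarrow> f x \<noteq> 0"
    and weak: "\<And>i. weak_dirderiv_on (ball 0 e) (axis i 1)
        (\<lambda>x. ln \<bar>f x\<bar>) (\<lambda>x. dirderiv (axis i 1) f x / f x)"
    by (rule exists_ball_log_weak_gradient[OF x0]) (rule that; assumption)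
  define G where "G = (\<lambda>x. (1 / f x) *\<^sub>R grad f x)"
  have G: "dirderiv (axis i 1) f x / f x = G x $ i" for x i by (simp add: G_def grad_def)
  have "AE x in lebesgue. x \<in> ball 0 e \<longrightarrow> f x \<noteq> 0 \<and>
      (f has_derivative (\<lambda>h. (f x *\<^sub>R G x) \<bullet> h)) (at x)"
    using AE_completion[OF nonzero] by eventually_elim (use grad_f(1) e in \<open>auto simp: G_def\<close>)
  moreover have "\<forall>i. L1_on (ball 0 e) (\<lambda>x. G x $ i)" "weak_gradient_on (ball 0 e) (\<lambda>x. ln \<bar>f x\<bar>) G"
    using weak unfolding G
    by (auto intro: L1_on_of_lborel weak_dirderiv_onD(2) weak_gradient_on_of_partials)
  moreover have "ball 0 e \<subseteq> \<Omega>" using e ball_sub by auto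
  ultimately show ?thesis
    using e L1_on_of_lborel[OF weak_dirderiv_onD(1)[OF weak]] by (intro exI[of _ "ball 0 e"]) auto
qed

end
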